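(* For $n\ge 1$, the union of polyhedral fans $\mathcal{M}_n=\coprod_{[G]}\mathcal{M}_G\subset\mathbb{T}^{E(\kappa_n)}$, where $[G]$ ranges over isomorphism classes of directed acyclic graphs on $n$ nodes, is a polyhedral subspace of $\mathbb{T}^{E(\kappa_n)}$ and is a moduli space for $(n-1)$-dimensional polytropes associated to labeled DAGs; that is, every cone of $\mathcal{M}_n$ forms an equivalence class of such polytropes up to tropical equivalence.
   Context: Min-plus conventions: $\mathbb{T}=\mathbb{R}\cup\{\infty\}$. $\kappa_n$ is the complete DAG on $[n]$ with edges $j\to i$ for all $j<i$; $\mathbb{T}^{E(\kappa_n)}$ has the usual topology of $(\mathbb{R}\cup\{\infty\})^{E(\kappa_n)}$, and weights on a DAG $G\subseteq\kappa_n$ are viewed as points of $\mathbb{T}^{E(\kappa_n)}$ with coordinate $\infty$ exactly on non-edges of $G$. A DAG $G=([n],E)$ is labeled so that $j\to i\in E$ implies $j<i$; its weighted adjacency matrix for $w\in\mathbb{R}^E$ is $C$ with $c_{ij}=w(j\to i)$ on edges, $c_{ii}=0$, $\infty$ otherwise; the polytrope associated to it is $\mathrm{Q}(C)=\{x\in\mathbb{R}^n/\mathbb{R}\mathbf{1}: x_i-x_j\le c_{ij}\ \forall i\neq j\}$. The weighted transitive reduction $G^\flat_w$ is the subgraph of edges $j\to i$ that are the unique shortest directed path from $j$ to $i$. The open polytrope region is $K_G=\{w\in\mathbb{R}^E : G^\flat_w=G\}$, equivalently the set of $w$ with $w(j\to i)<\sum_{k} w(v_k\to v_{k+1})$ for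 every directed path $j=v_0,\dots,v_\ell=i$ in $G$ other than the edge $j\to i$. The fundamental polytope of $G$ is the point configuration $A_G=\{0\}\cup\{e_i-e_j : j\to i\in E\}\subseteq\mathbb{R}^n$; for a subdivision $S$ of $A_G$, its secondary cone is the set of height functions $h\in\mathbb{R}^{A_G}$ such that $S$ refines the regular subdivision induced by $h$, and the secondary fan $\Sigma(A_G)$ is the collection of secondary cones. Heights on $A_G$ are written $(h_0,w)\in\mathbb{R}\times\mathbb{R}^E$ ($h_0$ at $0$, $w(j\to i)$ at $e_i-e_j$). The open stratum $\mathcal{M}_G$ is the polyhedral fan obtained by restricting $\Sigma(A_G)$ to $\{0\}\times K_G$, identified with a subset of $K_G\subseteq\mathbb{T}^{E(\kappa_n)}$. Point configurations $V,W$ (and the tropical polyhedra they generate) are tropically equivalent if there are permutations of the points and coordinates inducing an isomorphism of the posets of affine covectors, where the affine covector of $p$ relative to $V=(v^{(1)},\dots,v^{(n)})$ records the pairs $(j,i)$ with $v^{(j)}_i\neq\infty$ such that $p_i-v^{(j)}_i=\max_{\ell: v^{(j)}_\ell\ne\infty}(p_\ell-v^{(j)}_\ell)$.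
   Formalization: Cones are taken relatively open; distinct cones can be tropically equivalent, so "every cone forms an equivalence class" becomes: each cone lies in one class, and points are equivalent iff they share G and, up to an automorphism of G, the cells through the origin of the subdivision of A_G. *)

theory Defs
  imports "HOL-Analysis.Analysis"
begin

text \<open>
  The node set \<open>[n]\<close> is a type \<open>'n\<close> of class finite and linorder; being nonempty it covers exactly
  the cases \<open>n \<ge> 1\<close>. A pair \<open>(j, i)\<close> stands for the edge \<open>j \<rightarrow> i\<close>.
\<close>

section \<open>Labeled DAGs, weights and the min-plus space\<close>

definition complete_dag :: "('n::linorder \<times> 'n) set" where
  "complete_dag = {(j, i). j < i}"

definition labeled_dags :: "('n::linorder \<times> 'n) set set" where
  "labeled_dags = Pow complete_dag"

definition dag_iso :: "('n \<times> 'n) set \<Rightarrow> ('n \<times> 'n) set \<Rightarrow> bool" where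
  "dag_iso G H \<longleftrightarrow> (\<exists>\<pi>. bij \<pi> \<and> map_prod \<pi> \<pi> ` G = H)"

text \<open>A choice of one labeled DAG from each isomorphism class.\<close>

definition dag_representatives :: "('n::linorder \<times> 'n) set set \<Rightarrow> bool" where
  "dag_representatives R \<longleftrightarrow> R \<subseteq> labeled_dags \<and> (\<forall>G\<in>labeled_dags. \<exists>!H. H \<in> R \<and> dag_iso G H)"

text \<open>\<open>\<real>\<^sup>E\<close>, as a coordinate subspace of the space of all functions on pairs of nodes.\<close>

definition weights :: "('n::finite \<times> 'n) set \<Rightarrow> (real ^ ('n \<times> 'n)) set" where
  "weights G = {w. \<forall>e. e \<notin> G \<longrightarrow> w $ e = 0}"

definition trop_space :: "('n::linorder \<times> 'n \<Rightarrow> ereal) set" where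
  "trop_space = (complete_dag \<rightarrow>\<^sub>E {x. x \<noteq> -\<infinity>})"

definition trop_point :: "('n::{finite,linorder} \<times> 'n) set \<Rightarrow> real ^ ('n \<times> 'n) \<Rightarrow> ('n \<times> 'n \<Rightarrow> ereal)" where
  "trop_point G w = (\<lambda>e\<in>complete_dag. if e \<in> G then ereal (w $ e) else \<infinity>)"

section \<open>Shortest paths and the open polytrope region\<close>

definition dpaths :: "('n \<times> 'n) set \<Rightarrow> 'n \<Rightarrow> 'n \<Rightarrow> 'n list set" where
  "dpaths G j i = {p. p \<noteq> [] \<and> hd p = j \<and> last p = i \<and> successively (\<lambda>u v. (u, v) \<in> G) p}"

definition path_weight :: "real ^ ('n::finite \<times> 'n) \<Rightarrow> 'n list \<Rightarrow> real" where
  "path_weight w p = (\<Sum>e\<leftarrow>zip p (tl p). w $ e)"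

definition weighted_transitive_reduction ::
  "('n::finite \<times> 'n) set \<Rightarrow> real ^ ('n \<times> 'n) \<Rightarrow> ('n \<times> 'n) set" where
  "weighted_transitive_reduction G w =
     {(j, i) \<in> G. \<forall>p \<in> dpaths G j i. p \<noteq> [j, i] \<longrightarrow> path_weight w [j, i] < path_weight w p}"

definition polytrope_region :: "('n::finite \<times> 'n) set \<Rightarrow> (real ^ ('n \<times> 'n)) set" where
  "polytrope_region G = {w \<in> weights G. weighted_transitive_reduction G w = G}"

section \<open>Polytropes\<close>

definition adjacency :: "('n::finite \<times> 'n) set \<Rightarrow> real ^ ('n \<times> 'n) \<Rightarrow> 'n \<Rightarrow> 'n \<Rightarrow> ereal" where
  "adjacency G w i j =
     (if i = j then 0 else if (j, i) \<in> G then ereal (w $ (j, i)) else \<infinity>)"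

text \<open>A subset of \<open>\<real>\<^sup>n / \<real>\<one>\<close> is represented by its preimage in \<open>\<real>\<^sup>n\<close>.\<close>

definition polytrope :: "('n::finite \<times> 'n) set \<Rightarrow> real ^ ('n \<times> 'n) \<Rightarrow> (real ^ 'n) set" where
  "polytrope G w = {x. \<forall>i j. i \<noteq> j \<longrightarrow> ereal (x $ i - x $ j) \<le> adjacency G w i j}"

text \<open>The dimension in \<open>\<real>\<^sup>n / \<real>\<one>\<close>, which is one less than that of the preimage.\<close>

definition polytrope_dim :: "('n::finite \<times> 'n) set \<Rightarrow> real ^ ('n \<times> 'n) \<Rightarrow> int" where
  "polytrope_dim G w = aff_dim (polytrope G w) - 1"

text \<open>
  A point configuration \<open>V\<close> has the \<open>n\<close> points \<open>V j\<close>, with coordinates \<open>V j i\<close> in \<open>\<real> \<union> {\<infinity>}\<close>. It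
  generates the set of finite points that are min-plus combinations of its points. The polytrope of
  \<open>(G, w)\<close> is generated by the columns of the Kleene star of its adjacency matrix.
\<close>

definition tropical_span :: "('n::finite \<Rightarrow> 'n \<Rightarrow> ereal) \<Rightarrow> (real ^ 'n) set" where
  "tropical_span V = {x. \<exists>l :: 'n \<Rightarrow> ereal. (\<forall>j. l j \<noteq> -\<infinity>) \<and> (\<forall>i. ereal (x $ i) = (INF j. l j + V j i))}"

definition kleene_columns :: "('n::finite \<times> 'n) set \<Rightarrow> real ^ ('n \<times> 'n) \<Rightarrow> 'n \<Rightarrow> 'n \<Rightarrow> ereal" where
  "kleene_columns G w j i = (INF p \<in> dpaths G j i. ereal (path_weight w p))"

lemma path_weight_ge:
  assumes "x \<in> polytrope G w" "p \<noteq> []" "successively (\<lambda>u v. (u, v) \<in> G) p"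
    and "\<And>a. (a, a) \<notin> G"
  shows "x $ last p - x $ hd p \<le> path_weight w p"
  using assms(2,3)
proof (induction p rule: induct_list012)
  case (3 a b p)
  have "a \<noteq> b" "(a, b) \<in> G" using 3 assms(4) by auto
  then have "ereal (x $ b - x $ a) \<le> adjacency G w b a"
    using assms(1) by (auto simp: polytrope_def)
  then have "x $ b - x $ a \<le> w $ (a, b)"
    using \<open>a \<noteq> b\<close> \<open>(a, b) \<in> G\<close> by (simp add: adjacency_def)
  moreover have "x $ last (b # p) - x $ b \<le> path_weight w (b # p)"
    using "3.IH"(2) "3.prems" by simp
  ultimately show ?case by (simp add: path_weight_def)
qed (auto simp: path_weight_def)

lemma path_weight_snoc:
  "p \<noteq> [] \<Longrightarrow> path_weight w (p @ [i]) = path_weight w p + w $ (last p, i)"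
proof (induction p rule: induct_list012)
  case (3 a b p)
  then show ?case by (simp add: path_weight_def)
qed (auto simp: path_weight_def)

lemma tropical_span_kleene_columns:
  assumes G: "G \<in> labeled_dags"
  shows "tropical_span (kleene_columns G w) = polytrope G w"
proof
  have irr: "(a, a) \<notin> G" for a
    using G by (auto simp: labeled_dags_def complete_dag_def)
  show "polytrope G w \<subseteq> tropical_span (kleene_columns G w)"
  proof
    fix x assume x: "x \<in> polytrope G w"
    have eq: "ereal (x $ i) = (INF j. ereal (x $ j) + kleene_columns G w j i)" for i
    proof (rule antisym)
      show "ereal (x $ i) \<le> (INF j. ereal (x $ j) + kleene_columns G w j i)"
      proof (rule INF_greatest)
        fix j
        have "ereal (x $ i - x $ j) \<le> kleene_columns G w j i"
          unfolding kleene_columns_def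
          using path_weight_ge[OF x _ _ irr] by (intro INF_greatest) (auto simp: dpaths_def)
        then have "ereal (x $ j) + ereal (x $ i - x $ j) \<le> ereal (x $ j) + kleene_columns G w j i"
          by (rule add_left_mono)
        then show "ereal (x $ i) \<le> ereal (x $ j) + kleene_columns G w j i" by simp
      qed
      have "kleene_columns G w i i \<le> ereal (path_weight w [i])"
        unfolding kleene_columns_def by (rule INF_lower) (simp add: dpaths_def)
      then have "ereal (x $ i) + kleene_columns G w i i \<le> ereal (x $ i) + 0"
        by (intro add_left_mono) (simp add: path_weight_def zero_ereal_def)
      then show "(INF j. ereal (x $ j) + kleene_columns G w j i) \<le> ereal (x $ i)"
        by (intro INF_lower2[of i]) auto
    qed
    show "x \<in> tropical_span (kleene_columns G w)"
      unfolding tropical_span_def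
    proof (intro CollectI exI[of _ "\<lambda>j. ereal (x $ j)"] conjI allI)
      show "ereal (x $ j) \<noteq> -\<infinity>" for j by simp
      show "ereal (x $ i) = (INF j. ereal (x $ j) + kleene_columns G w j i)" for i by (rule eq)
    qed
  qed
  show "tropical_span (kleene_columns G w) \<subseteq> polytrope G w"
  proof
    fix x assume "x \<in> tropical_span (kleene_columns G w)"
    then obtain l :: "'a \<Rightarrow> ereal"
      where l: "\<And>i. ereal (x $ i) = (INF j. l j + kleene_columns G w j i)"
      unfolding tropical_span_def by auto
    have "x $ i - x $ k \<le> w $ (k, i)" if e: "(k, i) \<in> G" for i k
    proof -
      have "kleene_columns G w j i \<le> kleene_columns G w j k + ereal (w $ (k, i))" for j
      proof -
        have "kleene_columns G w j i - ereal (w $ (k, i)) \<le> ereal (path_weight w p)"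
          if "p \<in> dpaths G j k" for p
        proof -
          have "p @ [i] \<in> dpaths G j i"
            using that e by (auto simp: dpaths_def successively_append_iff)
          then have "kleene_columns G w j i \<le> ereal (path_weight w (p @ [i]))"
            unfolding kleene_columns_def by (rule INF_lower)
          also have "path_weight w (p @ [i]) = path_weight w p + w $ (k, i)"
            using that path_weight_snoc[of p w i] by (auto simp: dpaths_def)
          finally show ?thesis by (subst ereal_minus_le) auto
        qed
        then have "kleene_columns G w j i - ereal (w $ (k, i)) \<le> kleene_columns G w j k"
          unfolding kleene_columns_def[of G w j k] by (intro INF_greatest) auto
        then show ?thesis by (subst (asm) ereal_minus_le) auto
      qed
      then have "ereal (x $ i) \<le> l j + (kleene_columns G w j k + ereal (w $ (k, i)))" for j
        unfolding l by (intro INF_lower2[of j] add_left_mono) auto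
      then have "ereal (x $ i) - ereal (w $ (k, i)) \<le> l j + kleene_columns G w j k" for j
        by (subst ereal_minus_le) (auto simp: add.assoc)
      then have "ereal (x $ i) - ereal (w $ (k, i)) \<le> ereal (x $ k)"
        unfolding l[of k] by (intro INF_greatest) auto
      then show ?thesis by simp
    qed
    then show "x \<in> polytrope G w"
      by (auto simp: polytrope_def adjacency_def)
  qed
qed

section \<open>Tropical equivalence\<close>

definition affine_covector :: "('n::finite \<Rightarrow> 'n \<Rightarrow> ereal) \<Rightarrow> real ^ 'n \<Rightarrow> ('n \<times> 'n) set" where
  "affine_covector V p =
     {(j, i). V j i \<noteq> \<infinity> \<and>
        p $ i - real_of_ereal (V j i) = (MAX l\<in>{l. V j l \<noteq> \<infinity>}. p $ l - real_of_ereal (V j l))}"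

definition affine_covectors :: "('n::finite \<Rightarrow> 'n \<Rightarrow> ereal) \<Rightarrow> ('n \<times> 'n) set set" where
  "affine_covectors V = range (affine_covector V)"

text \<open>
  Covectors are ordered by inclusion. Taking images under a bijection of \<open>[n] \<times> [n]\<close> preserves and
  reflects inclusion, so such a map between the sets of covectors that is onto is an isomorphism of
  posets.
\<close>

definition tropically_equivalent ::
  "('n::finite \<Rightarrow> 'n \<Rightarrow> ereal) \<Rightarrow> ('n \<Rightarrow> 'n \<Rightarrow> ereal) \<Rightarrow> bool" where
  "tropically_equivalent V W \<longleftrightarrow>
     (\<exists>\<tau> \<sigma>. bij \<tau> \<and> bij \<sigma> \<and> (\<lambda>B. map_prod \<tau> \<sigma> ` B) ` affine_covectors V = affine_covectors W)"

definition equivalent_polytropes ::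
  "('n::finite \<times> 'n) set \<Rightarrow> real ^ ('n \<times> 'n) \<Rightarrow> ('n \<times> 'n) set \<Rightarrow> real ^ ('n \<times> 'n) \<Rightarrow> bool" where
  "equivalent_polytropes G w H v \<longleftrightarrow>
     tropically_equivalent (kleene_columns G w) (kleene_columns H v)"

section \<open>Subdivisions and the secondary fan of a point configuration\<close>

text \<open>A cell is the set of points of the configuration that it uses, not just a polytope.\<close>

definition subdivision :: "'a::euclidean_space set \<Rightarrow> 'a set set \<Rightarrow> bool" where
  "subdivision A S \<longleftrightarrow>
     (\<forall>B\<in>S. B \<noteq> {} \<and> B \<subseteq> A) \<and>
     (\<forall>B\<in>S. \<forall>F. F face_of convex hull B \<and> F \<noteq> {} \<longrightarrow> B \<inter> F \<in> S) \<and>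
     (\<Union>B\<in>S. convex hull B) = convex hull A \<and>
     (\<forall>B\<in>S. \<forall>B'\<in>S. B \<noteq> B' \<longrightarrow>
        rel_interior (convex hull B) \<inter> rel_interior (convex hull B') = {})"

text \<open>The cells are the sets of points lying on the lower faces of the lifted configuration.\<close>

definition regular_subdivision :: "'a::euclidean_space set \<Rightarrow> ('a \<Rightarrow> real) \<Rightarrow> 'a set set" where
  "regular_subdivision A h =
     {B. B \<noteq> {} \<and> (\<exists>u c. (\<forall>a\<in>A. u \<bullet> a + c \<le> h a) \<and> B = {a\<in>A. u \<bullet> a + c = h a})}"

definition refines :: "'a set set \<Rightarrow> 'a set set \<Rightarrow> bool" where
  "refines S T \<longleftrightarrow> (\<forall>B\<in>S. \<exists>B'\<in>T. B \<subseteq> B')"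

definition secondary_cone :: "'a::euclidean_space set \<Rightarrow> 'a set set \<Rightarrow> ('a \<Rightarrow> real) set" where
  "secondary_cone A S = {h \<in> A \<rightarrow>\<^sub>E UNIV. refines S (regular_subdivision A h)}"

definition secondary_fan :: "'a::euclidean_space set \<Rightarrow> ('a \<Rightarrow> real) set set" where
  "secondary_fan A = {secondary_cone A S | S. subdivision A S}"

section \<open>The strata and the moduli space\<close>

definition edge_vector :: "'n::finite \<times> 'n \<Rightarrow> real ^ 'n" where
  "edge_vector = (\<lambda>(j, i). axis i 1 - axis j 1)"

definition fundamental_polytope :: "('n::finite \<times> 'n) set \<Rightarrow> (real ^ 'n) set" where
  "fundamental_polytope G = insert 0 (edge_vector ` G)"

definition heights ::
  "('n::finite \<times> 'n) set \<Rightarrow> real \<Rightarrow> real ^ ('n \<times> 'n) \<Rightarrow> (real ^ 'n \<Rightarrow> real)" where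
  "heights G h0 w =
     (\<lambda>a\<in>fundamental_polytope G. if a = 0 then h0 else w $ the_inv_into G edge_vector a)"

text \<open>The cones of the restricted fan; they are closed relative to the open polytrope region.\<close>

definition stratum_cones :: "('n::finite \<times> 'n) set \<Rightarrow> (real ^ ('n \<times> 'n)) set set" where
  "stratum_cones G =
     {{w \<in> polytrope_region G. heights G 0 w \<in> \<sigma>} | \<sigma>.
        \<sigma> \<in> secondary_fan (fundamental_polytope G)} - {{}}"

definition open_stratum :: "('n::{finite,linorder} \<times> 'n) set \<Rightarrow> ('n \<times> 'n \<Rightarrow> ereal) set" where
  "open_stratum G = trop_point G ` \<Union> (stratum_cones G)"

definition moduli_space :: "('n::{finite,linorder} \<times> 'n) set set \<Rightarrow> ('n \<times> 'n \<Rightarrow> ereal) set" where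
  "moduli_space R = (\<Union>G\<in>R. open_stratum G)"

text \<open>
  As subsets of the disjoint union, the cones are taken relatively open: a closed cone also contains
  its proper faces, along which the combinatorics changes.
\<close>

definition moduli_cones :: "('n::{finite,linorder} \<times> 'n) set set \<Rightarrow> ('n \<times> 'n \<Rightarrow> ereal) set set" where
  "moduli_cones R = {trop_point G ` rel_interior \<sigma> | G \<sigma>. G \<in> R \<and> \<sigma> \<in> stratum_cones G}"

definition polyhedral_fan :: "'a::euclidean_space set set \<Rightarrow> bool" where
  "polyhedral_fan \<F> \<longleftrightarrow>
     finite \<F> \<and>
     (\<forall>\<sigma>\<in>\<F>. \<sigma> \<noteq> {} \<and> polyhedron \<sigma> \<and> cone \<sigma>) \<and>
     (\<forall>\<sigma>\<in>\<F>. \<forall>F. F face_of \<sigma> \<and> F \<noteq> {} \<longrightarrow> F \<in> \<F>) \<and>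
     (\<forall>\<sigma>\<in>\<F>. \<forall>\<tau>\<in>\<F>. \<sigma> \<inter> \<tau> face_of \<sigma> \<and> \<sigma> \<inter> \<tau> face_of \<tau>)"

text \<open>A fan restricted to a set \<open>U\<close>: the nonempty traces on \<open>U\<close> of the cones of a polyhedral fan.\<close>

definition restricted_polyhedral_fan :: "'a::euclidean_space set \<Rightarrow> 'a set set \<Rightarrow> bool" where
  "restricted_polyhedral_fan U \<C> \<longleftrightarrow>
     (\<exists>\<F>. polyhedral_fan \<F> \<and> \<C> = (\<lambda>\<sigma>. \<sigma> \<inter> U) ` \<F> - {{}})"

text \<open>
  The min-plus space is the disjoint union of the strata on which exactly the coordinates in a set
  \<open>F\<close> are finite, each a copy of \<open>\<real>\<^sup>F\<close>. A polyhedral subspace is a finite union of relatively open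
  polyhedra in these strata. Closed polyhedra would not do: the open polytrope regions are given by
  strict inequalities, so the moduli space is not closed.
\<close>

definition polyhedral_subspace :: "('n::{finite,linorder} \<times> 'n \<Rightarrow> ereal) set \<Rightarrow> bool" where
  "polyhedral_subspace X \<longleftrightarrow>
     (\<exists>\<P>. finite \<P> \<and>
        (\<forall>(F, P)\<in>\<P>. F \<subseteq> complete_dag \<and> P \<subseteq> weights F \<and> polyhedron P) \<and>
        X = (\<Union>(F, P)\<in>\<P>. trop_point F ` rel_interior P))"

section \<open>Comparing cones of one stratum\<close>

definition permute_weights :: "('n::finite \<Rightarrow> 'n) \<Rightarrow> real ^ ('n \<times> 'n) \<Rightarrow> real ^ ('n \<times> 'n)" where
  "permute_weights \<pi> w = (\<chi> e. w $ map_prod (inv \<pi>) (inv \<pi>) e)"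

text \<open>
  The cells through the origin of the subdivision of the fundamental polytope; they correspond to the
  faces of the polytrope. Distinct cones of a stratum can belong to one equivalence class for two
  reasons: an automorphism of the DAG may exchange them, and the secondary fan also separates
  subdivisions that differ only in cells away from the origin, which the polytrope does not see.
\<close>

definition origin_cells :: "('n::finite \<times> 'n) set \<Rightarrow> real ^ ('n \<times> 'n) \<Rightarrow> (real ^ 'n) set set" where
  "origin_cells G w = {B \<in> regular_subdivision (fundamental_polytope G) (heights G 0 w). 0 \<in> B}"

end

theory Submission
  imports Defs
begin

text \<open>
  Fan structure: if \<open>h\<^sub>0\<close> is a positive combination of two heights refined by a common subdivision, then
  the regular subdivision of \<open>h\<^sub>0\<close> refines those of both, because near each cell the lower hull of
  \<open>h\<^sub>0\<close> is the combination of the two lower hulls. Hence the faces of secondary cones are the cones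
  of regular subdivisions, and a relatively open cone consists of the heights with one fixed regular
  subdivision. The region \<open>K\<^sub>G\<close> is relatively open, so passing to it preserves relative interiors.

  Tropical type: for \<open>x\<close> in the polytrope let \<open>T(x)\<close> be the set of edges \<open>j \<rightarrow> i\<close> with
  \<open>x\<^sub>i - x\<^sub>j = w(j \<rightarrow> i)\<close>. The cells at the origin correspond to the sets \<open>T(x)\<close>, and the covector of
  \<open>x\<close> is the reflexive transitive closure of \<open>T(x)\<close>. Projecting an arbitrary point to the polytrope
  enlarges its covector, so all covectors are obtained from the sets \<open>T(x)\<^sup>*\<close> by passing to leading
  terms in a direction. Conversely, the reflexive covectors are exactly the \<open>T(x)\<^sup>*\<close>, and for \<open>w\<close> in
  \<open>K\<^sub>G\<close> the set \<open>T(x)\<close> is recovered as the covering relation of \<open>T(x)\<^sup>*\<close>. In an equivalence the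
  permutations of points and of coordinates coincide, as an interior point has the diagonal as its
  covector and a bijection \<open>\<rho>\<close> of a finite chain with \<open>k \<le> \<rho> k\<close> is the identity.
\<close>

section \<open>Linear images of polyhedra\<close>

text \<open>A secondary cone asks, for each cell, for the existence of an affine minorant touching
  there. It is thus a projection of a polyhedron of pairs of heights and minorants, which is why
  images of polyhedra come up at all; closedness of such images also yields a best minorant at a
  point, although the set of minorants is unbounded. Height functions do not form a Euclidean type,
  so the fan is built over a Euclidean parameter space on which the heights depend linearly; the
  origin has height 0 to make this dependence linear. The same normalization ties the cells at the
  origin to the polytrope: a minorant touching there has no constant term, and its linear part is a
  point of the polytrope. The region \<open>K\<^sub>G\<close> enters through uniqueness of shortest
  paths: a tight edge parallel to a longer tight path could not be seen in the covering relation. A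
  pair \<open>(G, w)\<close> with \<open>w\<close> outside \<open>K\<^sub>G\<close> is replaced by
  its weighted transitive reduction, which has the same shortest distances and lies in its own
  region.\<close>

lemma polyhedron_linear_preimage:
  fixes f :: "'a::euclidean_space \<Rightarrow> 'b::euclidean_space"
  assumes "linear f" "polyhedron S"
  shows "polyhedron (f -` S)"
proof -
  obtain F where F: "finite F" "S = \<Inter>F" "\<forall>H\<in>F. \<exists>a b. a \<noteq> 0 \<and> H = {x. a \<bullet> x \<le> b}"
    using \<open>polyhedron S\<close> unfolding polyhedron_def by blast
  have "polyhedron (f -` H)" if H: "H \<in> F" for H
  proof -
    obtain a b where "H = {x. a \<bullet> x \<le> b}" using F(3) H by blast
    then have "f -` H = {x. adjoint f a \<bullet> x \<le> b}"
      using adjoint_works[OF \<open>linear f\<close>] by (auto simp: inner_commute)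
    then show ?thesis by (simp add: polyhedron_halfspace_le)
  qed
  moreover have "f -` S = \<Inter>((\<lambda>H. f -` H) ` F)" using F(2) by blast
  ultimately show ?thesis using F(1) by auto
qed

lemma exists_between_finite:
  fixes L U :: "real set"
  assumes "finite L" "finite U" "\<And>l u. l \<in> L \<Longrightarrow> u \<in> U \<Longrightarrow> l \<le> u"
  shows "\<exists>t. (\<forall>l\<in>L. l \<le> t) \<and> (\<forall>u\<in>U. t \<le> u)"
proof (cases "L = {}")
  case True
  then show ?thesis
    using \<open>finite U\<close> by (cases "U = {}") (auto intro!: exI[of _ "Min U"])
next
  case False
  then show ?thesis
    using assms by (intro exI[of _ "Max L"]) auto
qed

text \<open>Fourier--Motzkin elimination of the variable \<open>t\<close>.\<close>

lemma polyhedron_line_sum: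
  fixes S :: "'a::euclidean_space set"
  assumes "polyhedron S"
  shows "polyhedron {y. \<exists>t. y + t *\<^sub>R d \<in> S}"
proof -
  obtain F where F: "finite F" "S = \<Inter>F" "\<forall>H\<in>F. \<exists>a b. a \<noteq> 0 \<and> H = {x. a \<bullet> x \<le> b}"
    using assms unfolding polyhedron_def by blast
  from F(3) obtain a b where ab: "\<And>H. H \<in> F \<Longrightarrow> H = {x. a H \<bullet> x \<le> b H}" by metis
  define s where "s H = a H \<bullet> d" for H
  define g where "g H y = b H - a H \<bullet> y" for H y
  have mem: "y + t *\<^sub>R d \<in> S \<longleftrightarrow> (\<forall>H\<in>F. t * s H \<le> g H y)" for y t
  proof -
    have "y + t *\<^sub>R d \<in> H \<longleftrightarrow> t * s H \<le> g H y" if "H \<in> F" for H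
      by (subst ab[OF that]) (auto simp: s_def g_def inner_right_distrib)
    then show ?thesis using F(2) by blast
  qed
  \<comment> \<open>The sign of \<open>s H\<close> decides the role of \<open>H\<close>: negative
    gives a lower bound for \<open>t\<close>, positive an upper bound, zero a condition on
    \<open>y\<close> alone. Lower and upper bounds are compared after cross-multiplication, so that
    each comparison is a half-space in \<open>y\<close>.\<close>
  have elim: "(\<exists>t. \<forall>H\<in>F. t * s H \<le> g H y) \<longleftrightarrow>
      (\<forall>H\<in>F. s H = 0 \<longrightarrow> 0 \<le> g H y) \<and>
      (\<forall>H\<in>F. \<forall>K\<in>F. s H < 0 \<longrightarrow> 0 < s K \<longrightarrow> s H * g K y \<le> s K * g H y)"
    (is "?L \<longleftrightarrow> ?R") for y
  proof
    assume ?L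
    then obtain t where t: "\<And>H. H \<in> F \<Longrightarrow> t * s H \<le> g H y" by blast
    have "s H * g K y \<le> s K * g H y" if "H \<in> F" "K \<in> F" "s H < 0" "0 < s K" for H K
    proof -
      have "s H * g K y \<le> s H * (t * s K)" using t[OF that(2)] that(3) by (simp add: mult_left_mono_neg)
      also have "\<dots> = s K * (t * s H)" by simp
      also have "\<dots> \<le> s K * g H y" using t[OF that(1)] that(4) by (simp add: mult_left_mono)
      finally show ?thesis .
    qed
    moreover have "0 \<le> g H y" if "H \<in> F" "s H = 0" for H using t[OF that(1)] that(2) by simp
    ultimately show ?R by blast
  next
    assume R: ?R
    have "\<exists>t. (\<forall>l\<in>(\<lambda>H. g H y / s H) ` {H\<in>F. s H < 0}. l \<le> t) \<and>
        (\<forall>u\<in>(\<lambda>H. g H y / s H) ` {H\<in>F. 0 < s H}. t \<le> u)"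
    proof (rule exists_between_finite)
      fix l u assume "l \<in> (\<lambda>H. g H y / s H) ` {H\<in>F. s H < 0}" "u \<in> (\<lambda>H. g H y / s H) ` {H\<in>F. 0 < s H}"
      then obtain H K where HK: "H \<in> F" "K \<in> F" "s H < 0" "0 < s K" "l = g H y / s H" "u = g K y / s K"
        by blast
      then have "s H * g K y \<le> s K * g H y" using R by blast
      moreover have "g H y = l * s H" "g K y = u * s K" using HK by auto
      ultimately have "(s H * s K) * u \<le> (s H * s K) * l" by (simp add: mult.commute mult.left_commute)
      moreover have "s H * s K < 0" using HK by (simp add: mult_less_0_iff)
      ultimately show "l \<le> u" by (rule mult_le_cancel_left_neg[THEN iffD1, rotated])
    qed (use F(1) in auto)
    then obtain t where t: "\<And>H. H \<in> F \<Longrightarrow> s H < 0 \<Longrightarrow> g H y / s H \<le> t"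
      "\<And>H. H \<in> F \<Longrightarrow> 0 < s H \<Longrightarrow> t \<le> g H y / s H" by auto
    have "t * s H \<le> g H y" if "H \<in> F" for H
      using t[OF that] R that by (cases "s H" "0::real" rule: linorder_cases) (auto simp: field_simps)
    then show ?L by blast
  qed
  have half: "s H * g K y \<le> s K * g H y \<longleftrightarrow>
      (s K *\<^sub>R a H - s H *\<^sub>R a K) \<bullet> y \<le> s K * b H - s H * b K" for H K y
    by (simp add: g_def inner_diff_left right_diff_distrib) linarith
  have half0: "0 \<le> g H y \<longleftrightarrow> a H \<bullet> y \<le> b H" for H y
    by (simp add: g_def)
  have "{y. \<exists>t. y + t *\<^sub>R d \<in> S} =
      (\<Inter>H\<in>{H\<in>F. s H = 0}. {y. a H \<bullet> y \<le> b H}) \<inter>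
      (\<Inter>H\<in>{H\<in>F. s H < 0}. \<Inter>K\<in>{K\<in>F. 0 < s K}.
        {y. (s K *\<^sub>R a H - s H *\<^sub>R a K) \<bullet> y \<le> s K * b H - s H * b K})"
    unfolding mem elim half half0 by (intro set_eqI) (simp only: mem_Collect_eq Int_iff INT_iff, blast)
  also have "polyhedron \<dots>"
    using F(1) by (intro polyhedron_Int polyhedron_Inter finite_imageI) (auto simp: polyhedron_halfspace_le)
  finally show ?thesis .
qed

text \<open>A span is closed under negation, so this set is the Minkowski sum of \<open>S\<close>
  and \<open>span D\<close>; each generator of the span costs one elimination.\<close>

lemma polyhedron_span_sum:
  fixes S :: "'a::euclidean_space set"
  assumes "polyhedron S" "finite D"
  shows "polyhedron {y. \<exists>v\<in>span D. y + v \<in> S}"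
  using \<open>finite D\<close>
proof (induction D rule: finite_induct)
  case empty
  then show ?case using assms(1) by simp
next
  case (insert d D)
  have "{y. \<exists>v\<in>span (insert d D). y + v \<in> S} = {y. \<exists>t. y + t *\<^sub>R d \<in> {y. \<exists>v\<in>span D. y + v \<in> S}}"
  proof (intro set_eqI iffI; clarsimp)
    fix y v assume "v \<in> span (insert d D)" "y + v \<in> S"
    then obtain k where "v - k *\<^sub>R d \<in> span D" using span_breakdown_eq by blast
    moreover have "y + k *\<^sub>R d + (v - k *\<^sub>R d) \<in> S" using \<open>y + v \<in> S\<close> by simp
    ultimately show "\<exists>t. \<exists>v\<in>span D. y + t *\<^sub>R d + v \<in> S" by blast
  next
    fix y t v assume "v \<in> span D" "y + t *\<^sub>R d + v \<in> S"
    moreover from this(1) have "t *\<^sub>R d + v \<in> span (insert d D)"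
      by (meson insertI1 span_add span_base span_mono span_scale subset_insertI subsetD)
    ultimately show "\<exists>v\<in>span (insert d D). y + v \<in> S" by (metis add.assoc)
  qed
  then show ?case using polyhedron_line_sum[OF insert.IH, of d] by simp
qed

text \<open>The projection is the slice at second coordinate 0 of the sum of \<open>S\<close> with
  the whole second factor.\<close>

lemma polyhedron_fst_image:
  fixes S :: "('a::euclidean_space \<times> 'b::euclidean_space) set"
  assumes "polyhedron S"
  shows "polyhedron (fst ` S)"
proof -
  let ?D = "Pair (0::'a) ` (Basis :: 'b set)"
  have span: "v \<in> span ?D \<longleftrightarrow> fst v = 0" for v
  proof -
    have "linear (Pair (0::'a) :: 'b \<Rightarrow> _)" by (auto intro!: linearI)
    from span_linear_image[OF this, of Basis] show ?thesis
      by (cases v) auto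
  qed
  have "y \<in> fst ` S \<longleftrightarrow> (\<exists>v\<in>span ?D. (y, 0) + v \<in> S)" for y
  proof
    assume "y \<in> fst ` S"
    then obtain z where "(y, z) \<in> S" by auto
    then show "\<exists>v\<in>span ?D. (y, 0) + v \<in> S" by (intro bexI[of _ "(0, z)"]) (simp_all add: span)
  next
    assume "\<exists>v\<in>span ?D. (y, 0) + v \<in> S"
    then obtain v where "fst v = 0" "(y, 0) + v \<in> S" using span by blast
    then show "y \<in> fst ` S" by (intro image_eqI[of _ _ "(y, 0) + v"]) simp_all
  qed
  then have "fst ` S = (\<lambda>y. (y, 0)) -` {y. \<exists>v\<in>span ?D. y + v \<in> S}" by blast
  moreover have "polyhedron ((\<lambda>y. (y, 0::'b)) -` {y. \<exists>v\<in>span ?D. y + v \<in> S})"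
    by (intro polyhedron_linear_preimage polyhedron_span_sum assms) (auto intro!: linearI)
  ultimately show ?thesis by simp
qed

text \<open>The graph of \<open>f\<close> over \<open>S\<close> is cut out by linear conditions, and
  the image is the projection of this graph.\<close>

lemma polyhedron_linear_image:
  fixes f :: "'a::euclidean_space \<Rightarrow> 'b::euclidean_space"
  assumes "linear f" "polyhedron S"
  shows "polyhedron (f ` S)"
proof -
  have "linear (\<lambda>z::'b \<times> 'a. fst z - f (snd z))"
    using \<open>linear f\<close> by (auto intro!: linearI simp: linear_add linear_scale algebra_simps)
  then have "polyhedron ((\<lambda>z::'b \<times> 'a. fst z - f (snd z)) -` {0} \<inter> snd -` S)"
    using assms by (intro polyhedron_Int polyhedron_linear_preimage) (auto simp: linear_snd intro: affine_imp_polyhedron)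
  moreover have "(\<lambda>z::'b \<times> 'a. fst z - f (snd z)) -` {0} \<inter> snd -` S = (\<lambda>x. (f x, x)) ` S"
    by (auto simp: image_iff)
  then have "f ` S = fst ` ((\<lambda>z::'b \<times> 'a. fst z - f (snd z)) -` {0} \<inter> snd -` S)"
    by (simp add: image_image)
  ultimately show ?thesis using polyhedron_fst_image by metis
qed

section \<open>Regular subdivisions\<close>

text \<open>The perturbation argument behind all later tilting: finitely many positive gaps
  \<open>f a\<close> absorb a change of order \<epsilon>. In filter form, the requirements of
  finitely many cells can be met by one common \<epsilon>.\<close>

lemma eventually_small_multiple_less:
  fixes f g :: "'a \<Rightarrow> real"
  assumes "finite A" and "\<And>a. a \<in> A \<Longrightarrow> 0 < f a"
  shows "\<forall>\<^sub>F \<epsilon> in at_right 0. \<forall>a\<in>A. \<epsilon> * g a < f a"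
proof -
  have "\<forall>\<^sub>F \<epsilon> in at_right 0. \<epsilon> * g a < f a" if "a \<in> A" for a
    by (rule order_tendstoD(2)[OF _ assms(2)[OF that]]) (auto intro!: tendsto_eq_intros)
  then show ?thesis
    using \<open>finite A\<close> by (simp add: eventually_ball_finite)
qed

lemma eventually_at_right_0_obtain:
  assumes "\<forall>\<^sub>F \<epsilon> in at_right (0::real). P \<epsilon>"
  obtains \<epsilon> where "\<epsilon> > 0" "P \<epsilon>"
proof -
  have "\<forall>\<^sub>F \<epsilon> in at_right 0. 0 < \<epsilon> \<and> P \<epsilon>"
    using eventually_at_right_less[of 0] assms by eventually_elim simp
  then show ?thesis
    using eventually_happens'[OF trivial_limit_at_right_real] that by blast
qed

lemmas small_multiple_less = eventually_at_right_0_obtain[OF eventually_small_multiple_less]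

lemma regular_subdivisionE:
  assumes "B \<in> regular_subdivision A h"
  obtains u c where "\<And>a. a \<in> A \<Longrightarrow> u \<bullet> a + c \<le> h a" "B = {a\<in>A. u \<bullet> a + c = h a}" "B \<noteq> {}"
  using assms unfolding regular_subdivision_def by blast

text \<open>The difference of the two minorants is nonnegative on \<open>B\<close>, where the first
  one touches \<open>h\<close>, and nonpositive on \<open>E\<close>. At \<open>x\<close> it is
  therefore 0, and a supporting hyperplane that meets the relative interior of the hull of
  \<open>B\<close> contains all of \<open>B\<close>.\<close>

lemma regular_cell_mono:
  assumes "B \<in> regular_subdivision A h" "E \<in> regular_subdivision A h"
    and x: "x \<in> rel_interior (convex hull B)" "x \<in> convex hull E"
  shows "B \<subseteq> E"
proof -
  obtain u c where u: "\<And>a. a \<in> A \<Longrightarrow> u \<bullet> a + c \<le> h a" and B: "B = {a\<in>A. u \<bullet> a + c = h a}"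
    using regular_subdivisionE[OF assms(1)] by blast
  obtain v d where v: "\<And>a. a \<in> A \<Longrightarrow> v \<bullet> a + d \<le> h a" and E: "E = {a\<in>A. v \<bullet> a + d = h a}"
    using regular_subdivisionE[OF assms(2)] by blast
  have "convex hull B \<subseteq> {y. (u - v) \<bullet> y \<ge> d - c}"
    using v by (intro hull_minimal convex_halfspace_ge) (force simp: B inner_diff_left)
  then have face: "convex hull B \<inter> {y. (u - v) \<bullet> y = d - c} face_of convex hull B"
    by (intro face_of_Int_supporting_hyperplane_ge) auto
  have "convex hull E \<subseteq> {y. (u - v) \<bullet> y \<le> d - c}"
    using u by (intro hull_minimal convex_halfspace_le) (force simp: E inner_diff_left)
  with \<open>convex hull B \<subseteq> _\<close> x have "x \<in> convex hull B \<inter> {y. (u - v) \<bullet> y = d - c}"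
    using rel_interior_subset by fastforce
  with face x(1) have "convex hull B \<inter> {y. (u - v) \<bullet> y = d - c} = convex hull B"
    using face_of_disjoint_rel_interior by blast
  then have "a \<in> E" if "a \<in> B" for a
    using that hull_inc[of a B] by (force simp: B E inner_diff_left)
  then show ?thesis by blast
qed

text \<open>Adding a small multiple of \<open>v\<close> to the minorant of \<open>E\<close> lowers
  it on \<open>E\<close> except where \<open>v \<bullet> a + d\<close> vanishes, while off
  \<open>E\<close> the positive slack absorbs the change. So the contact set shrinks to exactly the
  given face.\<close>

lemma regular_subdivision_face:
  assumes "finite A" and "E \<in> regular_subdivision A h"
    and le: "\<And>a. a \<in> E \<Longrightarrow> v \<bullet> a + d \<le> 0"
    and ne: "a0 \<in> E" "v \<bullet> a0 + d = 0"
  shows "{a\<in>E. v \<bullet> a + d = 0} \<in> regular_subdivision A h"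
proof -
  obtain u c where u: "\<And>a. a \<in> A \<Longrightarrow> u \<bullet> a + c \<le> h a" and E: "E = {a\<in>A. u \<bullet> a + c = h a}"
    using regular_subdivisionE[OF assms(2)] by blast
  have "0 < h a - (u \<bullet> a + c)" if "a \<in> A - E" for a
    using u[of a] that by (auto simp: E order_less_le)
  with \<open>finite A\<close> obtain \<epsilon> where "\<epsilon> > 0"
    and \<epsilon>: "\<forall>a\<in>A - E. \<epsilon> * (v \<bullet> a + d) < h a - (u \<bullet> a + c)"
    by (rule small_multiple_less[OF finite_Diff])
  have sum: "(u + \<epsilon> *\<^sub>R v) \<bullet> a + (c + \<epsilon> * d) = (u \<bullet> a + c) + \<epsilon> * (v \<bullet> a + d)" for a
    by (simp add: inner_left_distrib algebra_simps)
  have 1: "(u + \<epsilon> *\<^sub>R v) \<bullet> a + (c + \<epsilon> * d) \<le> h a \<and>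
      ((u + \<epsilon> *\<^sub>R v) \<bullet> a + (c + \<epsilon> * d) = h a \<longleftrightarrow> a \<in> E \<and> v \<bullet> a + d = 0)" if "a \<in> A" for a
  proof (cases "a \<in> E")
    case True
    then have "\<epsilon> * (v \<bullet> a + d) \<le> 0"
      using le \<open>\<epsilon> > 0\<close> by (simp add: mult_le_0_iff)
    then show ?thesis
      using True \<open>\<epsilon> > 0\<close> by (auto simp: sum E)
  next
    case False
    then show ?thesis using bspec[OF \<epsilon>, of a] that by (auto simp: sum)
  qed
  show ?thesis
    unfolding regular_subdivision_def
    by (intro CollectI conjI exI[of _ "u + \<epsilon> *\<^sub>R v"] exI[of _ "c + \<epsilon> * d"])
      (use 1 ne in \<open>auto simp: E\<close>)
qed

text \<open>
  An affine minorant of \<open>h\<close> that is maximal at \<open>x\<close> touches \<open>h\<close> around \<open>x\<close>: a hyperplane separating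
  \<open>x\<close> from the contact set would allow tilting the minorant upwards at \<open>x\<close>.
\<close>

lemma regular_subdivision_covers:
  fixes A :: "'a::euclidean_space set"
  assumes "finite A" and x: "x \<in> convex hull A"
  shows "\<exists>E\<in>regular_subdivision A h. x \<in> convex hull E"
proof -
  define \<Lambda> where "\<Lambda> = (\<Inter>a\<in>A. {l::'a \<times> real. (a, 1) \<bullet> l \<le> h a})"
  have \<Lambda>: "(u, c) \<in> \<Lambda> \<longleftrightarrow> (\<forall>a\<in>A. u \<bullet> a + c \<le> h a)" for u c
    by (auto simp: \<Lambda>_def inner_commute)
  define V where "V = (\<lambda>l. (x, 1::real) \<bullet> l) ` \<Lambda>"
  have "polyhedron \<Lambda>"
    unfolding \<Lambda>_def using \<open>finite A\<close> by (intro polyhedron_Inter) (auto simp: polyhedron_halfspace_le)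
  \<comment> \<open>The attainable values at \<open>x\<close> form a linear image of a polyhedron,
    hence a closed set; this is how the supremum comes to be attained.\<close>
  then have "closed V"
    unfolding V_def
    by (intro polyhedron_imp_closed polyhedron_linear_image) (auto intro: bounded_linear.linear bounded_linear_inner_right)
  have "A \<noteq> {}" using x by auto
  have "(0, Min (h ` A)) \<in> \<Lambda>"
    using \<open>finite A\<close> by (auto simp: \<Lambda>)
  then have "V \<noteq> {}" by (auto simp: V_def)
  have "bdd_above V"
  proof (rule bdd_aboveI)
    fix t assume "t \<in> V"
    then obtain u c where uc: "(u, c) \<in> \<Lambda>" "t = x \<bullet> u + c" by (auto simp: V_def)
    have "convex hull A \<subseteq> {y. u \<bullet> y \<le> Max (h ` A) - c}"
    proof (intro hull_minimal convex_halfspace_le subsetI CollectI)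
      fix a assume "a \<in> A"
      then have "u \<bullet> a + c \<le> h a" "h a \<le> Max (h ` A)" using uc \<open>finite A\<close> by (auto simp: \<Lambda>)
      then show "u \<bullet> a \<le> Max (h ` A) - c" by simp
    qed
    then show "t \<le> Max (h ` A)" using x uc by (auto simp: inner_commute)
  qed
  have "Sup V \<in> V"
    using \<open>closed V\<close> \<open>V \<noteq> {}\<close> \<open>bdd_above V\<close> by (rule closed_contains_Sup[rotated 2])
  then obtain u c where uc: "(u, c) \<in> \<Lambda>" and "Sup V = x \<bullet> u + c" by (auto simp: V_def)
  have max: "x \<bullet> v + d \<le> x \<bullet> u + c" if "(v, d) \<in> \<Lambda>" for v d
  proof -
    have "(x, 1) \<bullet> (v, d) \<in> V" unfolding V_def using that by (rule imageI)
    then have "x \<bullet> v + d \<le> Sup V" using \<open>bdd_above V\<close> by (auto intro: cSup_upper)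
    then show ?thesis using \<open>Sup V = _\<close> by simp
  qed
  define E where "E = {a\<in>A. u \<bullet> a + c = h a}"
  have "x \<in> convex hull E"
  proof (rule ccontr)
    assume "x \<notin> convex hull E"
    moreover have "closed (convex hull E)"
      using \<open>finite A\<close> by (intro compact_imp_closed finite_imp_compact_convex_hull) (auto simp: E_def)
    ultimately obtain v b where v: "v \<bullet> x < b" "\<And>y. y \<in> convex hull E \<Longrightarrow> v \<bullet> y > b"
      using separating_hyperplane_closed_point[of "convex hull E" x] by auto
    have "0 < h a - (u \<bullet> a + c)" if "a \<in> A - E" for a
      using uc that by (auto simp: E_def \<Lambda> order_less_le)
    with \<open>finite A\<close> obtain \<epsilon> where "\<epsilon> > 0"
      and \<epsilon>: "\<forall>a\<in>A - E. \<epsilon> * (b - v \<bullet> a) < h a - (u \<bullet> a + c)"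
      by (rule small_multiple_less[OF finite_Diff])
    have "(u - \<epsilon> *\<^sub>R v, c + \<epsilon> * b) \<in> \<Lambda>"
      unfolding \<Lambda>
    proof
      fix a assume "a \<in> A"
      show "(u - \<epsilon> *\<^sub>R v) \<bullet> a + (c + \<epsilon> * b) \<le> h a"
      proof (cases "a \<in> E")
        case True
        then have "\<epsilon> * (b - v \<bullet> a) \<le> 0"
          using v(2)[of a] hull_inc[of a E] \<open>\<epsilon> > 0\<close> by (simp add: mult_le_0_iff less_imp_le)
        then show ?thesis using True by (simp add: E_def inner_diff_left algebra_simps)
      next
        case False
        then show ?thesis using bspec[OF \<epsilon>, of a] \<open>a \<in> A\<close> by (simp add: inner_diff_left algebra_simps)
      qed
    qed
    from max[OF this] have "\<epsilon> * (b - v \<bullet> x) \<le> 0"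
      by (simp add: inner_diff_right inner_commute algebra_simps)
    then show False using v(1) \<open>\<epsilon> > 0\<close> by (simp add: mult_le_0_iff)
  qed
  moreover from this have "E \<noteq> {}" by auto
  then have "E \<in> regular_subdivision A h"
    unfolding regular_subdivision_def
    using uc \<Lambda> E_def by blast
  ultimately show ?thesis by blast
qed

text \<open>Faces of a polytope are exposed, so each face of a cell is given by a supporting
  functional and is again a cell by tilting. Relative interiors are disjoint because two cells
  sharing an interior point contain each other.\<close>

lemma subdivision_regular_subdivision:
  fixes A :: "'a::euclidean_space set"
  assumes "finite A"
  shows "subdivision A (regular_subdivision A h)"
  unfolding subdivision_def
proof (intro conjI ballI allI impI)
  fix B assume B: "B \<in> regular_subdivision A h"
  then show "B \<noteq> {}" "B \<subseteq> A" by (auto elim: regular_subdivisionE)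
  have "finite B" using \<open>B \<subseteq> A\<close> \<open>finite A\<close> by (rule finite_subset)
  fix F assume F: "F face_of convex hull B \<and> F \<noteq> {}"
  have "polyhedron (convex hull B)"
    using \<open>finite B\<close> by (simp add: polytope_convex_hull polytope_imp_polyhedron)
  then have "F exposed_face_of convex hull B"
    using F by (simp add: exposed_face_of_polyhedron)
  then obtain v d where v: "convex hull B \<subseteq> {y. v \<bullet> y \<le> d}" "F = convex hull B \<inter> {y. v \<bullet> y = d}"
    by (auto simp: exposed_face_of_def)
  have BF: "B \<inter> F = {a\<in>B. v \<bullet> a + - d = 0}"
    using v(2) hull_inc[of _ B] by auto
  \<comment> \<open>Were no point of \<open>B\<close> on the face, \<open>B\<close> and hence its
    hull would lie in the open half-space \<open>v \<bullet> y < d\<close>, leaving \<open>F\<close>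
    empty.\<close>
  have "B \<inter> F \<noteq> {}"
  proof
    assume "B \<inter> F = {}"
    then have "B \<subseteq> {y. v \<bullet> y < d}"
      using v hull_inc[of _ B] by force
    then have "convex hull B \<subseteq> {y. v \<bullet> y < d}"
      by (intro hull_minimal convex_halfspace_lt)
    then show False using F v(2) by auto
  qed
  then obtain a0 where "a0 \<in> B" "v \<bullet> a0 + - d = 0" using BF by blast
  then show "B \<inter> F \<in> regular_subdivision A h"
    unfolding BF using v(1) hull_inc[of _ B]
    by (intro regular_subdivision_face[OF \<open>finite A\<close> B]) force+
next
  have "convex hull B \<subseteq> convex hull A" if "B \<in> regular_subdivision A h" for B
    using that by (intro hull_mono) (auto elim: regular_subdivisionE)
  then show "(\<Union>B\<in>regular_subdivision A h. convex hull B) = convex hull A"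
    using regular_subdivision_covers[OF \<open>finite A\<close>, of _ h] by blast
next
  fix B B' assume B: "B \<in> regular_subdivision A h" "B' \<in> regular_subdivision A h" "B \<noteq> B'"
  show "rel_interior (convex hull B) \<inter> rel_interior (convex hull B') = {}"
  proof (rule ccontr)
    assume "rel_interior (convex hull B) \<inter> rel_interior (convex hull B') \<noteq> {}"
    then obtain x where "x \<in> rel_interior (convex hull B)" "x \<in> rel_interior (convex hull B')"
      by blast
    then have "B \<subseteq> B'" "B' \<subseteq> B"
      using regular_cell_mono[of _ A h] B rel_interior_subset by blast+
    then show False using \<open>B \<noteq> B'\<close> by blast
  qed
qed

section \<open>Secondary cones\<close>

lemma refines_trans: "refines S T \<Longrightarrow> refines T U \<Longrightarrow> refines S U"
  unfolding refines_def by (meson order_trans)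

lemma refines_refl: "refines S S"
  unfolding refines_def by blast

text \<open>The contact set of a minorant that touches \<open>h\<close> on \<open>B\<close> is
  itself a cell containing \<open>B\<close>. The conditions on the right are linear in
  \<open>h\<close>, \<open>u\<close> and \<open>c\<close> jointly, so minorants can be added and
  scaled along with heights.\<close>

lemma refines_regular_iff:
  assumes "\<forall>B\<in>S. B \<noteq> {} \<and> B \<subseteq> A"
  shows "refines S (regular_subdivision A h) \<longleftrightarrow>
    (\<forall>B\<in>S. \<exists>u c. (\<forall>a\<in>A. u \<bullet> a + c \<le> h a) \<and> (\<forall>a\<in>B. u \<bullet> a + c = h a))"
  unfolding refines_def
proof (intro ball_cong refl iffI)
  fix B assume "B \<in> S" "\<exists>B'\<in>regular_subdivision A h. B \<subseteq> B'"
  then show "\<exists>u c. (\<forall>a\<in>A. u \<bullet> a + c \<le> h a) \<and> (\<forall>a\<in>B. u \<bullet> a + c = h a)"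
    unfolding regular_subdivision_def by blast
next
  fix B assume B: "B \<in> S" and "\<exists>u c. (\<forall>a\<in>A. u \<bullet> a + c \<le> h a) \<and> (\<forall>a\<in>B. u \<bullet> a + c = h a)"
  then obtain u c where uc: "\<forall>a\<in>A. u \<bullet> a + c \<le> h a" "\<forall>a\<in>B. u \<bullet> a + c = h a" by blast
  have "{a\<in>A. u \<bullet> a + c = h a} \<in> regular_subdivision A h"
    unfolding regular_subdivision_def using uc bspec[OF assms B] by blast
  moreover have "B \<subseteq> {a\<in>A. u \<bullet> a + c = h a}" using uc bspec[OF assms B] by blast
  ultimately show "\<exists>B'\<in>regular_subdivision A h. B \<subseteq> B'" by blast
qed

lemma regular_cells: "B \<in> regular_subdivision A h \<Longrightarrow> B \<noteq> {} \<and> B \<subseteq> A"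
  by (auto elim: regular_subdivisionE)

lemma finite_regular_subdivision: "finite A \<Longrightarrow> finite (regular_subdivision A h)"
  by (rule finite_subset[of _ "Pow A"]) (auto simp: regular_subdivision_def)

lemma subdivision_cells: "subdivision A S \<Longrightarrow> \<forall>B\<in>S. B \<noteq> {} \<and> B \<subseteq> A"
  by (auto simp: subdivision_def)

lemma subdivision_covers: "subdivision A S \<Longrightarrow> (\<Union>B\<in>S. convex hull B) = convex hull A"
  by (simp add: subdivision_def)

lemma refines_combination:
  fixes A :: "'a::euclidean_space set"
  assumes cells: "\<forall>B\<in>S. B \<noteq> {} \<and> B \<subseteq> A"
    and "refines S (regular_subdivision A h1)" "refines S (regular_subdivision A h2)"
    and "0 \<le> \<alpha>" "0 \<le> \<beta>" and h0: "\<And>a. a \<in> A \<Longrightarrow> h0 a = \<alpha> * h1 a + \<beta> * h2 a"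
  shows "refines S (regular_subdivision A h0)"
  unfolding refines_regular_iff[OF cells]
proof
  fix B assume B: "B \<in> S"
  obtain u c where u: "\<forall>a\<in>A. u \<bullet> a + c \<le> h1 a" "\<forall>a\<in>B. u \<bullet> a + c = h1 a"
    using assms(2) B unfolding refines_regular_iff[OF cells] by blast
  obtain v d where v: "\<forall>a\<in>A. v \<bullet> a + d \<le> h2 a" "\<forall>a\<in>B. v \<bullet> a + d = h2 a"
    using assms(3) B unfolding refines_regular_iff[OF cells] by blast
  have eq: "(\<alpha> *\<^sub>R u + \<beta> *\<^sub>R v) \<bullet> a + (\<alpha> * c + \<beta> * d) = \<alpha> * (u \<bullet> a + c) + \<beta> * (v \<bullet> a + d)" for a
    by (simp add: inner_left_distrib algebra_simps)
  have "\<forall>a\<in>A. (\<alpha> *\<^sub>R u + \<beta> *\<^sub>R v) \<bullet> a + (\<alpha> * c + \<beta> * d) \<le> h0 a"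
    unfolding eq using u v assms(4,5) by (auto simp: h0 intro!: add_mono mult_left_mono)
  moreover have "\<forall>a\<in>B. (\<alpha> *\<^sub>R u + \<beta> *\<^sub>R v) \<bullet> a + (\<alpha> * c + \<beta> * d) = h0 a"
    unfolding eq using u v bspec[OF cells B] h0 by auto
  ultimately show "\<exists>u c. (\<forall>a\<in>A. u \<bullet> a + c \<le> h0 a) \<and> (\<forall>a\<in>B. u \<bullet> a + c = h0 a)" by blast
qed

text \<open>
  A point of a cell of \<open>h0\<close> lies in a cell \<open>D\<close> of \<open>S\<close>, over which \<open>h1\<close> and \<open>h2\<close> have affine
  minorants touching on \<open>D\<close>; their combination is a minorant of \<open>h0\<close> touching on \<open>D\<close>.
\<close>

lemma refines_of_combination:
  fixes A :: "'a::euclidean_space set"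
  assumes S: "subdivision A S"
    and "refines S (regular_subdivision A h1)" "refines S (regular_subdivision A h2)"
    and pos: "0 < \<alpha>" "0 < \<beta>" and h0: "\<And>a. a \<in> A \<Longrightarrow> h0 a = \<alpha> * h1 a + \<beta> * h2 a"
  shows "refines (regular_subdivision A h0) (regular_subdivision A h1)"
  unfolding refines_def
proof
  fix B assume B: "B \<in> regular_subdivision A h0"
  note cells = subdivision_cells[OF S]
  have "rel_interior (convex hull B) \<noteq> {}"
    using regular_cells[OF B] by (simp add: rel_interior_eq_empty)
  then obtain x where x: "x \<in> rel_interior (convex hull B)" by blast
  then have "x \<in> convex hull A"
    using regular_cells[OF B] rel_interior_subset hull_mono by blast
  then obtain D where D: "D \<in> S" "x \<in> convex hull D"
    using subdivision_covers[OF S] by blast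
  have "\<exists>u c. (\<forall>a\<in>A. u \<bullet> a + c \<le> h1 a) \<and> (\<forall>a\<in>D. u \<bullet> a + c = h1 a)"
    using assms(2) D(1) unfolding refines_regular_iff[OF cells] by (rule bspec)
  then obtain u c where u: "\<forall>a\<in>A. u \<bullet> a + c \<le> h1 a" "\<forall>a\<in>D. u \<bullet> a + c = h1 a"
    by blast
  have "\<exists>u c. (\<forall>a\<in>A. u \<bullet> a + c \<le> h2 a) \<and> (\<forall>a\<in>D. u \<bullet> a + c = h2 a)"
    using assms(3) D(1) unfolding refines_regular_iff[OF cells] by (rule bspec)
  then obtain v d where v: "\<forall>a\<in>A. v \<bullet> a + d \<le> h2 a" "\<forall>a\<in>D. v \<bullet> a + d = h2 a"
    by blast
  define u' c' where "u' = \<alpha> *\<^sub>R u + \<beta> *\<^sub>R v" and "c' = \<alpha> * c + \<beta> * d"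
  have eq: "u' \<bullet> a + c' = \<alpha> * (u \<bullet> a + c) + \<beta> * (v \<bullet> a + d)" for a
    by (simp add: u'_def c'_def inner_left_distrib algebra_simps)
  have le: "u' \<bullet> a + c' \<le> h0 a" if "a \<in> A" for a
    unfolding eq using u v pos that by (auto simp: h0 intro!: add_mono mult_left_mono)
  have tight: "u \<bullet> a + c = h1 a" if "a \<in> A" "u' \<bullet> a + c' = h0 a" for a
  proof -
    have "\<alpha> * (u \<bullet> a + c) + \<beta> * (v \<bullet> a + d) = \<alpha> * h1 a + \<beta> * h2 a"
      using that eq h0 by simp
    moreover have "\<alpha> * (u \<bullet> a + c) \<le> \<alpha> * h1 a" "\<beta> * (v \<bullet> a + d) \<le> \<beta> * h2 a"
      using u v that pos by auto
    ultimately have "\<alpha> * (u \<bullet> a + c) = \<alpha> * h1 a" by linarith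
    then show ?thesis using pos by simp
  qed
  define E where "E = {a\<in>A. u' \<bullet> a + c' = h0 a}"
  have "D \<subseteq> E" using u v bspec[OF cells D(1)] by (auto simp: E_def eq h0)
  moreover from this have "E \<in> regular_subdivision A h0"
    unfolding regular_subdivision_def using le bspec[OF cells D(1)] by (auto simp: E_def)
  ultimately have "B \<subseteq> E"
    using regular_cell_mono[OF B _ x] D hull_mono by blast
  moreover have "E \<subseteq> {a\<in>A. u \<bullet> a + c = h1 a}" using tight by (auto simp: E_def)
  moreover from calculation regular_cells[OF B]
  have "{a\<in>A. u \<bullet> a + c = h1 a} \<in> regular_subdivision A h1"
    unfolding regular_subdivision_def using u(1) by blast
  ultimately show "\<exists>B'\<in>regular_subdivision A h1. B \<subseteq> B'" by blast
qed

text \<open>The segment from \<open>h1\<close> to \<open>h0\<close> can be prolonged a little beyond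
  \<open>h0\<close>. For a cell \<open>B\<close> of \<open>h0\<close>, the same extrapolation of the
  two minorants touches on \<open>B\<close>. Off \<open>B\<close> the slack of the minorant of
  \<open>h0\<close> is positive and dominates for small \<epsilon>; the inequality required of
  \<epsilon> is nonnegativity of the extrapolated slack, rearranged.\<close>

lemma refines_extrapolation:
  fixes A :: "'a::euclidean_space set"
  assumes "finite A" and "refines (regular_subdivision A h0) (regular_subdivision A h1)"
  obtains \<epsilon> where "\<epsilon> > 0"
    "refines (regular_subdivision A h0) (regular_subdivision A (\<lambda>a. (1 + \<epsilon>) * h0 a - \<epsilon> * h1 a))"
proof -
  let ?S = "regular_subdivision A h0"
  have cells: "\<forall>B\<in>?S. B \<noteq> {} \<and> B \<subseteq> A"
    using regular_cells by blast
  have "finite ?S"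
    using \<open>finite A\<close> by (rule finite_regular_subdivision)
  moreover have "\<forall>\<^sub>F \<epsilon> in at_right (0::real). \<exists>u c. (\<forall>a\<in>A. u \<bullet> a + c \<le> (1 + \<epsilon>) * h0 a - \<epsilon> * h1 a) \<and>
        (\<forall>a\<in>B. u \<bullet> a + c = (1 + \<epsilon>) * h0 a - \<epsilon> * h1 a)" if B: "B \<in> ?S" for B
  proof -
    have "\<exists>u c. (\<forall>a\<in>A. u \<bullet> a + c \<le> h1 a) \<and> (\<forall>a\<in>B. u \<bullet> a + c = h1 a)"
      using assms(2) B unfolding refines_regular_iff[OF cells] by (rule bspec)
    then obtain v d where v: "\<forall>a\<in>B. v \<bullet> a + d = h1 a" by blast
    obtain u c where u: "\<And>a. a \<in> A \<Longrightarrow> u \<bullet> a + c \<le> h0 a" "B = {a\<in>A. u \<bullet> a + c = h0 a}"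
      using regular_subdivisionE[OF B] by blast
    have "0 < h0 a - (u \<bullet> a + c)" if "a \<in> A - B" for a
      using u(1)[of a] that by (subst (asm) u(2)) (auto simp: order_less_le)
    then have "\<forall>\<^sub>F \<epsilon> in at_right 0. \<forall>a\<in>A - B.
        \<epsilon> * ((h1 a - (v \<bullet> a + d)) - (h0 a - (u \<bullet> a + c))) < h0 a - (u \<bullet> a + c)"
      using \<open>finite A\<close> by (intro eventually_small_multiple_less) auto
    then show ?thesis
    proof eventually_elim
      case (elim \<epsilon>)
      let ?u = "(1 + \<epsilon>) *\<^sub>R u - \<epsilon> *\<^sub>R v" and ?c = "(1 + \<epsilon>) * c - \<epsilon> * d"
      have eq: "?u \<bullet> a + ?c = (1 + \<epsilon>) * (u \<bullet> a + c) - \<epsilon> * (v \<bullet> a + d)" for a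
        by (simp add: inner_diff_left algebra_simps)
      have on: "?u \<bullet> a + ?c = (1 + \<epsilon>) * h0 a - \<epsilon> * h1 a" if "a \<in> B" for a
      proof -
        have "u \<bullet> a + c = h0 a" using that u(2) by blast
        then show ?thesis unfolding eq using bspec[OF v that] by simp
      qed
      have off: "?u \<bullet> a + ?c \<le> (1 + \<epsilon>) * h0 a - \<epsilon> * h1 a" if "a \<in> A - B" for a
        using bspec[OF elim that] unfolding eq by (simp add: algebra_simps)
      show ?case
        by (intro exI[of _ ?u] exI[of _ ?c] conjI ballI) (use on off in force)+
    qed
  qed
  ultimately have "\<forall>\<^sub>F \<epsilon> in at_right (0::real).
      refines ?S (regular_subdivision A (\<lambda>a. (1 + \<epsilon>) * h0 a - \<epsilon> * h1 a))"
    unfolding refines_regular_iff[OF cells] by (simp add: eventually_ball_finite)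
  then show ?thesis
    by (rule eventually_at_right_0_obtain) (rule that)
qed

text \<open>Mutually refining regular subdivisions share their maximal cells, hence all faces of these.\<close>

lemma regular_subdivision_subset_if_refines:
  fixes A :: "'a::euclidean_space set"
  assumes "finite A"
    and r: "refines (regular_subdivision A h) (regular_subdivision A h')"
           "refines (regular_subdivision A h') (regular_subdivision A h)"
  shows "regular_subdivision A h \<subseteq> regular_subdivision A h'"
proof
  fix B assume B: "B \<in> regular_subdivision A h"
  let ?S = "regular_subdivision A h"
  have "finite ?S"
    using \<open>finite A\<close> by (rule finite_regular_subdivision)
  from finite_has_maximal2[OF this B] obtain M where
    M: "M \<in> ?S" "B \<subseteq> M" "\<And>D. D \<in> ?S \<Longrightarrow> M \<subseteq> D \<Longrightarrow> M = D" by auto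
  obtain E where "E \<in> regular_subdivision A h'" "M \<subseteq> E"
    using r(1) M(1) unfolding refines_def by blast
  moreover from this obtain D where "D \<in> ?S" "E \<subseteq> D"
    using r(2) unfolding refines_def by blast
  ultimately have M': "M \<in> regular_subdivision A h'" using M(3)[of D] by (metis order_trans subset_antisym)
  obtain u c where u: "\<And>a. a \<in> A \<Longrightarrow> u \<bullet> a + c \<le> h a" "B = {a\<in>A. u \<bullet> a + c = h a}" "B \<noteq> {}"
    using regular_subdivisionE[OF B] by blast
  obtain v d where v: "\<And>a. a \<in> A \<Longrightarrow> v \<bullet> a + d \<le> h a" "M = {a\<in>A. v \<bullet> a + d = h a}"
    using regular_subdivisionE[OF M(1)] by blast
  \<comment> \<open>On \<open>M\<close> the minorant of \<open>M\<close> equals \<open>h\<close>, so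
    the difference of the minorants of \<open>B\<close> and \<open>M\<close> is nonpositive there
    and vanishes exactly on \<open>B\<close>: it exposes \<open>B\<close> as a face of
    \<open>M\<close>.\<close>
  have eq: "B = {a\<in>M. (u - v) \<bullet> a + (c - d) = 0}"
    using M(2) u(2) v(2) by (auto simp: inner_diff_left)
  obtain a0 where a0: "a0 \<in> B" using u(3) by blast
  have "{a\<in>M. (u - v) \<bullet> a + (c - d) = 0} \<in> regular_subdivision A h'"
  proof (rule regular_subdivision_face[OF \<open>finite A\<close> M'])
    show "(u - v) \<bullet> a + (c - d) \<le> 0" if "a \<in> M" for a
      using that u(1)[of a] v(2) by (auto simp: inner_diff_left)
    show "a0 \<in> M" "(u - v) \<bullet> a0 + (c - d) = 0" using a0 eq by blast+
  qed
  then show "B \<in> regular_subdivision A h'" by (subst eq)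
qed

section \<open>The fan of a linear family of heights\<close>

lemma regular_subdivision_cong:
  assumes "\<And>a. a \<in> A \<Longrightarrow> h a = h' a"
  shows "regular_subdivision A h = regular_subdivision A h'"
proof -
  have "(\<forall>a\<in>A. u \<bullet> a + c \<le> h a) = (\<forall>a\<in>A. u \<bullet> a + c \<le> h' a)"
    "{a\<in>A. u \<bullet> a + c = h a} = {a\<in>A. u \<bullet> a + c = h' a}" for u c
    using assms by auto
  then show ?thesis unfolding regular_subdivision_def by simp
qed

text \<open>Abstracts the passage from a secondary fan to a linear section of it. Cones live in the
  parameter space \<open>W\<close>, a subspace of a Euclidean type, so the vocabulary of polyhedra,
  faces and relative interiors applies.\<close>

locale linear_heights =
  fixes A :: "'a::euclidean_space set"
    and W :: "'b::euclidean_space set"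
    and H :: "'b \<Rightarrow> 'a \<Rightarrow> real"
  assumes finite_points: "finite A"
    and subspace_W: "subspace W"
    and linear_H: "a \<in> A \<Longrightarrow> linear (\<lambda>w. H w a)"
begin

abbreviation induced :: "'b \<Rightarrow> 'a set set" where
  "induced w \<equiv> regular_subdivision A (H w)"

definition parameter_cone :: "'a set set \<Rightarrow> 'b set" where
  "parameter_cone S = {w\<in>W. refines S (induced w)}"

lemmas H_add = linear_add[OF linear_H] and H_scale = linear_scale[OF linear_H]

lemma H_combination:
  assumes "a \<in> A"
  shows "H (\<alpha> *\<^sub>R w + \<beta> *\<^sub>R v) a = \<alpha> * H w a + \<beta> * H v a"
  using assms by (simp add: H_add H_scale)

lemma zero_in_parameter_cone:
  assumes "subdivision A S"
  shows "0 \<in> parameter_cone S"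
proof -
  have "H 0 a = 0" if "a \<in> A" for a using linear_H[OF that] linear_0 by blast
  then have "refines S (induced 0)"
    unfolding refines_regular_iff[OF subdivision_cells[OF assms]]
    using subdivision_cells[OF assms] by (intro ballI exI[of _ 0]) auto
  then show ?thesis using subspace_W by (simp add: parameter_cone_def subspace_0)
qed

lemma parameter_cone_combination:
  assumes "subdivision A S" "w \<in> parameter_cone S" "v \<in> parameter_cone S" "0 \<le> \<alpha>" "0 \<le> \<beta>"
  shows "\<alpha> *\<^sub>R w + \<beta> *\<^sub>R v \<in> parameter_cone S"
  using assms subspace_W refines_combination[OF subdivision_cells[OF assms(1)] _ _ assms(4,5) H_combination]
  by (auto simp: parameter_cone_def subspace_add subspace_scale)

lemma convex_parameter_cone: "subdivision A S \<Longrightarrow> convex (parameter_cone S)"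
  using parameter_cone_combination by (auto simp: convex_def)

lemma cone_parameter_cone: "subdivision A S \<Longrightarrow> cone (parameter_cone S)"
  unfolding cone_def using parameter_cone_combination[of S _ _ _ 0] by auto

lemma parameter_cone_induced: "w \<in> W \<Longrightarrow> w \<in> parameter_cone (induced w)"
  by (simp add: parameter_cone_def refines_refl)

lemma parameter_cone_mono: "refines S T \<Longrightarrow> parameter_cone T \<subseteq> parameter_cone S"
  using refines_trans by (auto simp: parameter_cone_def)

lemma subdivision_induced: "subdivision A (induced w)"
  by (rule subdivision_regular_subdivision[OF finite_points])

lemma refines_induced_between:
  assumes "subdivision A S" "w \<in> parameter_cone S" "v \<in> parameter_cone S" "0 < \<alpha>" "0 < \<beta>"
  shows "refines (induced (\<alpha> *\<^sub>R w + \<beta> *\<^sub>R v)) (induced w)"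
  using assms refines_of_combination[OF assms(1) _ _ assms(4,5) H_combination]
  by (simp add: parameter_cone_def)

text \<open>For each cell, the triples of a parameter, a slope and a constant satisfying the
  touching conditions form a polyhedron; the condition on the parameter is its projection. The cone
  is the intersection of these finitely many projections with \<open>W\<close>.\<close>

lemma polyhedron_parameter_cone:
  assumes S: "subdivision A S"
  shows "polyhedron (parameter_cone S)"
proof -
  note cells = subdivision_cells[OF S]
  let ?f = "\<lambda>a (z::'b \<times> 'a \<times> real). fst (snd z) \<bullet> a + snd (snd z) - H (fst z) a"
  have lin: "linear (?f a)" if "a \<in> A" for a
    using that by (auto intro!: linearI simp: H_add H_scale inner_left_distrib algebra_simps)
  have "polyhedron {w. \<exists>u c. (\<forall>a\<in>A. u \<bullet> a + c \<le> H w a) \<and> (\<forall>a\<in>B. u \<bullet> a + c = H w a)}"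
    if B: "B \<in> S" for B
  proof -
    have "finite B" "B \<subseteq> A" using bspec[OF cells B] finite_points finite_subset by auto
    have "polyhedron {..0::real}" "polyhedron {0::real}"
      using polyhedron_halfspace_le[of "1::real" 0] by (simp_all add: atMost_def affine_imp_polyhedron)
    then have "polyhedron (?f a -` {..0})" "polyhedron (?f a -` {0})" if "a \<in> A" for a
      using polyhedron_linear_preimage[OF lin[OF that]] by blast+
    then have "polyhedron ((\<Inter>a\<in>A. ?f a -` {..0}) \<inter> (\<Inter>a\<in>B. ?f a -` {0}))"
      using \<open>finite B\<close> \<open>B \<subseteq> A\<close> finite_points
      by (intro polyhedron_Int polyhedron_Inter finite_imageI) blast+
    then have "polyhedron (fst ` ((\<Inter>a\<in>A. ?f a -` {..0}) \<inter> (\<Inter>a\<in>B. ?f a -` {0})))"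
      by (rule polyhedron_fst_image)
    also have "fst ` ((\<Inter>a\<in>A. ?f a -` {..0}) \<inter> (\<Inter>a\<in>B. ?f a -` {0})) =
        {w. \<exists>u c. (\<forall>a\<in>A. u \<bullet> a + c \<le> H w a) \<and> (\<forall>a\<in>B. u \<bullet> a + c = H w a)}"
      (is "fst ` ?P = ?Q")
    proof (intro equalityI subsetI)
      fix w assume "w \<in> ?Q"
      then obtain u c where "\<forall>a\<in>A. u \<bullet> a + c \<le> H w a" "\<forall>a\<in>B. u \<bullet> a + c = H w a" by blast
      then show "w \<in> fst ` ?P" by (intro image_eqI[of _ _ "(w, u, c)"]) auto
    next
      fix w assume "w \<in> fst ` ?P"
      then obtain u c where "(w, u, c) \<in> ?P" by force
      then show "w \<in> ?Q" by (intro CollectI exI[of _ u] exI[of _ c]) auto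
    qed
    finally show ?thesis .
  qed
  moreover have "finite S"
    using finite_points cells by (intro finite_subset[of S "Pow A"]) auto
  moreover have "parameter_cone S =
      W \<inter> (\<Inter>B\<in>S. {w. \<exists>u c. (\<forall>a\<in>A. u \<bullet> a + c \<le> H w a) \<and> (\<forall>a\<in>B. u \<bullet> a + c = H w a)})"
    unfolding parameter_cone_def refines_regular_iff[OF cells] by auto
  moreover have "polyhedron W"
    using subspace_W by (simp add: affine_imp_polyhedron subspace_imp_affine)
  ultimately show ?thesis by auto
qed

lemma parameter_cone_extrapolate:
  assumes v: "v \<in> parameter_cone (induced w)" and "w \<in> W"
  obtains \<epsilon> where "\<epsilon> > 0" "(1 + \<epsilon>) *\<^sub>R w + (- \<epsilon>) *\<^sub>R v \<in> parameter_cone (induced w)"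
proof -
  have "refines (induced w) (induced v)" using v by (simp add: parameter_cone_def)
  then obtain \<epsilon> where \<epsilon>: "\<epsilon> > 0"
    "refines (induced w) (regular_subdivision A (\<lambda>a. (1 + \<epsilon>) * H w a - \<epsilon> * H v a))"
    by (rule refines_extrapolation[OF finite_points])
  let ?v = "(1 + \<epsilon>) *\<^sub>R w + (- \<epsilon>) *\<^sub>R v"
  have "regular_subdivision A (\<lambda>a. (1 + \<epsilon>) * H w a - \<epsilon> * H v a) = induced ?v"
    by (rule regular_subdivision_cong, subst H_combination) simp_all
  moreover have "?v \<in> W"
    using v \<open>w \<in> W\<close> subspace_W by (auto simp: parameter_cone_def intro!: subspace_add subspace_scale subspace_diff)
  ultimately show ?thesis using \<epsilon> by (intro that[of \<epsilon>]) (auto simp: parameter_cone_def)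
qed

text \<open>Both inclusions prolong a segment beyond \<open>w\<close>. If \<open>v\<close> is in
  \<open>F\<close>, interiority of \<open>w\<close> supplies a point of \<open>F\<close> on the far
  side, and \<open>w\<close> as a positive combination refines \<open>v\<close>. If conversely the
  subdivision of \<open>w\<close> refines that of \<open>v\<close>, extrapolation supplies the far
  point, and the face property of \<open>F\<close> at \<open>w\<close> puts \<open>v\<close> into
  \<open>F\<close>.\<close>

lemma face_of_parameter_cone:
  assumes S: "subdivision A S" and F: "F face_of parameter_cone S" and w: "w \<in> rel_interior F"
  shows "F = parameter_cone (induced w)"
proof
  have "convex F" using F by (rule face_of_imp_convex)
  have "w \<in> F" using w rel_interior_subset by blast
  have FS: "F \<subseteq> parameter_cone S" using F by (rule face_of_imp_subset)
  have "w \<in> W" using \<open>w \<in> F\<close> FS by (auto simp: parameter_cone_def)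
  show "F \<subseteq> parameter_cone (induced w)"
  proof
    fix v assume "v \<in> F"
    then obtain e where e: "e > 1" "(1 - e) *\<^sub>R v + e *\<^sub>R w \<in> F"
      using convex_rel_interior_iff[OF \<open>convex F\<close>, of w] w by blast
    define v' where "v' = (1 - e) *\<^sub>R v + e *\<^sub>R w"
    \<comment> \<open>The definition of \<open>v'\<close> solved for \<open>w\<close>; both
      coefficients are positive because \<open>e > 1\<close>.\<close>
    have "w = ((e - 1) / e) *\<^sub>R v + (1 / e) *\<^sub>R v'"
      using e(1) by (simp add: v'_def algebra_simps flip: scaleR_add_left) (simp add: diff_divide_distrib)
    moreover have "v \<in> parameter_cone S" "v' \<in> parameter_cone S"
      using \<open>v \<in> F\<close> e(2) FS by (auto simp: v'_def)
    ultimately have "refines (induced w) (induced v)"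
      using refines_induced_between[OF S, of v v' "(e - 1) / e" "1 / e"] e(1) by simp
    then show "v \<in> parameter_cone (induced w)"
      using \<open>v \<in> parameter_cone S\<close> by (simp add: parameter_cone_def)
  qed
  show "parameter_cone (induced w) \<subseteq> F"
  proof
    fix v assume v: "v \<in> parameter_cone (induced w)"
    have sub: "parameter_cone (induced w) \<subseteq> parameter_cone S"
      using \<open>w \<in> F\<close> FS by (intro parameter_cone_mono) (auto simp: parameter_cone_def)
    obtain \<epsilon> where \<epsilon>: "\<epsilon> > 0" "(1 + \<epsilon>) *\<^sub>R w + (- \<epsilon>) *\<^sub>R v \<in> parameter_cone (induced w)"
      using v \<open>w \<in> W\<close> by (rule parameter_cone_extrapolate)
    define v' where "v' = (1 + \<epsilon>) *\<^sub>R w + (- \<epsilon>) *\<^sub>R v"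
    show "v \<in> F"
    proof (cases "v = w")
      case False
      have "w = (1 / (1 + \<epsilon>)) *\<^sub>R ((1 + \<epsilon>) *\<^sub>R w)" using \<epsilon>(1) by simp
      also have "(1 + \<epsilon>) *\<^sub>R w = \<epsilon> *\<^sub>R v + v'" by (simp add: v'_def)
      also have "(1 / (1 + \<epsilon>)) *\<^sub>R (\<epsilon> *\<^sub>R v + v') = (\<epsilon> / (1 + \<epsilon>)) *\<^sub>R v + (1 / (1 + \<epsilon>)) *\<^sub>R v'"
        by (simp add: scaleR_add_right)
      also have "\<epsilon> / (1 + \<epsilon>) = 1 - 1 / (1 + \<epsilon>)" using \<epsilon>(1) by (simp add: field_simps)
      finally have "w = (1 - 1 / (1 + \<epsilon>)) *\<^sub>R v + (1 / (1 + \<epsilon>)) *\<^sub>R v'" .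
      moreover have "v \<noteq> v'"
      proof
        assume "v = v'"
        then have "(1 + \<epsilon>) *\<^sub>R v = (1 + \<epsilon>) *\<^sub>R w" by (simp add: v'_def algebra_simps)
        then show False using \<epsilon>(1) False by simp
      qed
      ultimately have "w \<in> open_segment v v'"
        using \<epsilon>(1) unfolding in_segment(2) by (intro conjI exI[of _ "1 / (1 + \<epsilon>)"]) auto
      then show ?thesis
        using F \<open>w \<in> F\<close> v \<epsilon>(2) sub unfolding face_of_def v'_def by blast
    qed (use \<open>w \<in> F\<close> in simp)
  qed
qed

lemma parameter_cone_eq_of_rel_interior:
  assumes "subdivision A S" "w \<in> rel_interior (parameter_cone S)"
  shows "parameter_cone S = parameter_cone (induced w)"
  using face_of_parameter_cone[OF assms(1) face_of_refl[OF convex_parameter_cone[OF assms(1)]] assms(2)] .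

lemma in_rel_interior_parameter_cone:
  assumes "w \<in> W"
  shows "w \<in> rel_interior (parameter_cone (induced w))"
proof -
  have "convex (parameter_cone (induced w))"
    by (rule convex_parameter_cone[OF subdivision_induced])
  moreover have "parameter_cone (induced w) \<noteq> {}"
    using parameter_cone_induced[OF assms] by blast
  moreover have "\<exists>e>1. (1 - e) *\<^sub>R v + e *\<^sub>R w \<in> parameter_cone (induced w)"
    if v: "v \<in> parameter_cone (induced w)" for v
  proof -
    obtain \<epsilon> where "\<epsilon> > 0" "(1 + \<epsilon>) *\<^sub>R w + (- \<epsilon>) *\<^sub>R v \<in> parameter_cone (induced w)"
      using v assms by (rule parameter_cone_extrapolate)
    then show ?thesis by (intro exI[of _ "1 + \<epsilon>"]) (simp add: add.commute)
  qed
  ultimately show ?thesis by (simp add: convex_rel_interior_iff)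
qed

lemma induced_eq_of_rel_interior:
  assumes "subdivision A S" "w \<in> rel_interior (parameter_cone S)" "v \<in> rel_interior (parameter_cone S)"
  shows "induced w = induced v"
proof -
  have eq: "parameter_cone (induced w) = parameter_cone (induced v)"
    using parameter_cone_eq_of_rel_interior[OF assms(1)] assms(2,3) by simp
  have "w \<in> W" "v \<in> W"
    using assms(2,3) rel_interior_subset by (auto simp: parameter_cone_def)
  then have "refines (induced v) (induced w)" "refines (induced w) (induced v)"
    using eq parameter_cone_induced by (auto simp: parameter_cone_def)
  then show ?thesis
    using regular_subdivision_subset_if_refines[OF finite_points] by blast
qed

text \<open>The subdivision at an inner point of a segment refines those at both ends. If it is in
  turn refined by \<open>T\<close>, transitivity places both ends in the cone of
  \<open>T\<close>.\<close>

lemma parameter_cone_Int_face_of: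
  assumes S: "subdivision A S" and T: "subdivision A T"
  shows "parameter_cone S \<inter> parameter_cone T face_of parameter_cone S"
  unfolding face_of_def
proof (intro conjI ballI impI)
  show "convex (parameter_cone S \<inter> parameter_cone T)"
    by (intro convex_Int convex_parameter_cone S T)
  fix a b x
  assume ab: "a \<in> parameter_cone S" "b \<in> parameter_cone S"
    and x: "x \<in> parameter_cone S \<inter> parameter_cone T" "x \<in> open_segment a b"
  then obtain u where u: "0 < u" "u < 1" "x = (1 - u) *\<^sub>R a + u *\<^sub>R b"
    by (auto simp: in_segment)
  then have "refines (induced x) (induced a)" "refines (induced x) (induced b)"
    using refines_induced_between[OF S ab, of "1 - u" u]
      refines_induced_between[OF S ab(2,1), of u "1 - u"] by (auto simp: add.commute)
  then show "a \<in> parameter_cone S \<inter> parameter_cone T" "b \<in> parameter_cone S \<inter> parameter_cone T"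
    using ab x(1) refines_trans by (auto simp: parameter_cone_def)
qed simp

text \<open>The index set contains all subdivisions of \<open>A\<close>, of which there are finitely
  many. A nonempty face reappears as the cone of the regular subdivision at any of its relatively
  interior points.\<close>

lemma polyhedral_fan_parameter_cones: "polyhedral_fan (parameter_cone ` {S. subdivision A S})"
  unfolding polyhedral_fan_def
proof (intro conjI ballI allI impI)
  have "S \<in> Pow (Pow A)" if "subdivision A S" for S
    using subdivision_cells[OF that] by auto
  then have "{S. subdivision A S} \<subseteq> Pow (Pow A)" by blast
  moreover have "finite (Pow (Pow A))" using finite_points by simp
  ultimately show "finite (parameter_cone ` {S. subdivision A S})"
    by (intro finite_imageI) (rule finite_subset)
next
  fix \<sigma> assume "\<sigma> \<in> parameter_cone ` {S. subdivision A S}"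
  then obtain S where S: "subdivision A S" "\<sigma> = parameter_cone S" by blast
  show "\<sigma> \<noteq> {}" "polyhedron \<sigma>" "cone \<sigma>"
    using zero_in_parameter_cone[OF S(1)] polyhedron_parameter_cone[OF S(1)]
      cone_parameter_cone[OF S(1)] S(2) by auto
  fix F assume F: "F face_of \<sigma> \<and> F \<noteq> {}"
  then have "convex F" using face_of_imp_convex by blast
  then have "rel_interior F \<noteq> {}" using F by (simp add: rel_interior_eq_empty)
  then obtain w where "w \<in> rel_interior F" by blast
  then have "F = parameter_cone (induced w)"
    using face_of_parameter_cone[OF S(1)] F S(2) by blast
  then show "F \<in> parameter_cone ` {S. subdivision A S}"
    using subdivision_induced by blast
next
  fix \<sigma> \<tau>
  assume "\<sigma> \<in> parameter_cone ` {S. subdivision A S}" "\<tau> \<in> parameter_cone ` {S. subdivision A S}"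
  then obtain S T where S: "subdivision A S" "\<sigma> = parameter_cone S"
    and T: "subdivision A T" "\<tau> = parameter_cone T" by blast
  show "\<sigma> \<inter> \<tau> face_of \<sigma>"
    using parameter_cone_Int_face_of[OF S(1) T(1)] S(2) T(2) by simp
  show "\<sigma> \<inter> \<tau> face_of \<tau>"
    using parameter_cone_Int_face_of[OF T(1) S(1)] S(2) T(2) by (simp add: Int_commute)
qed

end

section \<open>Strata\<close>

lemma labeled_dag_less: "G \<in> labeled_dags \<Longrightarrow> (j, i) \<in> G \<Longrightarrow> j < i"
  by (auto simp: labeled_dags_def complete_dag_def)

lemma edge_vector_nth:
  "edge_vector (j, i) $ k = (if k = i then 1 else 0) - (if k = j then 1 else 0)"
  by (simp add: edge_vector_def axis_def)

lemma edge_vector_eq_iff: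
  assumes "j \<noteq> i" "j' \<noteq> i'"
  shows "edge_vector (j, i) = edge_vector (j', i') \<longleftrightarrow> j = j' \<and> i = i'"
proof
  assume eq: "edge_vector (j, i) = edge_vector (j', i')"
  have "edge_vector (j', i') $ i = 1" "edge_vector (j', i') $ j = -1"
    using assms unfolding eq[symmetric] by (auto simp: edge_vector_nth)
  then show "j = j' \<and> i = i'"
    by (auto simp: edge_vector_nth split: if_splits)
qed simp

lemma edge_vector_nonzero: "j \<noteq> i \<Longrightarrow> edge_vector (j, i) \<noteq> 0"
  using edge_vector_nth[of j i i] by auto

lemma inj_on_edge_vector: "G \<in> labeled_dags \<Longrightarrow> inj_on edge_vector G"
proof (rule inj_onI)
  fix e f assume G: "G \<in> labeled_dags" and ef: "e \<in> G" "f \<in> G" "edge_vector e = edge_vector f"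
  obtain j i j' i' where "e = (j, i)" "f = (j', i')" by fastforce
  then show "e = f"
    using ef labeled_dag_less[OF G] edge_vector_eq_iff[of j i j' i'] by fastforce
qed

lemma zero_notin_edge_vectors: "G \<in> labeled_dags \<Longrightarrow> 0 \<notin> edge_vector ` G"
  by (auto dest!: labeled_dag_less edge_vector_nonzero[OF less_imp_neq])

lemma heights_zero: "heights G h0 w 0 = h0"
  by (simp add: heights_def fundamental_polytope_def)

lemma heights_edge_vector:
  assumes "G \<in> labeled_dags" "e \<in> G"
  shows "heights G h0 w (edge_vector e) = w $ e"
proof -
  have "edge_vector e \<noteq> 0" using zero_notin_edge_vectors assms by force
  then show ?thesis
    using assms by (simp add: heights_def fundamental_polytope_def the_inv_into_f_f inj_on_edge_vector)
qed

lemma weightsD: "w \<in> weights G \<Longrightarrow> e \<notin> G \<Longrightarrow> w $ e = 0"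
  unfolding weights_def by blast

lemma subspace_weights: "subspace (weights G)"
  by (auto simp: subspace_def weights_def)

text \<open>The value 0 at the origin is what makes the heights linear in \<open>w\<close>; another
  constant would make them merely affine.\<close>

lemma linear_heights_fundamental_polytope:
  assumes "G \<in> labeled_dags"
  shows "linear_heights (fundamental_polytope G) (weights G) (heights G 0)"
proof (rule linear_heights.intro)
  show "finite (fundamental_polytope G)" by (simp add: fundamental_polytope_def)
  show "subspace (weights G)" by (rule subspace_weights)
  fix a assume "a \<in> fundamental_polytope G"
  then consider "a = 0" | e where "e \<in> G" "a = edge_vector e"
    by (auto simp: fundamental_polytope_def)
  then show "linear (\<lambda>w. heights G 0 w a)"
    by cases (auto intro!: linearI simp: heights_zero heights_edge_vector[OF assms])
qed

section \<open>The open polytrope region as the relative interior of a polyhedron\<close>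

definition detours :: "('n \<times> 'n) set \<Rightarrow> (('n \<times> 'n) \<times> 'n list) set" where
  "detours G = {(e, p). e \<in> G \<and> p \<in> dpaths G (fst e) (snd e) \<and> p \<noteq> [fst e, snd e]}"

definition excess :: "('n::finite \<times> 'n) \<times> 'n list \<Rightarrow> real ^ ('n \<times> 'n) \<Rightarrow> real" where
  "excess z w = w $ fst z - path_weight w (snd z)"

lemma path_weight_edge: "path_weight w [j, i] = w $ (j, i)"
  by (simp add: path_weight_def)

lemma polytrope_region_iff:
  "w \<in> polytrope_region G \<longleftrightarrow> w \<in> weights G \<and>
    (\<forall>j i. (j, i) \<in> G \<longrightarrow> (\<forall>p\<in>dpaths G j i. p \<noteq> [j, i] \<longrightarrow> w $ (j, i) < path_weight w p))"
proof -
  have "weighted_transitive_reduction G w = G \<longleftrightarrow>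
      (\<forall>j i. (j, i) \<in> G \<longrightarrow> (j, i) \<in> weighted_transitive_reduction G w)"
    by (auto simp: weighted_transitive_reduction_def)
  then show ?thesis
    by (simp add: polytrope_region_def weighted_transitive_reduction_def path_weight_edge)
qed

lemma polytrope_region_eq: "polytrope_region G = weights G \<inter> (\<Inter>z\<in>detours G. excess z -` {..<0})"
  by (rule set_eqI) (simp add: polytrope_region_iff detours_def excess_def, blast)

lemma linear_excess: "linear (excess z)"
  by (rule linearI)
    (simp_all add: excess_def path_weight_def sum_list_addf sum_list_const_mult algebra_simps)

lemma dpaths_strict_sorted:
  assumes "G \<in> labeled_dags" "p \<in> dpaths G j i"
  shows "sorted_wrt (<) p"
proof -
  have "successively (<) p"
    using assms by (auto simp: dpaths_def dest: labeled_dag_less elim!: successively_mono)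
  then show ?thesis by (simp add: successively_conv_sorted_wrt)
qed

text \<open>Labels increase along a path, so a path is a list without repetition, and there are only
  finitely many of these.\<close>

lemma finite_dpaths:
  fixes G :: "('n::{finite,linorder} \<times> 'n) set"
  assumes "G \<in> labeled_dags"
  shows "finite (dpaths G j i)"
proof (rule finite_subset)
  show "dpaths G j i \<subseteq> {p. set p \<subseteq> UNIV \<and> distinct p}"
    using dpaths_strict_sorted[OF assms] strict_sorted_iff by blast
qed (rule finite_subset_distinct, simp)

lemma finite_detours:
  fixes G :: "('n::{finite,linorder} \<times> 'n) set"
  assumes "G \<in> labeled_dags"
  shows "finite (detours G)"
proof (rule finite_subset)
  show "detours G \<subseteq> (SIGMA e:G. dpaths G (fst e) (snd e))" by (auto simp: detours_def)
qed (simp add: finite_dpaths[OF assms])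

text \<open>A canonical point of the open region: an edge costs 1, whereas every detour has at least
  two edges.\<close>

definition unit_weights :: "('n::finite \<times> 'n) set \<Rightarrow> real ^ ('n \<times> 'n)" where
  "unit_weights G = (\<chi> e. if e \<in> G then 1 else 0)"

lemma path_weight_unit_weights:
  "successively (\<lambda>u v. (u, v) \<in> G) p \<Longrightarrow> path_weight (unit_weights G) p = real (length p - 1)"
proof (induction p rule: induct_list012)
  case (3 a b p)
  then show ?case by (simp add: path_weight_def unit_weights_def)
qed (auto simp: path_weight_def)

text \<open>Lists count nodes, so three entries mean two edges. A single node is excluded by
  distinct endpoints, and two nodes would be the edge itself.\<close>

lemma detour_long:
  assumes "G \<in> labeled_dags" "(e, p) \<in> detours G"
  shows "length p \<ge> 3"
proof (rule ccontr)
  assume "\<not> length p \<ge> 3"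
  moreover have "p \<noteq> []" "hd p = fst e" "last p = snd e" "p \<noteq> [fst e, snd e]" "fst e \<noteq> snd e"
    using assms labeled_dag_less[OF assms(1), of "fst e" "snd e"] by (auto simp: detours_def dpaths_def)
  ultimately show False
    by (cases p; cases "tl p"; cases "tl (tl p)") auto
qed

lemma excess_unit_weights:
  assumes "G \<in> labeled_dags" "z \<in> detours G"
  shows "excess z (unit_weights G) < 0"
proof -
  obtain e p where z: "z = (e, p)" by fastforce
  have "e \<in> G" "successively (\<lambda>u v. (u, v) \<in> G) p"
    using assms z by (auto simp: detours_def dpaths_def)
  then show ?thesis
    using detour_long[of G e p] assms
    by (simp add: z excess_def path_weight_unit_weights) (simp add: unit_weights_def)
qed

lemma unit_weights_in_weights: "unit_weights G \<in> weights G"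
  by (simp add: unit_weights_def weights_def)

text \<open>The strict inequalities of the open region without the vanishing of coordinates off
  \<open>G\<close>. It is open in the full ambient space, unlike the open region itself, so it can
  be split off when relative interiors are computed.\<close>

definition strict_region :: "('n::finite \<times> 'n) set \<Rightarrow> (real ^ ('n \<times> 'n)) set" where
  "strict_region G = (\<Inter>z\<in>detours G. excess z -` {..<0})"

lemma open_strict_region:
  fixes G :: "('n::{finite,linorder} \<times> 'n) set"
  assumes "G \<in> labeled_dags"
  shows "open (strict_region G)"
  unfolding strict_region_def
  using finite_detours[OF assms] linear_continuous_on[OF linear_conv_bounded_linear[THEN iffD1, OF linear_excess]]
  by (intro open_INT ballI open_vimage) auto

lemma convex_strict_region: "convex (strict_region G)"
  unfolding strict_region_def
  by (intro convex_INT convex_linear_vimage linear_excess convex_real_interval)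

lemma polytrope_region_Int: "polytrope_region G = weights G \<inter> strict_region G"
  by (simp add: polytrope_region_eq strict_region_def)

definition closed_region :: "('n::finite \<times> 'n) set \<Rightarrow> (real ^ ('n \<times> 'n)) set" where
  "closed_region G = weights G \<inter> (\<Inter>z\<in>detours G. excess z -` {..0})"

lemma polyhedron_closed_region:
  fixes G :: "('n::{finite,linorder} \<times> 'n) set"
  assumes "G \<in> labeled_dags"
  shows "polyhedron (closed_region G)"
proof -
  have "polyhedron {..0::real}"
    using polyhedron_halfspace_le[of "1::real" 0] by (simp add: atMost_def)
  then have "polyhedron (excess z -` {..0})" for z :: "('n \<times> 'n) \<times> 'n list"
    by (rule polyhedron_linear_preimage[OF linear_excess])
  moreover have "polyhedron (weights G)"
    by (simp add: affine_imp_polyhedron subspace_imp_affine subspace_weights)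
  ultimately show ?thesis
    unfolding closed_region_def using finite_detours[OF assms]
    by (intro polyhedron_Int polyhedron_Inter) auto
qed

text \<open>A relatively interior \<open>w\<close> can be reached from the unit weights and overshot
  within the closed region. Each excess is strictly negative at the unit weights and at most 0
  beyond \<open>w\<close>, hence strictly negative at \<open>w\<close>. The other inclusion is
  openness of the strict inequalities.\<close>

lemma rel_interior_closed_region:
  fixes G :: "('n::{finite,linorder} \<times> 'n) set"
  assumes G: "G \<in> labeled_dags"
  shows "rel_interior (closed_region G) = polytrope_region G"
proof
  have sub: "polytrope_region G \<subseteq> closed_region G"
    by (force simp: polytrope_region_eq closed_region_def)
  have "affine hull (closed_region G) \<subseteq> weights G"
    by (intro hull_minimal subspace_imp_affine subspace_weights) (auto simp: closed_region_def)
  then have "strict_region G \<inter> affine hull (closed_region G) \<subseteq> closed_region G"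
    using sub by (auto simp: polytrope_region_Int)
  then show "polytrope_region G \<subseteq> rel_interior (closed_region G)"
    using sub open_strict_region[OF G] unfolding mem_rel_interior subset_iff polytrope_region_Int by blast
  show "rel_interior (closed_region G) \<subseteq> polytrope_region G"
  proof
    fix w assume w: "w \<in> rel_interior (closed_region G)"
    have "excess z w < 0" if z: "z \<in> detours G" for z
    proof -
      let ?u = "unit_weights G"
      have u: "?u \<in> closed_region G"
        using excess_unit_weights[OF G] unit_weights_in_weights by (auto simp: closed_region_def less_imp_le)
      have "convex (closed_region G)"
        using polyhedron_closed_region[OF G] by (rule polyhedron_imp_convex)
      then obtain e where e: "e > 1" "(1 - e) *\<^sub>R ?u + e *\<^sub>R w \<in> closed_region G"
        using w u convex_rel_interior_iff[of "closed_region G" w] by blast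
      then have "(1 - e) * excess z ?u + e * excess z w \<le> 0"
        using z linear_excess[of z] by (auto simp: closed_region_def linear_add linear_scale)
      moreover have "(1 - e) * excess z ?u > 0"
        using e(1) excess_unit_weights[OF G z] by (simp add: mult_neg_neg)
      ultimately have "e * excess z w < 0" by linarith
      then show ?thesis using e(1) by (simp add: mult_less_0_iff)
    qed
    moreover have "w \<in> weights G" using w rel_interior_subset by (auto simp: closed_region_def)
    ultimately show "w \<in> polytrope_region G" by (auto simp: polytrope_region_eq)
  qed
qed

text \<open>An open set meeting \<open>C\<close> also meets its relative interior, which is dense in
  \<open>C\<close>; then relative interiors commute with the intersection.\<close>

lemma rel_interior_Int_open:
  fixes C U :: "'a::euclidean_space set"
  assumes "convex C" "convex U" "open U" "C \<inter> U \<noteq> {}"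
  shows "rel_interior (C \<inter> U) = rel_interior C \<inter> U"
proof -
  have "U \<inter> closure (rel_interior C) \<noteq> {}"
    using assms closure_subset convex_closure_rel_interior[OF assms(1)] by blast
  then have "rel_interior C \<inter> rel_interior U \<noteq> {}"
    using open_Int_closure_eq_empty[OF assms(3)] by (auto simp: rel_interior_open[OF assms(3)])
  then show ?thesis
    using convex_rel_interior_inter_two[OF assms(1,2)] by (simp add: rel_interior_open[OF assms(3)])
qed

text \<open>The finite coordinates reveal the edge set and the weights on it; off the edge set both
  weight vectors vanish by convention.\<close>

lemma trop_point_inject:
  assumes GH: "G \<in> labeled_dags" "H \<in> labeled_dags" and wv: "w \<in> weights G" "v \<in> weights H"
    and eq: "trop_point G w = trop_point H v"
  shows "G = H \<and> w = v"
proof -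
  have *: "(if e \<in> G then ereal (w $ e) else \<infinity>) = (if e \<in> H then ereal (v $ e) else \<infinity>)"
    if "e \<in> complete_dag" for e
    using fun_cong[OF eq, of e] that by (simp add: trop_point_def)
  have sub: "G \<subseteq> complete_dag" "H \<subseteq> complete_dag" using GH by (auto simp: labeled_dags_def)
  have "e \<in> G \<longleftrightarrow> e \<in> H" for e
    using *[of e] sub by (cases "e \<in> complete_dag") (auto split: if_splits)
  then have "G = H" by blast
  moreover have "w $ e = v $ e" for e
    using *[of e] sub weightsD[OF wv(1), of e] weightsD[OF wv(2), of e] \<open>G = H\<close>
    by (cases "e \<in> G") auto
  ultimately show ?thesis by (simp add: vec_eq_iff)
qed

section \<open>The restricted secondary fan of one stratum\<close>

context
  fixes G :: "('n::{finite,linorder} \<times> 'n) set"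
  assumes G: "G \<in> labeled_dags"
begin

interpretation linear_heights "fundamental_polytope G" "weights G" "heights G 0"
  by (rule linear_heights_fundamental_polytope[OF G])

lemma stratum_cones_eq:
  "stratum_cones G =
    (\<lambda>\<sigma>. \<sigma> \<inter> polytrope_region G) ` parameter_cone ` {S. subdivision (fundamental_polytope G) S} - {{}}"
proof -
  have "{w \<in> polytrope_region G. heights G 0 w \<in> secondary_cone (fundamental_polytope G) S} =
      parameter_cone S \<inter> polytrope_region G" for S
    by (auto simp: secondary_cone_def parameter_cone_def polytrope_region_Int heights_def)
  moreover have "secondary_fan (fundamental_polytope G) =
      secondary_cone (fundamental_polytope G) ` {S. subdivision (fundamental_polytope G) S}"
    by (auto simp: secondary_fan_def)
  then have "stratum_cones G = (\<lambda>\<sigma>. {w \<in> polytrope_region G. heights G 0 w \<in> \<sigma>}) `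
      secondary_cone (fundamental_polytope G) ` {S. subdivision (fundamental_polytope G) S} - {{}}"
    by (simp only: stratum_cones_def Setcompr_eq_image Collect_mem_eq)
  ultimately show ?thesis by (simp only: image_image)
qed

lemma stratum_conesE:
  assumes "\<sigma> \<in> stratum_cones G"
  obtains S where "subdivision (fundamental_polytope G) S"
    "\<sigma> = parameter_cone S \<inter> polytrope_region G" "\<sigma> \<noteq> {}"
  using assms unfolding stratum_cones_eq by blast

lemma restricted_polyhedral_fan_stratum_cones:
  "restricted_polyhedral_fan (polytrope_region G) (stratum_cones G)"
  unfolding restricted_polyhedral_fan_def stratum_cones_eq
  by (intro exI[of _ "parameter_cone ` {S. subdivision (fundamental_polytope G) S}"] conjI
      polyhedral_fan_parameter_cones refl)

lemma stratum_cone_rel_interior: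
  assumes "\<sigma> \<in> stratum_cones G" "w \<in> rel_interior \<sigma>"
  shows "w \<in> polytrope_region G" "\<sigma> = parameter_cone (induced w) \<inter> polytrope_region G"
    "\<And>v. v \<in> rel_interior \<sigma> \<Longrightarrow> induced w = induced v"
proof -
  obtain S where S: "subdivision (fundamental_polytope G) S"
      "\<sigma> = parameter_cone S \<inter> polytrope_region G" "\<sigma> \<noteq> {}"
    using assms(1) by (rule stratum_conesE)
  \<comment> \<open>The parameter cone already lies in \<open>weights G\<close>, so only the open
    factor of the region has to be intersected, as the formula for relative interiors
    demands.\<close>
  have \<sigma>: "\<sigma> = parameter_cone S \<inter> strict_region G"
    using S(2) by (auto simp: polytrope_region_Int parameter_cone_def)
  then have rel: "rel_interior \<sigma> = rel_interior (parameter_cone S) \<inter> strict_region G"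
    using S(3) rel_interior_Int_open[OF convex_parameter_cone[OF S(1)] convex_strict_region open_strict_region[OF G]]
    by simp
  show "w \<in> polytrope_region G"
    using assms(2) rel_interior_subset S(2) by blast
  show "\<sigma> = parameter_cone (induced w) \<inter> polytrope_region G"
    using parameter_cone_eq_of_rel_interior[OF S(1)] assms(2) rel S(2) by blast
  show "induced w = induced v" if "v \<in> rel_interior \<sigma>" for v
    using induced_eq_of_rel_interior[OF S(1)] assms(2) rel that by blast
qed

lemma stratum_cone_exists:
  assumes "w \<in> polytrope_region G"
  shows "\<exists>\<sigma>\<in>stratum_cones G. w \<in> rel_interior \<sigma>"
proof -
  let ?C = "parameter_cone (induced w)"
  have w: "w \<in> weights G" "w \<in> strict_region G" using assms by (auto simp: polytrope_region_Int)
  have "w \<in> rel_interior ?C" using in_rel_interior_parameter_cone[OF w(1)] .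
  moreover have "?C \<inter> polytrope_region G = ?C \<inter> strict_region G"
    by (auto simp: polytrope_region_Int parameter_cone_def)
  moreover have "?C \<inter> strict_region G \<noteq> {}" using w parameter_cone_induced by blast
  ultimately have "w \<in> rel_interior (?C \<inter> polytrope_region G)" "?C \<inter> polytrope_region G \<noteq> {}"
    using w rel_interior_Int_open[OF convex_parameter_cone[OF subdivision_induced] convex_strict_region open_strict_region[OF G]]
    by auto
  then show ?thesis unfolding stratum_cones_eq using subdivision_induced by blast
qed

lemma stratum_cone_unique:
  assumes "\<sigma> \<in> stratum_cones G" "\<tau> \<in> stratum_cones G" "w \<in> rel_interior \<sigma>" "w \<in> rel_interior \<tau>"
  shows "\<sigma> = \<tau>"
  by (rule trans[OF stratum_cone_rel_interior(2)[OF assms(1,3)]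
      stratum_cone_rel_interior(2)[OF assms(2,4), symmetric]])

lemma stratum_cone_nonempty:
  assumes "\<sigma> \<in> stratum_cones G"
  shows "rel_interior \<sigma> \<noteq> {}"
proof -
  obtain S where S: "subdivision (fundamental_polytope G) S"
      "\<sigma> = parameter_cone S \<inter> polytrope_region G" "\<sigma> \<noteq> {}"
    using assms by (rule stratum_conesE)
  have "convex \<sigma>"
    unfolding S(2) polytrope_region_Int
    by (intro convex_Int convex_parameter_cone S(1) subspace_imp_convex subspace_weights convex_strict_region)
  then show ?thesis using S(3) by (simp add: rel_interior_eq_empty)
qed

lemma Union_stratum_cones: "\<Union> (stratum_cones G) = polytrope_region G"
proof
  show "\<Union> (stratum_cones G) \<subseteq> polytrope_region G" by (auto elim: stratum_conesE)
  show "polytrope_region G \<subseteq> \<Union> (stratum_cones G)"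
    using stratum_cone_exists rel_interior_subset by blast
qed

lemma origin_cells_eq_of_rel_interior:
  assumes "\<sigma> \<in> stratum_cones G" "w \<in> rel_interior \<sigma>" "v \<in> rel_interior \<sigma>"
  shows "origin_cells G w = origin_cells G v"
  using stratum_cone_rel_interior(3)[OF assms] by (simp add: origin_cells_def)

lemma open_stratum_eq: "open_stratum G = trop_point G ` polytrope_region G"
  by (simp add: open_stratum_def Union_stratum_cones)

end

section \<open>The union of the strata and its partition into relatively open cones\<close>

lemma moduli_space_eq:
  "R \<subseteq> labeled_dags \<Longrightarrow> moduli_space R = (\<Union>G\<in>R. trop_point G ` polytrope_region G)"
  unfolding moduli_space_def by (intro SUP_cong refl open_stratum_eq) blast

lemma polytrope_region_subset_weights: "polytrope_region G \<subseteq> weights G"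
  by (auto simp: polytrope_region_def)

lemma disjoint_open_strata:
  assumes "R \<subseteq> labeled_dags"
  shows "disjoint_family_on open_stratum R"
  unfolding disjoint_family_on_def
proof (intro ballI impI)
  fix G H assume GH: "G \<in> R" "H \<in> R" "G \<noteq> H"
  then have "G \<in> labeled_dags" "H \<in> labeled_dags" using assms by auto
  with GH(3) trop_point_inject[of G H] have "trop_point G w \<noteq> trop_point H v"
    if "w \<in> polytrope_region G" "v \<in> polytrope_region H" for w v
    using that polytrope_region_subset_weights by blast
  then show "open_stratum G \<inter> open_stratum H = {}"
    by (auto simp: open_stratum_eq[OF \<open>G \<in> labeled_dags\<close>] open_stratum_eq[OF \<open>H \<in> labeled_dags\<close>])
qed

lemma moduli_space_subset_trop_space:
  assumes "R \<subseteq> labeled_dags"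
  shows "moduli_space R \<subseteq> trop_space"
  unfolding moduli_space_eq[OF assms] by (auto simp: trop_point_def trop_space_def split: if_splits)

lemma polyhedral_subspace_moduli_space:
  fixes R :: "('n::{finite,linorder} \<times> 'n) set set"
  assumes "R \<subseteq> labeled_dags"
  shows "polyhedral_subspace (moduli_space R)"
  unfolding polyhedral_subspace_def
proof (intro exI[of _ "(\<lambda>G. (G, closed_region G)) ` R"] conjI)
  show "\<forall>(F, P)\<in>(\<lambda>G. (G, closed_region G)) ` R. F \<subseteq> complete_dag \<and> P \<subseteq> weights F \<and> polyhedron P"
  proof clarify
    fix G assume "G \<in> R"
    then have "G \<in> labeled_dags" using assms by blast
    then show "G \<subseteq> complete_dag \<and> closed_region G \<subseteq> weights G \<and> polyhedron (closed_region G)"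
      using polyhedron_closed_region by (simp add: labeled_dags_def closed_region_def)
  qed
  show "moduli_space R = (\<Union>(F, P)\<in>(\<lambda>G. (G, closed_region G)) ` R. trop_point F ` rel_interior P)"
  proof -
    have "rel_interior (closed_region G) = polytrope_region G" if "G \<in> R" for G
      using that assms by (intro rel_interior_closed_region) blast
    then show ?thesis by (simp add: moduli_space_eq[OF assms])
  qed
qed simp

lemma partition_moduli_cones:
  fixes R :: "('n::{finite,linorder} \<times> 'n) set set"
  assumes R: "R \<subseteq> labeled_dags"
  shows "partition_on (moduli_space R) (moduli_cones R)"
proof (rule partition_onI)
  show "\<Union> (moduli_cones R) = moduli_space R"
  proof (intro equalityI subsetI)
    fix x assume "x \<in> \<Union> (moduli_cones R)"
    then obtain G \<sigma> w where "G \<in> R" "\<sigma> \<in> stratum_cones G" "w \<in> rel_interior \<sigma>" "x = trop_point G w"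
      by (auto simp: moduli_cones_def)
    then show "x \<in> moduli_space R"
      using stratum_cone_rel_interior(1) R unfolding moduli_space_eq[OF R] by blast
  next
    fix x assume "x \<in> moduli_space R"
    then obtain G w where G: "G \<in> R" "w \<in> polytrope_region G" "x = trop_point G w"
      unfolding moduli_space_eq[OF R] by blast
    moreover obtain \<sigma> where "\<sigma> \<in> stratum_cones G" "w \<in> rel_interior \<sigma>"
      using stratum_cone_exists[of G w] G R by blast
    ultimately show "x \<in> \<Union> (moduli_cones R)" unfolding moduli_cones_def by blast
  qed
next
  fix c d assume cd: "c \<in> moduli_cones R" "d \<in> moduli_cones R" "c \<noteq> d"
  obtain G \<sigma> where c: "G \<in> R" "\<sigma> \<in> stratum_cones G" "c = trop_point G ` rel_interior \<sigma>"
    using cd(1) by (auto simp: moduli_cones_def)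
  obtain H \<tau> where d: "H \<in> R" "\<tau> \<in> stratum_cones H" "d = trop_point H ` rel_interior \<tau>"
    using cd(2) by (auto simp: moduli_cones_def)
  have dags: "G \<in> labeled_dags" "H \<in> labeled_dags" using c d R by auto
  show "disjnt c d"
  proof (rule ccontr)
    assume "\<not> disjnt c d"
    then obtain w v where wv: "w \<in> rel_interior \<sigma>" "v \<in> rel_interior \<tau>" "trop_point G w = trop_point H v"
      using c d by (auto simp: disjnt_def)
    have "w \<in> weights G" "v \<in> weights H"
      using stratum_cone_rel_interior(1) polytrope_region_subset_weights dags c d wv by blast+
    then have "G = H" "w = v" using trop_point_inject[OF dags _ _ wv(3)] by auto
    then have "\<sigma> = \<tau>" using stratum_cone_unique[OF dags(1)] c d wv by blast
    then show False using c d cd(3) \<open>G = H\<close> by simp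
  qed
next
  show "{} \<notin> moduli_cones R"
    using stratum_cone_nonempty R by (force simp: moduli_cones_def)
qed

section \<open>Covectors of polytropes\<close>

lemma polytrope_iff:
  assumes "G \<in> labeled_dags"
  shows "x \<in> polytrope G w \<longleftrightarrow> (\<forall>j i. (j, i) \<in> G \<longrightarrow> x $ i - x $ j \<le> w $ (j, i))"
proof -
  have "(j, i) \<in> G \<Longrightarrow> i \<noteq> j" for j i using labeled_dag_less[OF assms] by blast
  then show ?thesis by (auto simp: polytrope_def adjacency_def)
qed

definition tight_edges :: "('n::finite \<times> 'n) set \<Rightarrow> real ^ ('n \<times> 'n) \<Rightarrow> real ^ 'n \<Rightarrow> ('n \<times> 'n) set" where
  "tight_edges G w x = {(j, i) \<in> G. x $ i - x $ j = w $ (j, i)}"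

definition tight_sets :: "('n::finite \<times> 'n) set \<Rightarrow> real ^ ('n \<times> 'n) \<Rightarrow> ('n \<times> 'n) set set" where
  "tight_sets G w = tight_edges G w ` polytrope G w"

text \<open>The initial part of a covector: when a point moves slightly in direction
  \<open>d\<close>, the ties in each row are broken in favour of the entries where \<open>d\<close>
  is largest.\<close>

definition leading :: "('n::finite \<times> 'n) set \<Rightarrow> real ^ 'n \<Rightarrow> ('n \<times> 'n) set" where
  "leading C d = {(j, i) \<in> C. \<forall>l. (j, l) \<in> C \<longrightarrow> d $ l \<le> d $ i}"

lemma tight_edges_subset: "tight_edges G w x \<subseteq> G"
  by (auto simp: tight_edges_def)

lemma mem_affine_covector:
  "(j, i) \<in> affine_covector V p \<longleftrightarrow> V j i \<noteq> \<infinity> \<and>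
    (\<forall>l. V j l \<noteq> \<infinity> \<longrightarrow> p $ l - real_of_ereal (V j l) \<le> p $ i - real_of_ereal (V j i))"
proof (cases "V j i = \<infinity>")
  case False
  let ?f = "\<lambda>l. p $ l - real_of_ereal (V j l)"
  have "?f i = Max (?f ` {l. V j l \<noteq> \<infinity>}) \<longleftrightarrow> (\<forall>l. V j l \<noteq> \<infinity> \<longrightarrow> ?f l \<le> ?f i)"
  proof
    assume "?f i = Max (?f ` {l. V j l \<noteq> \<infinity>})"
    then show "\<forall>l. V j l \<noteq> \<infinity> \<longrightarrow> ?f l \<le> ?f i" by simp
  next
    assume "\<forall>l. V j l \<noteq> \<infinity> \<longrightarrow> ?f l \<le> ?f i"
    then show "?f i = Max (?f ` {l. V j l \<noteq> \<infinity>})"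
      using False by (intro Max_eqI[symmetric]) auto
  qed
  then show ?thesis using False by (simp add: affine_covector_def)
qed (simp add: affine_covector_def)

lemma dpaths_singleton: "[j] \<in> dpaths G j j"
  by (simp add: dpaths_def)

lemma dpaths_edge: "(j, i) \<in> G \<Longrightarrow> [j, i] \<in> dpaths G j i"
  by (simp add: dpaths_def)

lemma dpaths_snoc: "p \<in> dpaths G j k \<Longrightarrow> (k, i) \<in> G \<Longrightarrow> p @ [i] \<in> dpaths G j i"
  by (auto simp: dpaths_def successively_append_iff)

lemma path_weight_snoc_dpaths:
  "p \<in> dpaths G j k \<Longrightarrow> path_weight w (p @ [i]) = path_weight w p + w $ (k, i)"
  by (auto simp: dpaths_def path_weight_snoc)

lemma kleene_columns_le: "p \<in> dpaths G j i \<Longrightarrow> kleene_columns G w j i \<le> ereal (path_weight w p)"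
  unfolding kleene_columns_def by (rule INF_lower)

section \<open>Shortest distances, tight paths and covectors in the polytrope\<close>

context
  fixes G :: "('n::{finite,linorder} \<times> 'n) set" and w :: "real ^ ('n \<times> 'n)"
  assumes G: "G \<in> labeled_dags"
begin

lemma kleene_columns_attained:
  assumes "dpaths G j i \<noteq> {}"
  shows "\<exists>p\<in>dpaths G j i. kleene_columns G w j i = ereal (path_weight w p)"
proof -
  let ?A = "(\<lambda>p. ereal (path_weight w p)) ` dpaths G j i"
  have "finite ?A" "?A \<noteq> {}" using finite_dpaths[OF G] assms by auto
  then have "Min ?A \<in> ?A" "Min ?A = Inf ?A" by (rule Min_in, rule Min_Inf)
  then have "kleene_columns G w j i \<in> ?A" by (simp add: kleene_columns_def)
  then show ?thesis by blast
qed

lemma kleene_columns_infinite_iff: "kleene_columns G w j i = \<infinity> \<longleftrightarrow> dpaths G j i = {}"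
proof
  assume "kleene_columns G w j i = \<infinity>"
  then show "dpaths G j i = {}" using kleene_columns_attained by force
qed (simp add: kleene_columns_def top_ereal_def)

lemma kleene_columns_finite: "p \<in> dpaths G j i \<Longrightarrow> kleene_columns G w j i \<noteq> \<infinity>"
  by (auto simp: kleene_columns_infinite_iff)

lemma kleene_columns_finiteE:
  assumes "kleene_columns G w j i \<noteq> \<infinity>"
  obtains p where "p \<in> dpaths G j i" "kleene_columns G w j i = ereal (path_weight w p)"
  using kleene_columns_attained[of j i] assms by (auto simp: kleene_columns_infinite_iff)

lemma kleene_columns_not_minus_infinity: "kleene_columns G w j i \<noteq> -\<infinity>"
  by (cases "kleene_columns G w j i = \<infinity>") (auto elim: kleene_columns_finiteE)

lemma path_weight_ge_dpaths:
  assumes "x \<in> polytrope G w" "p \<in> dpaths G j i"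
  shows "x $ i - x $ j \<le> path_weight w p"
proof -
  have "(a, a) \<notin> G" for a using labeled_dag_less[OF G] by blast
  then show ?thesis using path_weight_ge[OF assms(1), of p] assms(2) by (auto simp: dpaths_def)
qed

lemma kleene_columns_ge:
  assumes "x \<in> polytrope G w" "kleene_columns G w j i \<noteq> \<infinity>"
  shows "x $ i - x $ j \<le> real_of_ereal (kleene_columns G w j i)"
proof -
  obtain p where "p \<in> dpaths G j i" "kleene_columns G w j i = ereal (path_weight w p)"
    using assms(2) by (rule kleene_columns_finiteE)
  then show ?thesis using path_weight_ge_dpaths[OF assms(1)] by simp
qed

text \<open>The first edge and the remaining path each weigh at least the corresponding difference
  of \<open>x\<close>. Equality of the sums forces equality in both.\<close>

lemma tight_path_of_weight:
  assumes x: "x \<in> polytrope G w" and "p \<noteq> []" "successively (\<lambda>u v. (u, v) \<in> G) p"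
    and "path_weight w p = x $ last p - x $ hd p"
  shows "(hd p, last p) \<in> (tight_edges G w x)\<^sup>*"
  using assms(2-)
proof (induction p rule: induct_list012)
  case (3 a b p)
  have "x $ last (b # p) - x $ b \<le> path_weight w (b # p)"
    using path_weight_ge_dpaths[OF x, of "b # p" b "last (b # p)"] "3.prems" by (simp add: dpaths_def)
  moreover have "x $ b - x $ a \<le> w $ (a, b)"
    using x "3.prems" by (simp add: polytrope_iff[OF G])
  moreover have "w $ (a, b) + path_weight w (b # p) = x $ last (b # p) - x $ a"
    using "3.prems" by (simp add: path_weight_def)
  ultimately have "w $ (a, b) = x $ b - x $ a" "path_weight w (b # p) = x $ last (b # p) - x $ b"
    by linarith+
  then have "(a, b) \<in> tight_edges G w x" "(b, last (b # p)) \<in> (tight_edges G w x)\<^sup>*"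
    using "3.prems" "3.IH"(2) by (auto simp: tight_edges_def)
  then show ?case by (simp add: converse_rtrancl_into_rtrancl)
qed auto

lemma tight_path_exists:
  assumes "(j, i) \<in> (tight_edges G w x)\<^sup>*"
  shows "\<exists>p\<in>dpaths G j i. path_weight w p = x $ i - x $ j"
  using assms
proof induction
  case base
  then show ?case using dpaths_singleton by (force simp: path_weight_def)
next
  case (step k i)
  then obtain p where p: "p \<in> dpaths G j k" "path_weight w p = x $ k - x $ j" by blast
  have "(k, i) \<in> G" "x $ i - x $ k = w $ (k, i)" using step by (auto simp: tight_edges_def)
  then show ?case
    using p dpaths_snoc[OF p(1)] path_weight_snoc_dpaths[OF p(1), of w i]
    by (intro bexI[of _ "p @ [i]"]) auto
qed

lemma kleene_columns_refl:
  assumes "x \<in> polytrope G w"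
  shows "kleene_columns G w j j = 0"
proof -
  obtain p where "p \<in> dpaths G j j" "kleene_columns G w j j = ereal (path_weight w p)"
    using kleene_columns_finite[OF dpaths_singleton] by (rule kleene_columns_finiteE)
  moreover have "kleene_columns G w j j \<le> ereal 0"
    using kleene_columns_le[OF dpaths_singleton[of j G], of w] by (simp add: path_weight_def)
  ultimately show ?thesis
    using path_weight_ge_dpaths[OF assms, of p j j] by simp
qed

text \<open>In row \<open>j\<close> every term is at most \<open>x $ j\<close>, and the diagonal
  term attains it. So \<open>i\<close> belongs to the row exactly if the shortest distance from
  \<open>j\<close> to \<open>i\<close> equals \<open>x $ i - x $ j\<close>, that is, if a path of
  tight edges joins them.\<close>

lemma affine_covector_polytrope:
  assumes x: "x \<in> polytrope G w"
  shows "affine_covector (kleene_columns G w) x = (tight_edges G w x)\<^sup>*"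
proof -
  let ?V = "kleene_columns G w"
  have "(j, i) \<in> affine_covector ?V x \<longleftrightarrow> (j, i) \<in> (tight_edges G w x)\<^sup>*" for j i
  proof
    assume "(j, i) \<in> affine_covector ?V x"
    then have fin: "?V j i \<noteq> \<infinity>"
      and le: "?V j l \<noteq> \<infinity> \<Longrightarrow> x $ l - real_of_ereal (?V j l) \<le> x $ i - real_of_ereal (?V j i)" for l
      by (simp_all add: mem_affine_covector)
    obtain p where p: "p \<in> dpaths G j i" "?V j i = ereal (path_weight w p)"
      using fin by (rule kleene_columns_finiteE)
    then have "path_weight w p = x $ i - x $ j"
      using path_weight_ge_dpaths[OF x p(1)] le[of j] by (simp add: kleene_columns_refl[OF x])
    then show "(j, i) \<in> (tight_edges G w x)\<^sup>*"
      using tight_path_of_weight[OF x, of p] p(1) by (auto simp: dpaths_def)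
  next
    assume "(j, i) \<in> (tight_edges G w x)\<^sup>*"
    then obtain p where p: "p \<in> dpaths G j i" "path_weight w p = x $ i - x $ j"
      using tight_path_exists by blast
    have fin: "?V j i \<noteq> \<infinity>" using p(1) by (rule kleene_columns_finite)
    then have "x $ i - x $ j \<le> real_of_ereal (?V j i)" by (rule kleene_columns_ge[OF x])
    moreover have "?V j i \<le> ereal (x $ i - x $ j)" using kleene_columns_le[OF p(1), of w] p(2) by simp
    ultimately have eq: "real_of_ereal (?V j i) = x $ i - x $ j"
      using fin kleene_columns_not_minus_infinity[of j i] by (cases "?V j i") auto
    have "x $ l - real_of_ereal (?V j l) \<le> x $ i - real_of_ereal (?V j i)" if "?V j l \<noteq> \<infinity>" for l
      using kleene_columns_ge[OF x that] eq by simp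
    then show "(j, i) \<in> affine_covector ?V x" using fin by (simp add: mem_affine_covector)
  qed
  then show ?thesis by auto
qed

section \<open>Covectors of arbitrary points\<close>

lemma affine_covector_total:
  shows "\<exists>i. (j, i) \<in> affine_covector (kleene_columns G w) y"
proof -
  let ?V = "kleene_columns G w" and ?f = "\<lambda>l. y $ l - real_of_ereal (kleene_columns G w j l)"
  have "?V j j \<noteq> \<infinity>" by (rule kleene_columns_finite[OF dpaths_singleton])
  then have "?f ` {l. ?V j l \<noteq> \<infinity>} \<noteq> {}" by blast
  then have "Max (?f ` {l. ?V j l \<noteq> \<infinity>}) \<in> ?f ` {l. ?V j l \<noteq> \<infinity>}" by (intro Max_in) auto
  then obtain i where i: "?V j i \<noteq> \<infinity>" "Max (?f ` {l. ?V j l \<noteq> \<infinity>}) = ?f i" by blast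
  then have "?f l \<le> ?f i" if "?V j l \<noteq> \<infinity>" for l
    using that by (subst i(2)[symmetric]) (intro Max_ge; auto)
  then show ?thesis using i(1) by (auto simp: mem_affine_covector)
qed

text \<open>With \<open>m j\<close> the maximum of row \<open>j\<close> at \<open>y\<close>, the
  min-plus combination \<open>q\<close> of the columns with coefficients \<open>m\<close> lies above
  \<open>y\<close> in each coordinate, while its terms in row \<open>j\<close> stay at most
  \<open>m j\<close>. A term of \<open>y\<close> attaining \<open>m j\<close> therefore still
  attains the maximum at \<open>q\<close>.\<close>

lemma affine_covector_projection:
  "\<exists>q\<in>polytrope G w. affine_covector (kleene_columns G w) y \<subseteq> affine_covector (kleene_columns G w) q"
proof -
  let ?V = "kleene_columns G w"
  have "\<forall>j. \<exists>i. (j, i) \<in> affine_covector ?V y" using affine_covector_total by blast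
  from choice[OF this] obtain b where b: "\<And>j. (j, b j) \<in> affine_covector ?V y" by blast
  define m where "m j = y $ b j - real_of_ereal (?V j (b j))" for j
  have m: "y $ i \<le> m j + real_of_ereal (?V j i)" if "?V j i \<noteq> \<infinity>" for i j
    using b[of j] that by (auto simp: mem_affine_covector m_def algebra_simps)
  note not_minus = kleene_columns_not_minus_infinity
  have ge: "ereal (y $ i) \<le> ereal (m j) + ?V j i" for i j
    using m[of j i] not_minus[of j i] by (cases "?V j i") auto
  \<comment> \<open>The infimum is finite, being at least \<open>y $ i\<close> and at most the
    finite term with index \<open>i\<close>, so conversion to a real loses nothing.\<close>
  define q where "q = (\<chi> i. real_of_ereal (INF j. ereal (m j) + ?V j i))"
  have q: "ereal (q $ i) = (INF j. ereal (m j) + ?V j i)" for i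
  proof -
    let ?I = "INF j. ereal (m j) + ?V j i"
    have "ereal (y $ i) \<le> ?I" using ge by (intro INF_greatest)
    moreover have "?I \<le> ereal (m i) + ?V i i" by (intro INF_lower) simp
    moreover have "?V i i \<noteq> \<infinity>" by (rule kleene_columns_finite[OF dpaths_singleton])
    ultimately have "\<bar>?I\<bar> \<noteq> \<infinity>" using not_minus[of i i] by (cases "?V i i"; cases ?I) auto
    then show ?thesis by (simp add: q_def ereal_real')
  qed
  have "q \<in> tropical_span ?V"
    unfolding tropical_span_def using q by (intro CollectI exI[of _ "\<lambda>j. ereal (m j)"]) simp
  then have "q \<in> polytrope G w" by (simp add: tropical_span_kleene_columns[OF G])
  have le: "q $ i - real_of_ereal (?V j i) \<le> m j" if "?V j i \<noteq> \<infinity>" for i j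
  proof -
    have "ereal (q $ i) \<le> ereal (m j) + ?V j i" unfolding q by (intro INF_lower) simp
    then show ?thesis using that not_minus[of j i] by (cases "?V j i") auto
  qed
  have "(j, i) \<in> affine_covector ?V q" if "(j, i) \<in> affine_covector ?V y" for j i
  proof -
    have fin: "?V j i \<noteq> \<infinity>" "?V j (b j) \<noteq> \<infinity>"
      and "m j \<le> y $ i - real_of_ereal (?V j i)"
      using that b[of j] by (auto simp: mem_affine_covector m_def)
    moreover have "ereal (y $ i) \<le> ereal (q $ i)" unfolding q using ge by (intro INF_greatest)
    ultimately have "m j \<le> q $ i - real_of_ereal (?V j i)" by simp
    then show ?thesis using fin(1) le by (force simp: mem_affine_covector)
  qed
  then have "affine_covector ?V y \<subseteq> affine_covector ?V q" by (rule subrelI)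
  then show ?thesis using \<open>q \<in> polytrope G w\<close> by blast
qed

text \<open>Terms in one row of the covector of \<open>q\<close> tie at \<open>q\<close>, so at
  \<open>y\<close> they are ordered by \<open>y - q\<close>. By the inclusion, and since no row of
  the covector of \<open>y\<close> is empty, the maximum at \<open>y\<close> is attained among
  them.\<close>

lemma leading_affine_covector:
  assumes "affine_covector (kleene_columns G w) y \<subseteq> affine_covector (kleene_columns G w) q"
  shows "affine_covector (kleene_columns G w) y = leading (affine_covector (kleene_columns G w) q) (y - q)"
proof -
  let ?V = "kleene_columns G w"
  have "(j, i) \<in> affine_covector ?V y \<longleftrightarrow> (j, i) \<in> leading (affine_covector ?V q) (y - q)" for j i
  proof
    assume y: "(j, i) \<in> affine_covector ?V y"
    then have q: "(j, i) \<in> affine_covector ?V q" using assms by blast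
    have "(y - q) $ l \<le> (y - q) $ i" if "(j, l) \<in> affine_covector ?V q" for l
    proof -
      have "y $ l - real_of_ereal (?V j l) \<le> y $ i - real_of_ereal (?V j i)"
        and "q $ i - real_of_ereal (?V j i) \<le> q $ l - real_of_ereal (?V j l)"
        using y q that by (auto simp: mem_affine_covector)
      then show ?thesis by simp
    qed
    then show "(j, i) \<in> leading (affine_covector ?V q) (y - q)" using q by (simp add: leading_def)
  next
    assume l: "(j, i) \<in> leading (affine_covector ?V q) (y - q)"
    obtain k where k: "(j, k) \<in> affine_covector ?V y" using affine_covector_total by blast
    then have kq: "(j, k) \<in> affine_covector ?V q" using assms by blast
    have iq: "(j, i) \<in> affine_covector ?V q" and "(y - q) $ k \<le> (y - q) $ i"
      using l kq by (auto simp: leading_def)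
    moreover have "q $ k - real_of_ereal (?V j k) \<le> q $ i - real_of_ereal (?V j i)"
      using iq kq by (auto simp: mem_affine_covector)
    ultimately have "y $ k - real_of_ereal (?V j k) \<le> y $ i - real_of_ereal (?V j i)" by simp
    then show "(j, i) \<in> affine_covector ?V y"
      using k iq by (force simp: mem_affine_covector)
  qed
  then show ?thesis by auto
qed

text \<open>The covector is realized at \<open>q + \<epsilon> *\<^sub>R d\<close>. Small \<epsilon>
  preserves the strict gaps between maximal and other finite terms, and among the tied terms only
  \<open>d\<close> decides.\<close>

lemma leading_in_affine_covectors:
  assumes q: "q \<in> polytrope G w"
  shows "leading (affine_covector (kleene_columns G w) q) d \<in> affine_covectors (kleene_columns G w)"
proof -
  let ?V = "kleene_columns G w"
  let ?f = "\<lambda>j l. q $ l - real_of_ereal (?V j l)"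
  let ?Z = "{(j, k, l). (j, k) \<in> affine_covector ?V q \<and> (j, l) \<notin> affine_covector ?V q \<and> ?V j l \<noteq> \<infinity>}"
  have gap: "?f j l < ?f j k" 
    if k: "(j, k) \<in> affine_covector ?V q" and l: "(j, l) \<notin> affine_covector ?V q" "?V j l \<noteq> \<infinity>" for j k l
  proof -
    obtain l' where "?V j l' \<noteq> \<infinity>" "?f j l < ?f j l'"
      using l unfolding mem_affine_covector by (meson not_le)
    moreover from this have "?f j l' \<le> ?f j k" using k by (simp add: mem_affine_covector)
    ultimately show ?thesis by simp
  qed
  have "0 < (\<lambda>(j, k, l). ?f j k - ?f j l) z" if "z \<in> ?Z" for z
    using that gap by (cases z) simp
  then obtain \<epsilon> where "\<epsilon> > 0"
    and \<epsilon>: "\<forall>z\<in>?Z. \<epsilon> * (\<lambda>(j, k, l). d $ l - d $ k) z < (\<lambda>(j, k, l). ?f j k - ?f j l) z"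
    by (rule small_multiple_less[OF finite])
  let ?y = "q + \<epsilon> *\<^sub>R d"
  have less: "?y $ l - real_of_ereal (?V j l) < ?y $ k - real_of_ereal (?V j k)"
    if "(j, k) \<in> affine_covector ?V q" "(j, l) \<notin> affine_covector ?V q" "?V j l \<noteq> \<infinity>" for j k l
    using bspec[OF \<epsilon>, of "(j, k, l)"] that by (simp add: algebra_simps)
  have cmp: "?y $ l - real_of_ereal (?V j l) \<le> ?y $ k - real_of_ereal (?V j k) \<longleftrightarrow> d $ l \<le> d $ k"
    if "(j, k) \<in> affine_covector ?V q" "(j, l) \<in> affine_covector ?V q" for j k l
  proof -
    have "?f j k = ?f j l" using that by (auto simp: mem_affine_covector intro: antisym)
    then have "?y $ l - real_of_ereal (?V j l) \<le> ?y $ k - real_of_ereal (?V j k) \<longleftrightarrow> \<epsilon> * d $ l \<le> \<epsilon> * d $ k"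
      by (simp add: algebra_simps) linarith
    then show ?thesis using \<open>\<epsilon> > 0\<close> by simp
  qed
  have "(j, i) \<in> affine_covector ?V ?y \<longleftrightarrow> (j, i) \<in> leading (affine_covector ?V q) d" for j i
  proof
    assume y: "(j, i) \<in> affine_covector ?V ?y"
    obtain k where k: "(j, k) \<in> affine_covector ?V q" using affine_covector_total by blast
    have iq: "(j, i) \<in> affine_covector ?V q"
    proof (rule ccontr)
      assume "(j, i) \<notin> affine_covector ?V q"
      moreover have "?V j i \<noteq> \<infinity>" "?V j k \<noteq> \<infinity>" using y k by (auto simp: mem_affine_covector)
      ultimately show False
        using less[OF k, of i] y by (force simp: mem_affine_covector)
    qed
    have "d $ l \<le> d $ i" if l: "(j, l) \<in> affine_covector ?V q" for l
      using y l cmp[OF iq l] by (simp add: mem_affine_covector)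
    then show "(j, i) \<in> leading (affine_covector ?V q) d" using iq by (simp add: leading_def)
  next
    assume "(j, i) \<in> leading (affine_covector ?V q) d"
    then have iq: "(j, i) \<in> affine_covector ?V q"
      and lead: "\<And>l. (j, l) \<in> affine_covector ?V q \<Longrightarrow> d $ l \<le> d $ i" by (auto simp: leading_def)
    have "?y $ l - real_of_ereal (?V j l) \<le> ?y $ i - real_of_ereal (?V j i)" if "?V j l \<noteq> \<infinity>" for l
    proof (cases "(j, l) \<in> affine_covector ?V q")
      case True
      then show ?thesis using cmp[OF iq True] lead by blast
    next
      case False
      then show ?thesis using less[OF iq False that] by simp
    qed
    moreover have "?V j i \<noteq> \<infinity>" using iq by (simp add: mem_affine_covector)
    ultimately show "(j, i) \<in> affine_covector ?V ?y" unfolding mem_affine_covector by blast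
  qed
  then have "leading (affine_covector ?V q) d = affine_covector ?V ?y" by auto
  then show ?thesis by (simp add: affine_covectors_def)
qed

lemma affine_covectors_eq:
  "affine_covectors (kleene_columns G w) = {leading (T\<^sup>*) d | T d. T \<in> tight_sets G w}"
proof (intro equalityI subsetI)
  fix C assume "C \<in> affine_covectors (kleene_columns G w)"
  then obtain y where y: "C = affine_covector (kleene_columns G w) y" by (auto simp: affine_covectors_def)
  obtain q where q: "q \<in> polytrope G w"
    "affine_covector (kleene_columns G w) y \<subseteq> affine_covector (kleene_columns G w) q"
    using affine_covector_projection by blast
  have "C = leading ((tight_edges G w q)\<^sup>*) (y - q)"
    using leading_affine_covector[OF q(2)] y affine_covector_polytrope[OF q(1)] by simp
  moreover have "tight_edges G w q \<in> tight_sets G w" using q by (simp add: tight_sets_def)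
  ultimately show "C \<in> {leading (T\<^sup>*) d | T d. T \<in> tight_sets G w}" by blast
next
  fix C assume "C \<in> {leading (T\<^sup>*) d | T d. T \<in> tight_sets G w}"
  then obtain q d where "q \<in> polytrope G w" "C = leading ((tight_edges G w q)\<^sup>*) d"
    by (auto simp: tight_sets_def)
  then show "C \<in> affine_covectors (kleene_columns G w)"
    using leading_in_affine_covectors affine_covector_polytrope by simp
qed

text \<open>If the diagonal entry attains the maximum in each row, then \<open>y $ i - y $ j\<close>
  is at most the shortest distance from \<open>j\<close> to \<open>i\<close>, hence at most the
  weight of an edge from \<open>j\<close> to \<open>i\<close>. So such a \<open>y\<close> lies in
  the polytrope itself.\<close>

lemma affine_covectors_reflexive:
  assumes "polytrope G w \<noteq> {}"
  shows "{C \<in> affine_covectors (kleene_columns G w). Id \<subseteq> C} = rtrancl ` tight_sets G w"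
proof (intro equalityI subsetI)
  fix C assume "C \<in> {C \<in> affine_covectors (kleene_columns G w). Id \<subseteq> C}"
  then obtain y where y: "C = affine_covector (kleene_columns G w) y" "Id \<subseteq> C"
    by (auto simp: affine_covectors_def)
  obtain x where "x \<in> polytrope G w" using assms by blast
  then have zero: "kleene_columns G w j j = 0" for j by (rule kleene_columns_refl)
  have "y $ i - y $ j \<le> w $ (j, i)" if e: "(j, i) \<in> G" for j i
  proof -
    have le: "kleene_columns G w j i \<le> ereal (w $ (j, i))"
      using kleene_columns_le[OF dpaths_edge[OF e], of w] by (simp add: path_weight_edge)
    have fin: "kleene_columns G w j i \<noteq> \<infinity>" by (rule kleene_columns_finite[OF dpaths_edge[OF e]])
    then obtain p where "kleene_columns G w j i = ereal (path_weight w p)"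
      by (rule kleene_columns_finiteE)
    moreover have "(j, j) \<in> C" using y(2) by blast
    then have "y $ i - real_of_ereal (kleene_columns G w j i) \<le> y $ j"
      using fin zero by (simp add: y(1) mem_affine_covector)
    ultimately show ?thesis using le by simp
  qed
  then have "y \<in> polytrope G w" by (simp add: polytrope_iff[OF G])
  then show "C \<in> rtrancl ` tight_sets G w"
    using affine_covector_polytrope y(1) by (auto simp: tight_sets_def)
next
  fix C assume "C \<in> rtrancl ` tight_sets G w"
  then obtain x where "x \<in> polytrope G w" "C = (tight_edges G w x)\<^sup>*" by (auto simp: tight_sets_def)
  then show "C \<in> {C \<in> affine_covectors (kleene_columns G w). Id \<subseteq> C}"
    using affine_covector_polytrope by (auto simp: affine_covectors_def)
qed

text \<open>A unique shortest edge is tight at the projection of a point far out in direction \<open>i\<close>.\<close>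

lemma tight_sets_cover:
  assumes w: "w \<in> polytrope_region G"
  shows "\<Union> (tight_sets G w) = G"
proof
  show "\<Union> (tight_sets G w) \<subseteq> G" by (auto simp: tight_sets_def tight_edges_def)
  show "G \<subseteq> \<Union> (tight_sets G w)"
  proof clarify
    fix j i assume e: "(j, i) \<in> G"
    let ?V = "kleene_columns G w"
    \<comment> \<open>\<open>M\<close> dominates every difference of entries in row
      \<open>j\<close>, so at the point with \<open>M\<close> in coordinate \<open>i\<close> and 0
      elsewhere the term of \<open>i\<close> is maximal.\<close>
    define M where "M = (\<Sum>l\<in>UNIV. \<bar>real_of_ereal (?V j i) - real_of_ereal (?V j l)\<bar>)"
    have "\<bar>real_of_ereal (?V j i) - real_of_ereal (?V j l)\<bar> \<le> M" for l
      unfolding M_def by (rule member_le_sum) auto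
    then have M: "real_of_ereal (?V j i) - real_of_ereal (?V j l) \<le> M" for l
      using abs_ge_self order_trans by blast
    have "?V j i \<noteq> \<infinity>" by (rule kleene_columns_finite[OF dpaths_edge[OF e]])
    moreover have "axis i M $ l - real_of_ereal (?V j l) \<le> axis i M $ i - real_of_ereal (?V j i)" for l
      using M[of l] by (auto simp: axis_def)
    ultimately have "(j, i) \<in> affine_covector ?V (axis i M)" by (simp add: mem_affine_covector)
    then obtain q where q: "q \<in> polytrope G w" "(j, i) \<in> (tight_edges G w q)\<^sup>*"
      using affine_covector_projection[of "axis i M"] affine_covector_polytrope by blast
    then obtain p where p: "p \<in> dpaths G j i" "path_weight w p = q $ i - q $ j"
      using tight_path_exists by blast
    \<comment> \<open>The tight path weighs no more than the edge, which is the unique shortest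
      path, so the path is the edge.\<close>
    have "q $ i - q $ j \<le> w $ (j, i)" using q(1) e by (simp add: polytrope_iff[OF G])
    then have "p = [j, i]" using w p e by (force simp: polytrope_region_iff)
    then have "(j, i) \<in> tight_edges G w q" using p(2) e by (simp add: tight_edges_def path_weight_edge)
    then show "(j, i) \<in> \<Union> (tight_sets G w)" using q(1) by (auto simp: tight_sets_def)
  qed
qed

end

section \<open>Tropical equivalence of polytropes\<close>

text \<open>Contact at the origin, where the height is 0, forces the constant \<open>c\<close> to be
  0. The remaining conditions on the slope \<open>u\<close> are the inequalities of the polytrope,
  with equality exactly at tight edges.\<close>

lemma origin_cells_eq:
  fixes G :: "('n::{finite,linorder} \<times> 'n) set"
  assumes G: "G \<in> labeled_dags"
  shows "origin_cells G w = (\<lambda>T. insert 0 (edge_vector ` T)) ` tight_sets G w"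
proof -
  let ?A = "fundamental_polytope G"
  have inner: "u \<bullet> edge_vector (j, i) = u $ i - u $ j" for u :: "(real, 'n) vec" and j i
    by (simp add: edge_vector_def inner_diff_right inner_axis)
  have below: "(\<forall>a\<in>?A. u \<bullet> a + 0 \<le> heights G 0 w a) \<longleftrightarrow> u \<in> polytrope G w" for u
    by (auto simp: fundamental_polytope_def heights_zero heights_edge_vector[OF G] inner polytrope_iff[OF G])
  have contact: "{a\<in>?A. u \<bullet> a + 0 = heights G 0 w a} = insert 0 (edge_vector ` tight_edges G w u)" for u
    by (auto simp: fundamental_polytope_def heights_zero heights_edge_vector[OF G] inner tight_edges_def)
  have "B \<in> origin_cells G w \<longleftrightarrow> (\<exists>u\<in>polytrope G w. B = insert 0 (edge_vector ` tight_edges G w u))" for B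
  proof
    assume "B \<in> origin_cells G w"
    then have B: "B \<in> regular_subdivision ?A (heights G 0 w)" "0 \<in> B"
      by (simp_all add: origin_cells_def)
    obtain u c where u: "\<And>a. a \<in> ?A \<Longrightarrow> u \<bullet> a + c \<le> heights G 0 w a"
      "B = {a\<in>?A. u \<bullet> a + c = heights G 0 w a}"
      using regular_subdivisionE[OF B(1)] by blast
    have "u \<bullet> 0 + c = heights G 0 w 0" using B(2) unfolding u(2) by blast
    then have "c = 0" by (simp add: heights_zero)
    have "u \<in> polytrope G w" using u(1) \<open>c = 0\<close> below by blast
    moreover have "B = insert 0 (edge_vector ` tight_edges G w u)"
      using u(2) unfolding \<open>c = 0\<close> contact .
    ultimately show "\<exists>u\<in>polytrope G w. B = insert 0 (edge_vector ` tight_edges G w u)" by blast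
  next
    assume "\<exists>u\<in>polytrope G w. B = insert 0 (edge_vector ` tight_edges G w u)"
    then obtain u where u: "u \<in> polytrope G w" "B = insert 0 (edge_vector ` tight_edges G w u)" by blast
    have "B \<in> regular_subdivision ?A (heights G 0 w)"
      unfolding regular_subdivision_def
    proof (intro CollectI conjI exI)
      show "B \<noteq> {}" using u(2) by simp
      show "\<forall>a\<in>?A. u \<bullet> a + 0 \<le> heights G 0 w a" using below u(1) by blast
      show "B = {a\<in>?A. u \<bullet> a + 0 = heights G 0 w a}" unfolding contact by (rule u(2))
    qed
    then show "B \<in> origin_cells G w" using u(2) by (simp add: origin_cells_def)
  qed
  then show ?thesis by (auto simp: tight_sets_def)
qed

lemma origin_cells_eq_iff:
  assumes G: "G \<in> labeled_dags"
  shows "origin_cells G w = origin_cells G v \<longleftrightarrow> tight_sets G w = tight_sets G v"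
proof -
  have sub: "tight_sets G u \<subseteq> Pow G" for u by (auto simp: tight_sets_def tight_edges_def)
  have "inj_on (\<lambda>T. insert 0 (edge_vector ` T)) (Pow G)"
  proof (rule inj_onI)
    fix S T assume ST: "S \<in> Pow G" "T \<in> Pow G" "insert 0 (edge_vector ` S) = insert 0 (edge_vector ` T)"
    have "0 \<notin> edge_vector ` S" "0 \<notin> edge_vector ` T"
      using zero_notin_edge_vectors[OF G] ST by blast+
    then have "edge_vector ` S = edge_vector ` T" using ST(3) by (metis insert_ident)
    then show "S = T" using inj_on_image_eq_iff[OF inj_on_edge_vector[OF G]] ST by simp
  qed
  from inj_on_image_eq_iff[OF this sub sub] show ?thesis by (simp add: origin_cells_eq[OF G])
qed

section \<open>Interior points and full dimension\<close>

lemma polytrope_interior: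
  fixes G :: "('n::{finite,linorder} \<times> 'n) set" and w :: "real ^ ('n \<times> 'n)"
  assumes G: "G \<in> labeled_dags"
  shows "\<exists>x. \<forall>j i. (j, i) \<in> G \<longrightarrow> x $ i - x $ j < w $ (j, i)"
proof (intro exI allI impI)
  \<comment> \<open>The witness drops by \<open>M\<close> with each label. An edge goes to a larger
    label, so its difference is at most \<open>- M\<close>, below every weight; no sign condition on
    the weights is involved.\<close>
  define M where "M = 1 + (\<Sum>e\<in>UNIV. \<bar>w $ e\<bar>)"
  fix j i assume e: "(j, i) \<in> G"
  have "\<bar>w $ (j, i)\<bar> \<le> (\<Sum>e\<in>UNIV. \<bar>w $ e\<bar>)" by (rule member_le_sum) auto
  then have M: "- M < w $ (j, i)" "M > 0" by (auto simp: M_def)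
  have "{..<j} \<subset> {..<i}" using labeled_dag_less[OF G e] by auto
  then have "card {..<j} < card {..<i}" by (intro psubset_card_mono) auto
  then have "M * 1 \<le> M * (real (card {..<i}) - real (card {..<j}))"
    using M(2) by (intro mult_left_mono) auto
  then show "(\<chi> k. - M * real (card {..<k})) $ i - (\<chi> k. - M * real (card {..<k})) $ j < w $ (j, i)"
    using M(1) by (simp add: algebra_simps)
qed

lemma polytrope_dim:
  fixes G :: "('n::{finite,linorder} \<times> 'n) set"
  assumes G: "G \<in> labeled_dags"
  shows "polytrope_dim G w = int CARD('n) - 1"
proof -
  let ?U = "\<Inter>e\<in>G. {x :: (real, 'n) vec. x $ snd e - x $ fst e < w $ e}"
  have "open {x :: (real, 'n) vec. x $ snd e - x $ fst e < w $ e}" for e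
    by (intro open_Collect_less continuous_intros)
  then have "open ?U" by (intro open_INT) auto
  moreover obtain x where "\<forall>j i. (j, i) \<in> G \<longrightarrow> x $ i - x $ j < w $ (j, i)"
    using polytrope_interior[OF G] by blast
  then have "x \<in> ?U" by auto
  then have "?U \<noteq> {}" by blast
  ultimately have "aff_dim ?U = int CARD('n)" by (simp add: aff_dim_open)
  moreover have "?U \<subseteq> polytrope G w" by (force simp: polytrope_iff[OF G])
  ultimately have "aff_dim (polytrope G w) = int CARD('n)"
    using aff_dim_subset[of ?U "polytrope G w"] aff_dim_le_DIM[of "polytrope G w"] by simp
  then show ?thesis by (simp add: polytrope_dim_def)
qed

lemma polytrope_nonempty:
  assumes "G \<in> labeled_dags"
  shows "polytrope G w \<noteq> {}"
proof -
  obtain x where "\<forall>j i. (j, i) \<in> G \<longrightarrow> x $ i - x $ j < w $ (j, i)"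
    using polytrope_interior[OF assms] by blast
  then have "x \<in> polytrope G w" by (simp add: polytrope_iff[OF assms] less_imp_le)
  then show ?thesis by blast
qed

lemma empty_in_tight_sets:
  assumes "G \<in> labeled_dags"
  shows "{} \<in> tight_sets G w"
proof -
  obtain x where x: "\<And>j i. (j, i) \<in> G \<Longrightarrow> x $ i - x $ j < w $ (j, i)"
    using polytrope_interior[OF assms, of w] by blast
  then have "x \<in> polytrope G w" by (auto simp: polytrope_iff[OF assms] intro: less_imp_le)
  moreover have "tight_edges G w x = {}" using x by (force simp: tight_edges_def)
  ultimately show ?thesis unfolding tight_sets_def by (metis imageI)
qed

subsection \<open>Relabeling\<close>

lemma map_prod_mem_iff:
  assumes "bij \<pi>"
  shows "(\<pi> j, \<pi> i) \<in> map_prod \<pi> \<pi> ` C \<longleftrightarrow> (j, i) \<in> C"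
  using inj_image_mem_iff[OF prod.inj_map[OF bij_is_inj bij_is_inj], OF assms assms, of "(j, i)" C]
  by simp

lemma map_prod_image_iff:
  assumes "bij \<pi>"
  shows "(j, i) \<in> map_prod \<pi> \<pi> ` C \<longleftrightarrow> (inv \<pi> j, inv \<pi> i) \<in> C"
  using map_prod_mem_iff[OF assms, of "inv \<pi> j" "inv \<pi> i" C]
  by (simp add: surj_f_inv_f[OF bij_is_surj[OF assms]])

lemma permute_weights_nth: "permute_weights \<pi> w $ (j, i) = w $ (inv \<pi> j, inv \<pi> i)"
  by (simp add: permute_weights_def)

lemma tight_sets_permute:
  fixes G :: "('n::{finite,linorder} \<times> 'n) set"
  assumes \<pi>: "bij \<pi>" and G: "G \<in> labeled_dags" and H: "H \<in> labeled_dags" and GH: "map_prod \<pi> \<pi> ` G = H"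
  shows "tight_sets H (permute_weights \<pi> w) = (`) (map_prod \<pi> \<pi>) ` tight_sets G w"
proof -
  let ?f = "\<lambda>x :: (real, 'n) vec. \<chi> k. x $ inv \<pi> k"
  have inv: "inv \<pi> (\<pi> k) = k" for k by (simp add: inv_f_f[OF bij_is_inj[OF \<pi>]])
  have mem: "(j, i) \<in> H \<longleftrightarrow> (inv \<pi> j, inv \<pi> i) \<in> G" for j i
    using map_prod_image_iff[OF \<pi>, of j i G] GH by simp
  have poly: "?f x \<in> polytrope H (permute_weights \<pi> w) \<longleftrightarrow> x \<in> polytrope G w" for x
  proof
    assume l: "?f x \<in> polytrope H (permute_weights \<pi> w)"
    show "x \<in> polytrope G w"
      unfolding polytrope_iff[OF G]
    proof (intro allI impI)
      fix j i assume "(j, i) \<in> G"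
      then have "(\<pi> j, \<pi> i) \<in> H" by (simp add: mem inv)
      with l show "x $ i - x $ j \<le> w $ (j, i)"
        unfolding polytrope_iff[OF H] by (fastforce simp: permute_weights_nth inv)
    qed
  qed (simp add: polytrope_iff[OF G] polytrope_iff[OF H] mem permute_weights_nth)
  have "(j, i) \<in> tight_edges H (permute_weights \<pi> w) (?f x) \<longleftrightarrow> (j, i) \<in> map_prod \<pi> \<pi> ` tight_edges G w x" for x j i
    by (simp add: map_prod_image_iff[OF \<pi>] tight_edges_def mem permute_weights_nth)
  then have tight: "tight_edges H (permute_weights \<pi> w) (?f x) = map_prod \<pi> \<pi> ` tight_edges G w x" for x
    by auto
  have surj: "y = ?f (\<chi> k. y $ \<pi> k)" for y
    by (simp add: vec_eq_iff surj_f_inv_f[OF bij_is_surj[OF \<pi>]])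
  have "polytrope H (permute_weights \<pi> w) = ?f ` polytrope G w"
  proof (intro equalityI subsetI)
    fix y assume "y \<in> polytrope H (permute_weights \<pi> w)"
    then have "(\<chi> k. y $ \<pi> k) \<in> polytrope G w"
      by (subst (asm) surj) (simp only: poly)
    then show "y \<in> ?f ` polytrope G w" using surj[of y] by (intro image_eqI[of y ?f "\<chi> k. y $ \<pi> k"])
  next
    fix y assume "y \<in> ?f ` polytrope G w"
    then show "y \<in> polytrope H (permute_weights \<pi> w)" using poly by blast
  qed
  then show ?thesis by (simp add: tight_sets_def image_image tight)
qed

lemma rtrancl_map_prod:
  assumes \<pi>: "bij \<pi>"
  shows "(map_prod \<pi> \<pi> ` T)\<^sup>* = map_prod \<pi> \<pi> ` T\<^sup>*"
proof -
  have 1: "(\<pi> j, \<pi> i) \<in> (map_prod \<pi> \<pi> ` T)\<^sup>*" if "(j, i) \<in> T\<^sup>*" for j i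
    using that
  proof induction
    case (step k i)
    then have "(\<pi> k, \<pi> i) \<in> map_prod \<pi> \<pi> ` T" using map_prod_mem_iff[OF \<pi>] by blast
    then show ?case using step by (meson rtrancl_into_rtrancl)
  qed simp
  have 2: "(inv \<pi> j, inv \<pi> i) \<in> T\<^sup>*" if "(j, i) \<in> (map_prod \<pi> \<pi> ` T)\<^sup>*" for j i
    using that
  proof induction
    case (step k i)
    then have "(inv \<pi> k, inv \<pi> i) \<in> T" using map_prod_image_iff[OF \<pi>] by blast
    then show ?case using step by (meson rtrancl_into_rtrancl)
  qed simp
  show ?thesis
  proof (intro equalityI subsetI)
    fix z assume z: "z \<in> (map_prod \<pi> \<pi> ` T)\<^sup>*"
    obtain j i where "z = (j, i)" by fastforce
    then show "z \<in> map_prod \<pi> \<pi> ` T\<^sup>*" using z 2 map_prod_image_iff[OF \<pi>] by blast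
  next
    fix z assume "z \<in> map_prod \<pi> \<pi> ` T\<^sup>*"
    then show "z \<in> (map_prod \<pi> \<pi> ` T)\<^sup>*" using 1 by force
  qed
qed

lemma leading_map_prod:
  fixes d :: "real ^ 'n::finite"
  assumes \<pi>: "bij \<pi>"
  shows "map_prod \<pi> \<pi> ` leading C d = leading (map_prod \<pi> \<pi> ` C) (\<chi> k. d $ inv \<pi> k)"
proof -
  have "(j, i) \<in> map_prod \<pi> \<pi> ` leading C d \<longleftrightarrow>
      (j, i) \<in> leading (map_prod \<pi> \<pi> ` C) (\<chi> k. d $ inv \<pi> k)" for j i
  proof -
    have "(\<forall>l. (inv \<pi> j, l) \<in> C \<longrightarrow> d $ l \<le> d $ inv \<pi> i) \<longleftrightarrow>
        (\<forall>l. (inv \<pi> j, inv \<pi> l) \<in> C \<longrightarrow> d $ inv \<pi> l \<le> d $ inv \<pi> i)"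
      by (metis \<pi> bij_is_inj inv_f_f)
    then show ?thesis by (simp add: map_prod_image_iff[OF \<pi>] leading_def)
  qed
  then show ?thesis by auto
qed

text \<open>Closure and leading terms commute with relabeling, so the description of all covectors
  by tight sets carries over with \<open>\<pi>\<close> acting on points and coordinates
  alike.\<close>

lemma equivalent_polytropesI:
  fixes G :: "('n::{finite,linorder} \<times> 'n) set"
  assumes \<pi>: "bij \<pi>" and G: "G \<in> labeled_dags" and H: "H \<in> labeled_dags"
    and T: "tight_sets H v = (`) (map_prod \<pi> \<pi>) ` tight_sets G w"
  shows "equivalent_polytropes G w H v"
proof -
  let ?m = "map_prod \<pi> \<pi>"
  have "(\<lambda>B. ?m ` B) ` affine_covectors (kleene_columns G w) = affine_covectors (kleene_columns H v)"
    unfolding affine_covectors_eq[OF G] affine_covectors_eq[OF H] T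
  proof (intro equalityI subsetI)
    fix B assume "B \<in> (\<lambda>B. ?m ` B) ` {leading (T\<^sup>*) d | T d. T \<in> tight_sets G w}"
    then obtain T d where "T \<in> tight_sets G w" "B = ?m ` leading (T\<^sup>*) d" by blast
    then show "B \<in> {leading (T\<^sup>*) d | T d. T \<in> (`) ?m ` tight_sets G w}"
      by (auto simp: leading_map_prod[OF \<pi>] simp flip: rtrancl_map_prod[OF \<pi>])
  next
    fix B assume "B \<in> {leading (T\<^sup>*) d | T d. T \<in> (`) ?m ` tight_sets G w}"
    then obtain T d where T: "T \<in> tight_sets G w" "B = leading ((?m ` T)\<^sup>*) d" by blast
    have "d = (\<chi> k. (\<chi> k. d $ \<pi> k) $ inv \<pi> k)"
      by (simp add: vec_eq_iff surj_f_inv_f[OF bij_is_surj[OF \<pi>]])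
    then have "B = ?m ` leading (T\<^sup>*) (\<chi> k. d $ \<pi> k)"
      using T(2) by (simp add: leading_map_prod[OF \<pi>] rtrancl_map_prod[OF \<pi>])
    then show "B \<in> (\<lambda>B. ?m ` B) ` {leading (T\<^sup>*) d | T d. T \<in> tight_sets G w}"
      using T(1) by blast
  qed
  then show ?thesis
    unfolding equivalent_polytropes_def tropically_equivalent_def using \<pi> by blast
qed

subsection \<open>Recovering the tight sets from the covectors\<close>

text \<open>The largest point that is not fixed would be sent to a larger, hence fixed, point,
  against injectivity.\<close>

lemma bij_increasing_id:
  fixes f :: "'a::{finite,linorder} \<Rightarrow> 'a"
  assumes "bij f" and le: "\<And>x. x \<le> f x"
  shows "f x = x"
proof (rule ccontr)
  assume "f x \<noteq> x"
  define m where "m = Max {y. f y \<noteq> y}"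
  have "m \<in> {y. f y \<noteq> y}" unfolding m_def using \<open>f x \<noteq> x\<close> by (intro Max_in) auto
  then have "m < f m" using le[of m] by simp
  then have "f m \<notin> {y. f y \<noteq> y}" unfolding m_def by (metis Max_ge finite leD)
  then have "f (f m) = f m" by simp
  then have "f m = m" by (rule injD[OF bij_is_inj[OF \<open>bij f\<close>]])
  then show False using \<open>m < f m\<close> by simp
qed

definition covers :: "('n \<times> 'n) set \<Rightarrow> ('n \<times> 'n) set" where
  "covers C = {(j, i) \<in> C. j \<noteq> i \<and> (\<forall>k. (j, k) \<in> C \<longrightarrow> (k, i) \<in> C \<longrightarrow> k = j \<or> k = i)}"

lemma covers_map_prod:
  assumes \<pi>: "bij \<pi>"
  shows "covers (map_prod \<pi> \<pi> ` C) = map_prod \<pi> \<pi> ` covers C"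
proof -
  have inj: "inv \<pi> a = inv \<pi> b \<longleftrightarrow> a = b" for a b
    by (metis \<pi> bij_is_surj surj_f_inv_f)
  have "(\<forall>k. P (inv \<pi> k)) \<longleftrightarrow> (\<forall>k. P k)" for P
    by (metis \<pi> bij_is_inj inv_f_f)
  note this[of "\<lambda>k. (inv \<pi> j, k) \<in> C \<longrightarrow> (k, inv \<pi> i) \<in> C \<longrightarrow> k = inv \<pi> j \<or> k = inv \<pi> i" for j i]
  then have "(j, i) \<in> covers (map_prod \<pi> \<pi> ` C) \<longleftrightarrow> (j, i) \<in> map_prod \<pi> \<pi> ` covers C" for j i
    by (simp add: map_prod_image_iff[OF \<pi>] covers_def inj)
  then show ?thesis by auto
qed

lemma labeled_dag_rtrancl_le:
  assumes G: "G \<in> labeled_dags" and "(j, i) \<in> G\<^sup>*"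
  shows "j \<le> i"
  using assms(2)
proof induction
  case (step k i)
  then show ?case using labeled_dag_less[OF G step.hyps(2)] by simp
qed simp

text \<open>A covering pair is joined by a tight path, whose first step must already reach the end.
  Conversely, an intermediate node for a tight edge would give a longer tight path; its weight
  telescopes to that of the edge, against unique shortness.\<close>

lemma covers_tight_set:
  assumes G: "G \<in> labeled_dags" and w: "w \<in> polytrope_region G" and T: "T \<in> tight_sets G w"
  shows "covers (T\<^sup>*) = T"
proof -
  obtain x where x: "x \<in> polytrope G w" "T = tight_edges G w x" using T by (auto simp: tight_sets_def)
  have TG: "T \<subseteq> G" using x(2) tight_edges_subset by blast
  then have star: "T\<^sup>* \<subseteq> G\<^sup>*" by (rule rtrancl_mono)
  have "(j, i) \<in> T" if c: "(j, i) \<in> covers (T\<^sup>*)" for j i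
  proof -
    have "(j, i) \<in> T\<^sup>*" "j \<noteq> i" using c by (auto simp: covers_def)
    then obtain k where k: "(j, k) \<in> T" "(k, i) \<in> T\<^sup>*" by (meson converse_rtranclE)
    moreover have "k \<noteq> j" using labeled_dag_less[OF G] TG k(1) by blast
    ultimately have "k = i" using c by (auto simp: covers_def)
    then show ?thesis using k(1) by simp
  qed
  moreover have "(j, i) \<in> covers (T\<^sup>*)" if e: "(j, i) \<in> T" for j i
  proof -
    have "j \<noteq> i" using labeled_dag_less[OF G] TG e by blast
    moreover have "k = j" if k: "(j, k) \<in> T\<^sup>*" "(k, i) \<in> T\<^sup>*" "k \<noteq> i" for k
    proof (rule ccontr)
      assume "k \<noteq> j"
      obtain m where m: "(k, m) \<in> T\<^sup>*" "(m, i) \<in> T" using k(2,3) by (meson rtranclE)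
      then have "(j, m) \<in> T\<^sup>*" using k(1) by simp
      then obtain p where p: "p \<in> dpaths G j m" "path_weight w p = x $ m - x $ j"
        using tight_path_exists[OF G] x(2) by blast
      have mi: "(m, i) \<in> G" "x $ i - x $ m = w $ (m, i)" and ji: "(j, i) \<in> G" "x $ i - x $ j = w $ (j, i)"
        using m(2) e x(2) by (auto simp: tight_edges_def)
      have "p @ [i] \<in> dpaths G j i" "path_weight w (p @ [i]) = w $ (j, i)"
        using dpaths_snoc[OF p(1) mi(1)] path_weight_snoc_dpaths[OF p(1), of w i] p(2) mi(2) ji(2) by auto
      \<comment> \<open>A path other than the edge would be strictly heavier. Hence
        \<open>m = j\<close>, and \<open>k\<close>, lying between \<open>j\<close> and
        \<open>m\<close> in label order, is \<open>j\<close> too.\<close>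
      then have "p @ [i] = [j, i]" using w ji(1) by (force simp: polytrope_region_iff)
      then have "m = j" using p(1) by (simp add: dpaths_def)
      then have "j \<le> k" "k \<le> j" using labeled_dag_rtrancl_le[OF G] star k(1) m(1) by blast+
      then show False using \<open>k \<noteq> j\<close> by simp
    qed
    ultimately show ?thesis using e by (auto simp: covers_def)
  qed
  ultimately show ?thesis by auto
qed

lemma equivalent_polytropesD:
  fixes G :: "('n::{finite,linorder} \<times> 'n) set"
  assumes G: "G \<in> labeled_dags" and H: "H \<in> labeled_dags"
    and w: "w \<in> polytrope_region G" and v: "v \<in> polytrope_region H"
    and eq: "equivalent_polytropes G w H v"
  obtains \<pi> where "bij \<pi>" "map_prod \<pi> \<pi> ` G = H"
    "tight_sets H v = (`) (map_prod \<pi> \<pi>) ` tight_sets G w"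
proof -
  let ?CG = "affine_covectors (kleene_columns G w)" and ?CH = "affine_covectors (kleene_columns H v)"
  obtain \<tau> \<sigma> where \<tau>: "bij \<tau>" and \<sigma>: "bij \<sigma>" and C: "(\<lambda>B. map_prod \<tau> \<sigma> ` B) ` ?CG = ?CH"
    using eq unfolding equivalent_polytropes_def tropically_equivalent_def by blast
  have "leading ({}\<^sup>*) 0 \<in> ?CG"
    unfolding affine_covectors_eq[OF G] using empty_in_tight_sets[OF G] by blast
  moreover have "leading ({}\<^sup>*) (0 :: (real, 'n) vec) = Id" by (auto simp: leading_def)
  ultimately have "map_prod \<tau> \<sigma> ` Id \<in> ?CH" using C by (metis imageI)
  then obtain T d where T: "T \<in> tight_sets H v" "map_prod \<tau> \<sigma> ` Id = leading (T\<^sup>*) d"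
    unfolding affine_covectors_eq[OF H] by blast
  have "T \<subseteq> H" using T(1) tight_edges_subset by (auto simp: tight_sets_def)
  \<comment> \<open>The image of the diagonal is a covector over \<open>H\<close>, so its pairs are
    joined by paths of \<open>H\<close>, along which labels do not decrease.\<close>
  have "(\<tau> j, \<sigma> j) \<in> H\<^sup>*" for j
  proof -
    have "(\<tau> j, \<sigma> j) \<in> map_prod \<tau> \<sigma> ` Id" by force
    then have "(\<tau> j, \<sigma> j) \<in> T\<^sup>*" unfolding T(2) by (simp add: leading_def)
    then show ?thesis using rtrancl_mono[OF \<open>T \<subseteq> H\<close>] by blast
  qed
  then have "\<tau> j \<le> \<sigma> j" for j using labeled_dag_rtrancl_le[OF H] by blast
  then have "k \<le> (\<sigma> \<circ> inv \<tau>) k" for k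
    by (metis \<tau> bij_is_surj comp_apply surj_f_inv_f)
  moreover have "bij (\<sigma> \<circ> inv \<tau>)"
    using \<tau> \<sigma> by (intro bij_comp bij_imp_bij_inv)
  ultimately have "(\<sigma> \<circ> inv \<tau>) k = k" for k
    by (intro bij_increasing_id)
  from this[of "\<tau> j" for j] have "\<sigma> = \<tau>"
    by (auto simp: inv_f_f[OF bij_is_inj[OF \<tau>]])
  let ?m = "map_prod \<tau> \<tau>"
  have "?m ` Id = Id" using bij_is_surj[OF \<tau>] by (force simp: surj_def)
  \<comment> \<open>With one permutation on both sides the diagonal is preserved, so the equivalence
    matches reflexive covectors with reflexive covectors.\<close>
  then have Id: "Id \<subseteq> ?m ` B \<longleftrightarrow> Id \<subseteq> B" for B
    using inj_image_subset_iff[of ?m Id B] bij_is_inj[OF \<tau>] prod.inj_map by metis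
  have "rtrancl ` tight_sets H v = {B \<in> (\<lambda>B. ?m ` B) ` ?CG. Id \<subseteq> B}"
    using C \<open>\<sigma> = \<tau>\<close> affine_covectors_reflexive[OF H polytrope_nonempty[OF H]] by simp
  also have "\<dots> = (\<lambda>B. ?m ` B) ` {B \<in> ?CG. Id \<subseteq> B}" using Id by blast
  also have "\<dots> = (\<lambda>B. ?m ` B) ` rtrancl ` tight_sets G w"
    using affine_covectors_reflexive[OF G polytrope_nonempty[OF G]] by simp
  finally have "covers ` rtrancl ` tight_sets H v = covers ` (\<lambda>B. ?m ` B) ` rtrancl ` tight_sets G w"
    by simp
  moreover have "covers ` rtrancl ` tight_sets H v = tight_sets H v"
    by (simp add: image_image covers_tight_set[OF H v])
  moreover have "covers ` (\<lambda>B. ?m ` B) ` rtrancl ` tight_sets G w = (`) ?m ` tight_sets G w"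
    by (simp add: image_image covers_map_prod[OF \<tau>] covers_tight_set[OF G w])
  ultimately have tight: "tight_sets H v = (`) ?m ` tight_sets G w" by simp
  \<comment> \<open>Each DAG is the union of its tight sets, so matching tight sets makes the
    permutation a graph isomorphism.\<close>
  have "?m ` G = ?m ` \<Union> (tight_sets G w)" by (simp add: tight_sets_cover[OF G w])
  also have "\<dots> = \<Union> (tight_sets H v)" unfolding tight by blast
  also have "\<dots> = H" by (rule tight_sets_cover[OF H v])
  finally show ?thesis using that \<tau> tight by blast
qed

section \<open>The weighted transitive reduction\<close>

lemma dpaths_mono: "G \<subseteq> H \<Longrightarrow> dpaths G j i \<subseteq> dpaths H j i"
  by (auto simp: dpaths_def elim!: successively_mono)

lemma path_weight_append:
  "p \<noteq> [] \<Longrightarrow> path_weight w (p @ q) = path_weight w p + path_weight w (last p # q)"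
  by (induction p rule: induct_list012) (auto simp: path_weight_def)

lemma dpaths_append:
  assumes "p \<in> dpaths G j k" "q \<in> dpaths G k i"
  shows "\<exists>r\<in>dpaths G j i. path_weight w r = path_weight w p + path_weight w q"
proof -
  have q: "q = k # tl q" and p: "p \<noteq> []" "last p = k"
    using assms by (auto simp: dpaths_def)
  have "successively (\<lambda>u v. (u, v) \<in> G) (k # tl q)" using assms(2) q by (simp add: dpaths_def)
  \<comment> \<open>\<open>p\<close> already ends in \<open>k\<close>, so the head of
    \<open>q\<close> is dropped.\<close>
  then have "p @ tl q \<in> dpaths G j i"
    using assms p q by (cases "tl q") (auto simp: dpaths_def successively_append_iff)
  moreover have "path_weight w (p @ tl q) = path_weight w p + path_weight w q"
    using path_weight_append[OF p(1), of w "tl q"] p(2) q by simp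
  ultimately show ?thesis by blast
qed

text \<open>Provides the decrease for an induction over label intervals: an edge of a path spans the
  whole interval only if it is the entire path.\<close>

lemma path_edges_subinterval:
  fixes p :: "'a::linorder list"
  assumes "sorted_wrt (<) p" "(a, b) \<in> set (zip p (tl p))"
  shows "hd p \<le> a \<and> a < b \<and> b \<le> last p \<and> (a = hd p \<longrightarrow> b = last p \<longrightarrow> p = [a, b])"
  using assms
proof (induction p rule: induct_list012)
  case (3 x y p)
  have less: "y < last (y # p)" if "p \<noteq> []"
    using "3.prems"(1) last_in_set[OF that] that by simp
  then have last: "y \<le> last (y # p)" by (cases "p = []") (auto intro: less_imp_le)
  have lastx: "last (x # y # p) = last (y # p)" by simp
  have "x < y" using "3.prems"(1) by simp
  from "3.prems"(2) consider "a = x" "b = y" | "(a, b) \<in> set (zip (y # p) (tl (y # p)))" by auto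
  then show ?case
  proof cases
    case 1
    moreover have "p = []" if "y = last (y # p)"
      using that less by fastforce
    ultimately show ?thesis using \<open>x < y\<close> last by (simp add: lastx del: last.simps)
  next
    case 2
    have "sorted_wrt (<) (y # p)" using "3.prems"(1) by simp
    from "3.IH"(2)[OF this 2] have "y \<le> a" "a < b" "b \<le> last (y # p)" by simp_all
    moreover from this \<open>x < y\<close> have "x < a" by simp
    ultimately show ?thesis by (auto simp: lastx simp del: last.simps)
  qed
qed auto

lemma dpaths_replace_edges:
  assumes "p \<noteq> []"
    and "\<And>a b. (a, b) \<in> set (zip p (tl p)) \<Longrightarrow> \<exists>q\<in>dpaths H a b. path_weight w q \<le> w $ (a, b)"
  shows "\<exists>q\<in>dpaths H (hd p) (last p). path_weight w q \<le> path_weight w p"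
  using assms
proof (induction p rule: induct_list012)
  case (2 x)
  then show ?case using dpaths_singleton[of x H] by auto
next
  case (3 x y p)
  have "\<exists>q\<in>dpaths H y (last (y # p)). path_weight w q \<le> path_weight w (y # p)"
    using "3.IH"(2) "3.prems"(2) by simp
  then obtain q where q: "q \<in> dpaths H y (last (y # p))" "path_weight w q \<le> path_weight w (y # p)"
    by blast
  obtain r where r: "r \<in> dpaths H x y" "path_weight w r \<le> w $ (x, y)"
    using "3.prems"(2)[of x y] by auto
  obtain s where "s \<in> dpaths H x (last (y # p))" "path_weight w s = path_weight w r + path_weight w q"
    using dpaths_append[OF r(1) q(1)] by blast
  then show ?case using q(2) r(2) by (intro bexI[of _ s]) (auto simp: path_weight_def)
qed simp

text \<open>A removed edge has a detour that is no heavier. Each edge of the detour spans a strictly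
  smaller label interval, so by induction it can be replaced by a path of surviving edges;
  concatenation keeps the bound.\<close>

lemma edge_of_reduction_path:
  fixes G :: "('n::{finite,linorder} \<times> 'n) set"
  assumes G: "G \<in> labeled_dags" and "(j, i) \<in> G"
  shows "\<exists>q\<in>dpaths (weighted_transitive_reduction G w) j i. path_weight w q \<le> w $ (j, i)"
  using assms(2)
proof (induction "card {j<..i}" arbitrary: j i rule: less_induct)
  case less
  let ?H = "weighted_transitive_reduction G w"
  show ?case
  proof (cases "(j, i) \<in> ?H")
    case True
    then show ?thesis by (intro bexI[OF _ dpaths_edge]) (simp_all add: path_weight_edge)
  next
    case False
    then obtain p where p: "p \<in> dpaths G j i" "p \<noteq> [j, i]" "path_weight w p \<le> w $ (j, i)"
      using less.prems by (auto simp: weighted_transitive_reduction_def path_weight_edge not_less)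
    have sorted: "sorted_wrt (<) p" by (rule dpaths_strict_sorted[OF G p(1)])
    have ends: "p \<noteq> []" "hd p = j" "last p = i" using p(1) by (auto simp: dpaths_def)
    have "\<exists>q\<in>dpaths ?H a b. path_weight w q \<le> w $ (a, b)" if ab: "(a, b) \<in> set (zip p (tl p))" for a b
    proof (rule less.hyps)
      have "j \<le> a" "a < b" "b \<le> i" and ne: "a = j \<longrightarrow> b \<noteq> i"
        using path_edges_subinterval[OF sorted ab] ends p(2) by auto
      then have "{a<..b} \<subseteq> {j<..i}" by auto
      moreover have "{a<..b} \<noteq> {j<..i}"
        using \<open>j \<le> a\<close> \<open>a < b\<close> \<open>b \<le> i\<close> ne
        by (metis greaterThanAtMost_iff less_irrefl order.order_iff_strict order.strict_trans1 order.strict_trans2)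
      ultimately show "card {a<..b} < card {j<..i}" by (intro psubset_card_mono) auto
      have "successively (\<lambda>u v. (u, v) \<in> G) p" using p(1) by (simp add: dpaths_def)
      then show "(a, b) \<in> G" using ab by (induction p rule: induct_list012) auto
    qed
    then have "\<exists>q\<in>dpaths ?H (hd p) (last p). path_weight w q \<le> path_weight w p"
      by (rule dpaths_replace_edges[OF ends(1)])
    then obtain q where "q \<in> dpaths ?H j i" "path_weight w q \<le> path_weight w p"
      unfolding ends(2,3) by blast
    then show ?thesis using p(3) by (intro bexI[of _ q]) auto
  qed
qed

definition restrict_weights :: "('n::finite \<times> 'n) set \<Rightarrow> real ^ ('n \<times> 'n) \<Rightarrow> real ^ ('n \<times> 'n)" where
  "restrict_weights H w = (\<chi> e. if e \<in> H then w $ e else 0)"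

lemma path_weight_restrict:
  "successively (\<lambda>u v. (u, v) \<in> H) p \<Longrightarrow> path_weight (restrict_weights H w) p = path_weight w p"
  by (induction p rule: induct_list012) (auto simp: path_weight_def restrict_weights_def)

lemma successively_edges:
  "successively (\<lambda>u v. (u, v) \<in> G) p \<Longrightarrow> (a, b) \<in> set (zip p (tl p)) \<Longrightarrow> (a, b) \<in> G"
  by (induction p rule: induct_list012) auto

context
  fixes G H :: "('n::{finite,linorder} \<times> 'n) set" and w v :: "real ^ ('n \<times> 'n)"
  assumes G: "G \<in> labeled_dags"
  defines "H \<equiv> weighted_transitive_reduction G w"
  defines "v \<equiv> restrict_weights H w"
begin

lemma reduction_subset: "H \<subseteq> G"
  by (auto simp: H_def weighted_transitive_reduction_def)

lemma reduction_labeled_dag: "H \<in> labeled_dags"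
  using G reduction_subset by (auto simp: labeled_dags_def)

lemma path_weight_reduction: "p \<in> dpaths H j i \<Longrightarrow> path_weight v p = path_weight w p"
  by (simp add: dpaths_def v_def path_weight_restrict)

text \<open>Deleted edges are replaceable at no extra cost, so no shortest distance changes. Since
  equivalence is expressed through these columns, any weighted DAG may be traded for its
  reduction.\<close>

lemma kleene_columns_reduction: "kleene_columns G w = kleene_columns H v"
proof (intro ext antisym)
  fix j i
  show "kleene_columns G w j i \<le> kleene_columns H v j i"
    unfolding kleene_columns_def
  proof (rule INF_mono)
    fix p assume p: "p \<in> dpaths H j i"
    then have "p \<in> dpaths G j i" using dpaths_mono[OF reduction_subset] by blast
    then show "\<exists>q\<in>dpaths G j i. ereal (path_weight w q) \<le> ereal (path_weight v p)"
      using path_weight_reduction[OF p] by force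
  qed
  show "kleene_columns H v j i \<le> kleene_columns G w j i"
    unfolding kleene_columns_def
  proof (rule INF_mono)
    fix p assume p: "p \<in> dpaths G j i"
    have "\<exists>q\<in>dpaths H (hd p) (last p). path_weight w q \<le> path_weight w p"
    proof (rule dpaths_replace_edges)
      show "p \<noteq> []" using p by (simp add: dpaths_def)
      fix a b assume "(a, b) \<in> set (zip p (tl p))"
      then have "(a, b) \<in> G" using p successively_edges by (auto simp: dpaths_def)
      then show "\<exists>q\<in>dpaths H a b. path_weight w q \<le> w $ (a, b)"
        unfolding H_def by (rule edge_of_reduction_path[OF G])
    qed
    moreover have "hd p = j" "last p = i" using p by (auto simp: dpaths_def)
    ultimately obtain q where "q \<in> dpaths H j i" "path_weight w q \<le> path_weight w p" by auto
    then show "\<exists>q\<in>dpaths H j i. ereal (path_weight v q) \<le> ereal (path_weight w p)"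
      using path_weight_reduction by (intro bexI[of _ q]) auto
  qed
qed

text \<open>An edge that beats all competing paths in \<open>G\<close> beats in particular those
  within the subgraph.\<close>

lemma reduction_in_polytrope_region: "v \<in> polytrope_region H"
  unfolding polytrope_region_iff
proof (intro conjI allI impI ballI)
  show "v \<in> weights H" by (simp add: v_def restrict_weights_def weights_def)
  fix j i p assume e: "(j, i) \<in> H" and p: "p \<in> dpaths H j i" "p \<noteq> [j, i]"
  have "p \<in> dpaths G j i" using p(1) dpaths_mono[OF reduction_subset] by blast
  then have "w $ (j, i) < path_weight w p"
    using e p(2) by (auto simp: H_def weighted_transitive_reduction_def path_weight_edge)
  then show "v $ (j, i) < path_weight v p"
    using e path_weight_reduction[OF p(1)] by (simp add: v_def restrict_weights_def)
qed

end

lemma path_weight_permute: "path_weight (permute_weights \<pi> w) p = path_weight w (map (inv \<pi>) p)"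
  by (induction p rule: induct_list012) (auto simp: path_weight_def permute_weights_nth)

lemma permute_in_polytrope_region:
  fixes G :: "('n::{finite,linorder} \<times> 'n) set"
  assumes \<pi>: "bij \<pi>" and GH: "map_prod \<pi> \<pi> ` G = H" and w: "w \<in> polytrope_region G"
  shows "permute_weights \<pi> w \<in> polytrope_region H"
proof -
  have mem: "(j, i) \<in> H \<longleftrightarrow> (inv \<pi> j, inv \<pi> i) \<in> G" for j i
    using map_prod_image_iff[OF \<pi>, of j i G] GH by simp
  have "permute_weights \<pi> w $ (j, i) = 0" if "(j, i) \<notin> H" for j i
    using that w by (simp add: permute_weights_nth mem polytrope_region_iff weights_def)
  then have "permute_weights \<pi> w \<in> weights H" by (auto simp: weights_def)
  moreover have "permute_weights \<pi> w $ (j, i) < path_weight (permute_weights \<pi> w) p"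
    if e: "(j, i) \<in> H" and p: "p \<in> dpaths H j i" "p \<noteq> [j, i]" for j i p
  proof -
    have "map (inv \<pi>) p \<in> dpaths G (inv \<pi> j) (inv \<pi> i)"
      using p(1) by (auto simp: dpaths_def hd_map last_map successively_map mem)
    moreover have "map (inv \<pi>) p \<noteq> map (inv \<pi>) [j, i]"
      using p(2) bij_is_inj[OF bij_imp_bij_inv[OF \<pi>]] by (metis inj_map_eq_map)
    ultimately show ?thesis
      using w e by (auto simp: polytrope_region_iff path_weight_permute permute_weights_nth mem)
  qed
  ultimately show ?thesis by (simp add: polytrope_region_iff)
qed

section \<open>The moduli space\<close>

lemma trop_point_in_moduli_space:
  assumes R: "R \<subseteq> labeled_dags" and G: "G \<in> R" and w: "w \<in> weights G"
    and "trop_point G w \<in> moduli_space R"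
  shows "w \<in> polytrope_region G"
proof -
  obtain H v where H: "H \<in> R" "v \<in> polytrope_region H" "trop_point G w = trop_point H v"
    using assms(4) unfolding moduli_space_eq[OF R] by blast
  then have "G = H \<and> w = v"
    using R G w polytrope_region_subset_weights by (intro trop_point_inject) auto
  then show ?thesis using H(2) by simp
qed

lemma dag_representative_unique:
  assumes "dag_representatives R" "G \<in> R" "H \<in> R" "dag_iso G H"
  shows "G = H"
proof -
  have "G \<in> labeled_dags" using assms by (auto simp: dag_representatives_def)
  moreover have "dag_iso G G" unfolding dag_iso_def by (intro exI[of _ id]) (simp add: map_prod.id)
  ultimately show ?thesis using assms unfolding dag_representatives_def by blast
qed

text \<open>Reduction moves the weights into an open region without changing the columns; an
  isomorphism to the chosen representative then only relabels.\<close>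

lemma equivalent_to_moduli_point:
  fixes R :: "('n::{finite,linorder} \<times> 'n) set set"
  assumes R: "dag_representatives R" and G: "G \<in> labeled_dags"
  shows "\<exists>H v. H \<in> R \<and> v \<in> weights H \<and> trop_point H v \<in> moduli_space R \<and> equivalent_polytropes G w H v"
proof -
  have RL: "R \<subseteq> labeled_dags" using R by (simp add: dag_representatives_def)
  define G' where "G' = weighted_transitive_reduction G w"
  define w' where "w' = restrict_weights G' w"
  have G': "G' \<in> labeled_dags" unfolding G'_def by (rule reduction_labeled_dag[OF G])
  have w': "w' \<in> polytrope_region G'"
    unfolding w'_def G'_def by (rule reduction_in_polytrope_region[OF G])
  obtain H where H: "H \<in> R" "dag_iso G' H"
    using R G' unfolding dag_representatives_def by blast
  then obtain \<pi> where \<pi>: "bij \<pi>" "map_prod \<pi> \<pi> ` G' = H" by (auto simp: dag_iso_def)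
  let ?v = "permute_weights \<pi> w'"
  have HL: "H \<in> labeled_dags" using H(1) RL by blast
  have v: "?v \<in> polytrope_region H" by (rule permute_in_polytrope_region[OF \<pi> w'])
  have "equivalent_polytropes G' w' H ?v"
    by (rule equivalent_polytropesI[OF \<pi>(1) G' HL tight_sets_permute[OF \<pi>(1) G' HL \<pi>(2)]])
  moreover have "kleene_columns G w = kleene_columns G' w'"
    unfolding w'_def G'_def by (rule kleene_columns_reduction[OF G])
  ultimately have "equivalent_polytropes G w H ?v" by (simp add: equivalent_polytropes_def)
  moreover have "trop_point H ?v \<in> moduli_space R"
    unfolding moduli_space_eq[OF RL] using H(1) v by blast
  moreover have "?v \<in> weights H" using v polytrope_region_subset_weights by blast
  ultimately show ?thesis using H(1) by blast
qed

text \<open>An equivalence induces an isomorphism of the DAGs; two isomorphic representatives are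
  equal, so the isomorphism is an automorphism. Tight sets and origin cells determine each
  other.\<close>

lemma equivalent_polytropes_iff:
  fixes R :: "('n::{finite,linorder} \<times> 'n) set set"
  assumes R: "dag_representatives R" and "G \<in> R" "H \<in> R"
    and w: "w \<in> polytrope_region G" and v: "v \<in> polytrope_region H"
  shows "equivalent_polytropes G w H v \<longleftrightarrow>
    G = H \<and> (\<exists>\<pi>. bij \<pi> \<and> map_prod \<pi> \<pi> ` G = G \<and>
      origin_cells G (permute_weights \<pi> w) = origin_cells G v)"
proof
  have GH: "G \<in> labeled_dags" "H \<in> labeled_dags"
    using R assms(2,3) by (auto simp: dag_representatives_def)
  {
    assume "equivalent_polytropes G w H v"
    then obtain \<pi> where \<pi>: "bij \<pi>" "map_prod \<pi> \<pi> ` G = H"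
      "tight_sets H v = (`) (map_prod \<pi> \<pi>) ` tight_sets G w"
      by (rule equivalent_polytropesD[OF GH w v])
    then have "dag_iso G H" unfolding dag_iso_def by blast
    then have "G = H" using dag_representative_unique R assms(2,3) by blast
    moreover have "tight_sets H (permute_weights \<pi> w) = tight_sets H v"
      using tight_sets_permute[OF \<pi>(1) GH \<pi>(2)] \<pi>(3) by simp
    then have "origin_cells H (permute_weights \<pi> w) = origin_cells H v"
      by (rule origin_cells_eq_iff[OF GH(2), THEN iffD2])
    ultimately show "G = H \<and> (\<exists>\<pi>. bij \<pi> \<and> map_prod \<pi> \<pi> ` G = G \<and>
        origin_cells G (permute_weights \<pi> w) = origin_cells G v)"
      using \<pi>(1,2) by blast
  next
    assume "G = H \<and> (\<exists>\<pi>. bij \<pi> \<and> map_prod \<pi> \<pi> ` G = G \<and>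
        origin_cells G (permute_weights \<pi> w) = origin_cells G v)"
    then obtain \<pi> where \<pi>: "G = H" "bij \<pi>" "map_prod \<pi> \<pi> ` G = G"
      "tight_sets G (permute_weights \<pi> w) = tight_sets G v"
      by (auto simp: origin_cells_eq_iff[OF GH(1)])
    then have "tight_sets G v = (`) (map_prod \<pi> \<pi>) ` tight_sets G w"
      using tight_sets_permute[OF \<pi>(2) GH(1) GH(1) \<pi>(3)] by simp
    then show "equivalent_polytropes G w H v"
      using equivalent_polytropesI[OF \<pi>(2) GH(1) GH(1)] \<pi>(1) by simp
  }
qed

text \<open>A cone belongs to one stratum and carries one regular subdivision, so the tight sets
  agree and the identity relabeling is an equivalence.\<close>

lemma equivalent_in_moduli_cone:
  fixes R :: "('n::{finite,linorder} \<times> 'n) set set"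
  assumes R: "R \<subseteq> labeled_dags" and c: "c \<in> moduli_cones R"
    and "G \<in> R" "w \<in> weights G" "H \<in> R" "v \<in> weights H"
    and "trop_point G w \<in> c" "trop_point H v \<in> c"
  shows "equivalent_polytropes G w H v"
proof -
  obtain K \<sigma> where K: "K \<in> R" "\<sigma> \<in> stratum_cones K" "c = trop_point K ` rel_interior \<sigma>"
    using c by (auto simp: moduli_cones_def)
  have KL: "K \<in> labeled_dags" using K(1) R by blast
  have *: "F = K \<and> u \<in> rel_interior \<sigma>" if F: "F \<in> R" "u \<in> weights F" "trop_point F u \<in> c" for F u
  proof -
    obtain u' where u': "u' \<in> rel_interior \<sigma>" "trop_point F u = trop_point K u'" using F(3) K(3) by blast
    have "u' \<in> weights K"
      using stratum_cone_rel_interior(1)[OF KL K(2) u'(1)] polytrope_region_subset_weights by blast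
    then have "F = K \<and> u = u'" using F R KL u'(2) by (intro trop_point_inject) auto
    then show ?thesis using u'(1) by simp
  qed
  have "G = K" "w \<in> rel_interior \<sigma>" "H = K" "v \<in> rel_interior \<sigma>" using *[OF assms(3,4,7)] *[OF assms(5,6,8)] by simp_all
  then have "origin_cells K w = origin_cells K v"
    by (intro origin_cells_eq_of_rel_interior[OF KL K(2)])
  then have "tight_sets K w = tight_sets K v"
    by (rule origin_cells_eq_iff[OF KL, THEN iffD1])
  then have "equivalent_polytropes K w K v"
    by (intro equivalent_polytropesI[OF bij_id KL KL]) (simp add: map_prod.id)
  then show ?thesis using \<open>G = K\<close> \<open>H = K\<close> by simp
qed

text \<open>The moduli property is rendered in three parts: every weighted labeled DAG is equivalent
  to a point of the space, each cone stays within one equivalence class, and equivalence of two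
  points is decided by the origin cells up to automorphism. By the last part, distinct cones share a
  class only if their origin cells correspond under an automorphism of their common DAG.\<close>

theorem theorem4p17:
  fixes R :: "('n::{finite,linorder} \<times> 'n) set set"
  assumes "dag_representatives R"
  shows "(disjoint_family_on open_stratum R \<and>
          (\<forall>G\<in>R. restricted_polyhedral_fan (polytrope_region G) (stratum_cones G)) \<and>
          moduli_space R \<subseteq> trop_space \<and>
          polyhedral_subspace (moduli_space R) \<and>
          partition_on (moduli_space R) (moduli_cones R)) \<and>
         (\<forall>G\<in>labeled_dags. \<forall>w\<in>weights G.
            polytrope_dim G w = int CARD('n) - 1 \<and>
            (\<exists>H v. H \<in> R \<and> v \<in> weights H \<and> trop_point H v \<in> moduli_space R \<and>
                   equivalent_polytropes G w H v)) \<and>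
         (\<forall>c\<in>moduli_cones R. \<forall>G\<in>R. \<forall>w\<in>weights G. \<forall>H\<in>R. \<forall>v\<in>weights H.
            trop_point G w \<in> c \<and> trop_point H v \<in> c \<longrightarrow> equivalent_polytropes G w H v) \<and>
         (\<forall>G\<in>R. \<forall>w\<in>weights G. \<forall>H\<in>R. \<forall>v\<in>weights H.
            trop_point G w \<in> moduli_space R \<and> trop_point H v \<in> moduli_space R \<longrightarrow>
            (equivalent_polytropes G w H v \<longleftrightarrow>
             G = H \<and> (\<exists>\<pi>. bij \<pi> \<and> map_prod \<pi> \<pi> ` G = G \<and>
                          origin_cells G (permute_weights \<pi> w) = origin_cells G v)))"
proof -
  have R: "R \<subseteq> labeled_dags" using assms by (simp add: dag_representatives_def)
  show ?thesis
  proof (intro conjI)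
    show "disjoint_family_on open_stratum R" by (rule disjoint_open_strata[OF R])
    show "\<forall>G\<in>R. restricted_polyhedral_fan (polytrope_region G) (stratum_cones G)"
      using restricted_polyhedral_fan_stratum_cones R by blast
    show "moduli_space R \<subseteq> trop_space" by (rule moduli_space_subset_trop_space[OF R])
    show "polyhedral_subspace (moduli_space R)" by (rule polyhedral_subspace_moduli_space[OF R])
    show "partition_on (moduli_space R) (moduli_cones R)" by (rule partition_moduli_cones[OF R])
    show "\<forall>G\<in>labeled_dags. \<forall>w\<in>weights G. polytrope_dim G w = int CARD('n) - 1 \<and>
        (\<exists>H v. H \<in> R \<and> v \<in> weights H \<and> trop_point H v \<in> moduli_space R \<and> equivalent_polytropes G w H v)"
      using polytrope_dim equivalent_to_moduli_point[OF assms] by blast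
    show "\<forall>c\<in>moduli_cones R. \<forall>G\<in>R. \<forall>w\<in>weights G. \<forall>H\<in>R. \<forall>v\<in>weights H.
        trop_point G w \<in> c \<and> trop_point H v \<in> c \<longrightarrow> equivalent_polytropes G w H v"
      using equivalent_in_moduli_cone[OF R] by blast
    show "\<forall>G\<in>R. \<forall>w\<in>weights G. \<forall>H\<in>R. \<forall>v\<in>weights H.
        trop_point G w \<in> moduli_space R \<and> trop_point H v \<in> moduli_space R \<longrightarrow>
        (equivalent_polytropes G w H v \<longleftrightarrow>
         G = H \<and> (\<exists>\<pi>. bij \<pi> \<and> map_prod \<pi> \<pi> ` G = G \<and>
                      origin_cells G (permute_weights \<pi> w) = origin_cells G v))"
    proof (intro ballI impI)
      fix G w H v
      assume "G \<in> R" "w \<in> weights G" "H \<in> R" "v \<in> weights H"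
        and "trop_point G w \<in> moduli_space R \<and> trop_point H v \<in> moduli_space R"
      then show "equivalent_polytropes G w H v \<longleftrightarrow>
         G = H \<and> (\<exists>\<pi>. bij \<pi> \<and> map_prod \<pi> \<pi> ` G = G \<and>
                      origin_cells G (permute_weights \<pi> w) = origin_cells G v)"
        by (intro equivalent_polytropes_iff[OF assms]) (auto intro: trop_point_in_moduli_space[OF R])
    qed
  qed
qed

end
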